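(* Let $\varepsilon>0$ be fixed. For all $A,B\ge1$ and all odd $n\in\mathbb{N}$, writing $t$ for the number of distinct prime factors of $n$, we have $$ \mathop{\sum_{|a|\le A}\sum_{|b|\le B}}_{(ab\Delta(a,b),n)=1}\tilde a_{E(a,b)}(n)=4AB\,S(n)+O_{\varepsilon,t}\left(d(n)s(n)^{1/2+\varepsilon}(A+B)\right). $$
   Context: For $(a,b)\in\mathbb{Z}^2$, $\Delta(a,b):=4a^3+27b^2$; when $\Delta(a,b)\neq0$, $E(a,b)$ is the elliptic curve $y^2=x^3+ax+b$ over $\mathbb{Q}$, pairs with $\Delta(a,b)=0$ being excluded from the sums. For an elliptic curve $E/\mathbb{Q}$, $L(E,s)=\sum_{n\ge1}a_E(n)n^{-s}$ is its Hasse–Weil $L$-function and $\tilde a_E(n):=a_E(n)/\sqrt n$. $d(n)$ is the number of divisors of $n$, $s(n)$ is the largest squarefree divisor of $n$, and $$S(n):=\frac{1}{s(n)^2}\mathop{\sum_{a=1}^{s(n)}\sum_{b=1}^{s(n)}}_{(ab\Delta(a,b),n)=1}\tilde a_{E(a,b)}(n).$$ *)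

theory Defs
  imports
    Complex_Main
    "HOL-Computational_Algebra.Formal_Power_Series"
    "HOL-Computational_Algebra.Squarefree"
begin

text \<open>
  Weierstrass equations y^2 + a1 x y + a3 y = x^3 + a2 x^2 + a4 x + a6 with integer coefficients.
\<close>

datatype weierstrass =
  Weierstrass (wa1: int) (wa2: int) (wa3: int) (wa4: int) (wa6: int)

definition disc :: "weierstrass \<Rightarrow> int" where
  "disc W =
    (let b2 = (wa1 W)^2 + 4 * wa2 W;
         b4 = 2 * wa4 W + wa1 W * wa3 W;
         b6 = (wa3 W)^2 + 4 * wa6 W;
         b8 = (wa1 W)^2 * wa6 W + 4 * wa2 W * wa6 W - wa1 W * wa3 W * wa4 W
              + wa2 W * (wa3 W)^2 - (wa4 W)^2
     in - (b2^2 * b8) - 8 * b4^3 - 27 * b6^2 + 9 * b2 * b4 * b6)"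

text \<open>
  Isomorphism over the rationals: W' arises from W by the substitution
  x = u^2 x' + r, y = u^3 y' + s u^2 x' + t.
\<close>

definition isomorphic_over_Q :: "weierstrass \<Rightarrow> weierstrass \<Rightarrow> bool" where
  "isomorphic_over_Q W W' \<longleftrightarrow>
    (\<exists>u r s t :: rat. u \<noteq> 0 \<and>
      (let a1 = of_int (wa1 W); a2 = of_int (wa2 W); a3 = of_int (wa3 W);
           a4 = of_int (wa4 W); a6 = of_int (wa6 W)
       in u * of_int (wa1 W') = a1 + 2 * s \<and>
          u^2 * of_int (wa2 W') = a2 - s * a1 + 3 * r - s^2 \<and>
          u^3 * of_int (wa3 W') = a3 + r * a1 + 2 * t \<and>
          u^4 * of_int (wa4 W') = a4 - s * a3 + 2 * r * a2 - (t + r * s) * a1 + 3 * r^2 - 2 * s * t \<and>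
          u^6 * of_int (wa6 W') = a6 + r * a4 + r^2 * a2 + r^3 - t * a3 - t^2 - r * t * a1))"

text \<open>
  Minimal Weierstrass equations at a prime p. Asking for integer coefficients rather than
  p-integral rational ones does not change the minimum: scaling by an integer u prime to p clears
  the other denominators and leaves the p-adic valuation of the discriminant unchanged.
\<close>

definition minimal_model_at :: "nat \<Rightarrow> weierstrass \<Rightarrow> weierstrass \<Rightarrow> bool" where
  "minimal_model_at p E W \<longleftrightarrow>
    isomorphic_over_Q E W \<and>
    (\<forall>W'. isomorphic_over_Q E W' \<longrightarrow>
       multiplicity (int p) (disc W) \<le> multiplicity (int p) (disc W'))"

text \<open>
  Two minimal models at p have isomorphic reductions modulo p, so nothing below depends on the
  choice made here.
\<close>

definition minimal_model :: "nat \<Rightarrow> weierstrass \<Rightarrow> weierstrass" where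
  "minimal_model p E = (SOME W. minimal_model_at p E W)"

definition good_reduction :: "weierstrass \<Rightarrow> nat \<Rightarrow> bool" where
  "good_reduction E p \<longleftrightarrow> \<not> int p dvd disc (minimal_model p E)"

text \<open>
  The summand 1 is the point at infinity. A singular point of the reduced curve is counted too.
\<close>

definition num_points_mod :: "nat \<Rightarrow> weierstrass \<Rightarrow> nat" where
  "num_points_mod p W =
    card {(x, y). x \<in> {0..<int p} \<and> y \<in> {0..<int p} \<and>
            (y^2 + wa1 W * x * y + wa3 W * y) mod int p =
            (x^3 + wa2 W * x^2 + wa4 W * x + wa6 W) mod int p} + 1"

text \<open>
  At primes of bad reduction the formula for the trace yields the usual values 1, -1 and 0 for
  split multiplicative, nonsplit multiplicative and additive reduction: the reduced curve then has
  p, p + 2 and p + 1 points, respectively, the singular one included.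
\<close>

definition frob_trace :: "weierstrass \<Rightarrow> nat \<Rightarrow> int" where
  "frob_trace E p = int p + 1 - int (num_points_mod p (minimal_model p E))"

text \<open>
  The reciprocal of the Euler factor at p, as a polynomial in X = p^(-s).
\<close>

definition euler_poly :: "weierstrass \<Rightarrow> nat \<Rightarrow> real fps" where
  "euler_poly E p =
    1 - fps_const (of_int (frob_trace E p)) * fps_X
      + (if good_reduction E p then fps_const (of_nat p) * fps_X^2 else 0)"

text \<open>
  The n-th Dirichlet coefficient (n > 0) of the Euler product of all 1 / euler_poly E p at
  X = p^(-s), that is, of the Hasse--Weil L-function of E.
\<close>

definition L_coeff :: "weierstrass \<Rightarrow> nat \<Rightarrow> real" where
  "L_coeff E n = (\<Prod>p\<in>prime_factors n. fps_nth (inverse (euler_poly E p)) (multiplicity p n))"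

definition L_coeff_normalized :: "weierstrass \<Rightarrow> nat \<Rightarrow> real" where
  "L_coeff_normalized E n = L_coeff E n / sqrt (real n)"

definition Delta :: "int \<Rightarrow> int \<Rightarrow> int" where
  "Delta a b = 4 * a^3 + 27 * b^2"

definition curve :: "int \<Rightarrow> int \<Rightarrow> weierstrass" where
  "curve a b = Weierstrass 0 0 0 a b"

lemma disc_curve: "disc (curve a b) = - 16 * Delta a b"
  by (simp add: disc_def curve_def Delta_def Let_def power_mult_distrib)

lemma isomorphic_over_Q_refl: "isomorphic_over_Q W W"
  unfolding isomorphic_over_Q_def Let_def
  by (rule exI[of _ 1], rule exI[of _ 0], rule exI[of _ 0], rule exI[of _ 0]) simp

lemma minimal_model_at_minimal_model: "minimal_model_at p E (minimal_model p E)"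
proof -
  obtain W where "isomorphic_over_Q E W"
    and "\<forall>W'. isomorphic_over_Q E W' \<longrightarrow>
           multiplicity (int p) (disc W) \<le> multiplicity (int p) (disc W')"
    using ex_has_least_nat[of "isomorphic_over_Q E" E "\<lambda>W. multiplicity (int p) (disc W)"]
      isomorphic_over_Q_refl by blast
  then have "\<exists>W. minimal_model_at p E W"
    unfolding minimal_model_at_def by blast
  then show ?thesis
    unfolding minimal_model_def by (rule someI_ex)
qed

definition num_divisors :: "nat \<Rightarrow> nat" where
  "num_divisors n = card {d. d dvd n}"

definition max_squarefree_divisor :: "nat \<Rightarrow> nat" where
  "max_squarefree_divisor n = Max {d. d dvd n \<and> squarefree d}"

definition admissible :: "nat \<Rightarrow> int \<Rightarrow> int \<Rightarrow> bool" where
  "admissible n a b \<longleftrightarrow> Delta a b \<noteq> 0 \<and> coprime (a * b * Delta a b) (int n)"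

definition mean_coeff :: "nat \<Rightarrow> real" where
  "mean_coeff n =
    (\<Sum>(a, b) \<in> {(a, b). a \<in> {1..int (max_squarefree_divisor n)} \<and>
                         b \<in> {1..int (max_squarefree_divisor n)} \<and> admissible n a b}.
       L_coeff_normalized (curve a b) n) / real (max_squarefree_divisor n)^2"

end

theory Submission
  imports Defs "HOL-Number_Theory.Number_Theory" "HOL-Computational_Algebra.Computational_Algebra"
    "HOL-Computational_Algebra.Field_as_Ring"
begin

text \<open>
  The summand depends only on a and b modulo s = s(n), it is invariant under
  (a, b) \<mapsto> (l^4 a, l^6 b) for units l modulo s, and the Hasse bound gives d(n) as an upper bound.
  Completing the sum with additive characters modulo s, the zero frequency yields the main term.
  In the rest, averaging over l and applying Parseval and Cauchy--Schwarz leaves fourth moments of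
  the incomplete sums, that is, weighted counts of solutions of x y = z w modulo the divisors of s.
  Their diagonal dominates as soon as both sides of the box exceed the square root of s, and the
  divisor bound controls the number of representations; for smaller boxes the claim is trivial.

  The Hasse bound is proved by Manin's method, with x-coordinates only. On the quadratic twist
  f(t) y^2 = f(x) over the field of rational functions in t over the field with p elements, let
  Q = (t, 1) and P = (t^p, f(t)^((p-1)/2)). The heights h(k) of the x-coordinates of P + k Q
  satisfy h(k+1) + h(k-1) = 2 h(k) + 2, hence h(k) = k^2 + c k + p, where c is the trace of
  Frobenius up to sign. As h(k) is nonnegative for all integers k, c^2 is at most 4 p.
\<close>

subsection \<open>Heights of x-coordinates on the quadratic twist\<close>


text \<open>No cancellation in any individual complete sum is used: of the summand only its size and
  its invariance enter. For A, B up to s, Parseval and Cauchy--Schwarz by themselves would give an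
  error of about d(n) s sqrt(AB); averaging over an orbit of about s units gains the missing factor
  sqrt(s). The units act through l^4 and l^6, so the cost is the number of roots of l^i = v modulo
  s, at most 6^t, and the ratio s/phi(s), at most 2^t. This is where the constant depends on t.

  The L-function is defined by an arbitrary choice of minimal Weierstrass equations, whereas
  periodicity and invariance are visible only on y^2 = x^3 + ax + b. Hence point counts have to be
  transported along rational substitutions, also at the prime 3, where 3 cannot be inverted.

  Working with x-coordinates replaces the addition of points by Vieta's formulas for a quadratic.
  The height law is an exact equality, rather than one up to a bounded error, because the
  coefficients of this quadratic have no common factor; without exactness the constant 4 in the
  Hasse bound would be lost.\<close>

text \<open>
  Let P and Q = (t, 1) be points of the quadratic twist f(t) y^2 = f(x) with f(x) = x^3 + a x + b,
  and let x(P) = M / N. The x-coordinates of P + Q and P - Q are the roots of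
  xadd2 z^2 - 2 xadd1 z + xadd0. Homogenising in z gives xbiq, which relates P and P + Q
  symmetrically; this is all of the group law that is used.
\<close>

definition xadd2 :: "'a::comm_ring_1 \<Rightarrow> 'a \<Rightarrow> 'a \<Rightarrow> 'a" where
  "xadd2 t M N = (M - t * N)^2"

definition xadd1 :: "'a::comm_ring_1 \<Rightarrow> 'a \<Rightarrow> 'a \<Rightarrow> 'a \<Rightarrow> 'a \<Rightarrow> 'a" where
  "xadd1 a b t M N = (M * t + a * N) * (M + t * N) + 2 * b * N^2"

definition xadd0 :: "'a::comm_ring_1 \<Rightarrow> 'a \<Rightarrow> 'a \<Rightarrow> 'a \<Rightarrow> 'a \<Rightarrow> 'a" where
  "xadd0 a b t M N = (M * t - a * N)^2 - 4 * b * N * (M + t * N)"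

definition xbiq :: "'a::comm_ring_1 \<Rightarrow> 'a \<Rightarrow> 'a \<Rightarrow> 'a \<times> 'a \<Rightarrow> 'a \<times> 'a \<Rightarrow> 'a" where
  "xbiq a b t P Q = xadd2 t (fst P) (snd P) * fst Q ^ 2
     - 2 * xadd1 a b t (fst P) (snd P) * fst Q * snd Q
     + xadd0 a b t (fst P) (snd P) * snd Q ^ 2"

lemma xbiq_sym: "xbiq a b t P Q = xbiq a b t Q P"
  unfolding xbiq_def xadd2_def xadd1_def xadd0_def
  by (simp add: algebra_simps power2_eq_square)

text \<open>At x(P) = t the leading coefficient \<open>xadd2\<close> vanishes and the quadratic
  degenerates: one root is at infinity, and the other, \<open>xadd0 / (2 * xadd1)\<close>, is the
  duplication formula for x(2Q).\<close>

lemma xadd_at_pole: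
  "xadd1 a b t (t * N) N = 2 * (t^3 + a * t + b) * N^2"
  "xadd0 a b t (t * N) N = ((t^2 - a)^2 - 8 * b * t) * N^2"
  by (simp_all add: xadd1_def xadd0_def algebra_simps power2_eq_square power3_eq_cube)

text \<open>The Bezout relation behind the duplication formula: its numerator and the cubic in its
  denominator have a common zero only if the discriminant vanishes.\<close>

lemma resultant_identity:
  fixes a b t :: "'a::comm_ring_1"
  shows "(3 * t^2 + 4 * a) * ((t^2 - a)^2 - 8 * b * t)
      - (3 * t^3 - 5 * a * t - 27 * b) * (t^3 + a * t + b) = 4 * a^3 + 27 * b^2"
  by (simp add: algebra_simps power2_eq_square power3_eq_cube)

text \<open>Vieta's formulas in projective form: by Gauss's lemma, a quadratic with the root M/N in
  lowest terms splits as (N z - M)(N' z - M') without denominators. The case \<open>N = 0\<close>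
  stands for the point at infinity.\<close>

lemma other_root:
  fixes M N q0 q1 q2 :: "'a::{factorial_ring_gcd,ring_gcd,idom}"
  assumes cop: "coprime M N" and root: "q2 * M^2 - q1 * M * N + q0 * N^2 = 0"
  obtains M' N' where "q2 = N * N'" "q1 = M * N' + N * M'" "q0 = M * M'"
proof (cases "N = 0")
  case True
  then have "is_unit M" using cop by simp
  then obtain v where v: "1 = M * v" by (auto elim: dvdE)
  then have "M \<noteq> 0" by auto
  with root True have "q2 = 0" by simp
  have "q1 = M * (v * q1)" "q0 = M * (v * q0)"
    using v by (simp_all flip: mult.assoc)
  with \<open>q2 = 0\<close> True show ?thesis by (intro that[of "v * q1" "v * q0"]) auto
next
  case False
  have "N dvd q2 * M^2"
  proof -
    have "q2 * M^2 = N * (q1 * M - q0 * N)"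
      using root by (simp add: algebra_simps power2_eq_square)
    then show ?thesis by simp
  qed
  then have "N dvd q2"
    using cop by (simp add: coprime_commute coprime_dvd_mult_left_iff)
  then obtain N' where N': "q2 = N * N'" by auto
  have "N * (N' * M^2 - q1 * M + q0 * N) = 0"
    using root by (simp add: N' algebra_simps power2_eq_square)
  with False have eq: "N' * M^2 - q1 * M + q0 * N = 0" by simp
  have "N dvd (q1 - M * N') * M"
  proof -
    have "(q1 - M * N') * M = N * q0"
      using eq by (simp add: algebra_simps power2_eq_square)
    then show ?thesis by simp
  qed
  then have "N dvd q1 - M * N'"
    using cop by (simp add: coprime_commute coprime_dvd_mult_left_iff)
  then obtain M' where M': "q1 - M * N' = N * M'" by auto
  then have q1: "q1 = M * N' + N * M'" by (simp add: algebra_simps)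
  have "N * (q0 - M * M') = 0"
    using eq by (simp add: q1 algebra_simps power2_eq_square)
  with False have "q0 = M * M'" by simp
  with N' q1 show ?thesis by (intro that)
qed

lemma coeff_mult_bounded:
  fixes p q :: "'a::comm_ring_1 poly"
  assumes "degree p \<le> m" "degree q \<le> n"
  shows "coeff (p * q) (m + n) = coeff p m * coeff q n"
proof (cases "degree p = m \<and> degree q = n")
  case True
  then show ?thesis using coeff_mult_degree_sum[of p q] by auto
next
  case False
  then have "coeff p m * coeff q n = 0"
    using assms by (metis coeff_eq_0 le_neq_implies_less mult_not_zero)
  moreover have "degree (p * q) < m + n"
    using False assms degree_mult_le[of p q] by linarith
  ultimately show ?thesis by (simp add: coeff_eq_0)
qed

text \<open>For coprime entries this is the degree of the rational function
  \<open>fst P / snd P\<close>.\<close>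

definition height :: "'a::zero poly \<times> 'a poly \<Rightarrow> nat" where
  "height P = max (degree (fst P)) (degree (snd P))"

lemma height_coeff_nonzero:
  assumes "fst P \<noteq> 0 \<or> snd P \<noteq> 0"
  shows "coeff (fst P) (height P) \<noteq> 0 \<or> coeff (snd P) (height P) \<noteq> 0"
proof -
  consider "degree (fst P) > degree (snd P)" | "degree (fst P) < degree (snd P)"
    | "degree (fst P) = degree (snd P)" by linarith
  then show ?thesis
  proof cases
    case 1 then show ?thesis by (auto simp: height_def max_def)
  next
    case 2 then show ?thesis by (auto simp: height_def max_def)
  next
    case 3 then show ?thesis using assms by (auto simp: height_def)
        (metis leading_coeff_0_iff)+
  qed
qed

text \<open>The height of the projective point (u : v : w), as a relation: the degree
  \<open>d\<close> must be attained, which also excludes the zero triple.\<close>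

definition height3 :: "'a::zero poly \<Rightarrow> 'a poly \<Rightarrow> 'a poly \<Rightarrow> nat \<Rightarrow> bool" where
  "height3 u v w d \<longleftrightarrow> degree u \<le> d \<and> degree v \<le> d \<and> degree w \<le> d
     \<and> (coeff u d \<noteq> 0 \<or> coeff v d \<noteq> 0 \<or> coeff w d \<noteq> 0)"

lemma height3_unique: "height3 u v w d \<Longrightarrow> height3 u v w e \<Longrightarrow> d = e"
  unfolding height3_def by (metis coeff_eq_0 linorder_neqE_nat order_le_less_trans)

text \<open>Gauss's lemma at the infinite place.\<close>

lemma height3_product:
  fixes M N M' N' :: "'a::idom poly"
  assumes "M \<noteq> 0 \<or> N \<noteq> 0" "M' \<noteq> 0 \<or> N' \<noteq> 0"
  shows "height3 (N * N') (M * N' + N * M') (M * M') (height (M, N) + height (M', N'))"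
proof -
  define d d' where "d = height (M, N)" and "d' = height (M', N')"
  have deg: "degree M \<le> d" "degree N \<le> d" "degree M' \<le> d'" "degree N' \<le> d'"
    by (simp_all add: d_def d'_def height_def)
  have "degree (N * N') \<le> d + d'" "degree (M * N') \<le> d + d'" "degree (N * M') \<le> d + d'"
    "degree (M * M') \<le> d + d'"
    using deg degree_mult_le order_trans add_mono by metis+
  moreover from this have "degree (M * N' + N * M') \<le> d + d'"
    by (simp add: degree_add_le)
  moreover have "coeff (N * N') (d + d') \<noteq> 0 \<or> coeff (M * N' + N * M') (d + d') \<noteq> 0
      \<or> coeff (M * M') (d + d') \<noteq> 0"
  proof -
    have "coeff M d \<noteq> 0 \<or> coeff N d \<noteq> 0" "coeff M' d' \<noteq> 0 \<or> coeff N' d' \<noteq> 0"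
      using height_coeff_nonzero[of "(M, N)"] height_coeff_nonzero[of "(M', N')"] assms
      by (auto simp: d_def d'_def)
    then show ?thesis
      using deg by (auto simp: coeff_mult_bounded)
  qed
  ultimately show ?thesis
    by (simp add: height3_def d_def d'_def)
qed

abbreviation polyX :: "'a::comm_ring_1 poly" where "polyX \<equiv> [:0, 1:]"

lemma coeff_mult_polyX: "coeff (p * polyX) (Suc n) = coeff p n"
  by (simp add: mult.commute)

text \<open>With d the height of (M, N), the coefficients of \<open>xadd2\<close> and
  \<open>xadd0\<close> at degree 2d + 2 are the squares of those of N and M at d. One of these is
  nonzero, so the leading terms cannot all cancel.\<close>

lemma height3_xadd:
  fixes M N :: "'a::idom poly"
  assumes "M \<noteq> 0 \<or> N \<noteq> 0"
  shows "height3 (xadd2 polyX M N) (xadd1 [:a:] [:b:] polyX M N) (xadd0 [:a:] [:b:] polyX M N)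
           (2 * height (M, N) + 2)"
proof -
  define d where "d = height (M, N)"
  have deg: "degree M \<le> d" "degree N \<le> d" by (simp_all add: d_def height_def)
  have degs: "degree (M - polyX * N) \<le> Suc d" "degree (M + polyX * N) \<le> Suc d"
    "degree (M * polyX + [:a:] * N) \<le> Suc d" "degree (M * polyX - [:a:] * N) \<le> Suc d"
    using deg by (auto intro!: degree_diff_le degree_add_le order_trans[OF degree_mult_le]
        order_trans[OF degree_smult_le] order_trans[OF degree_pCons_le])
  have deg_b: "degree ([:2 * b:] * N) \<le> Suc d" "degree ([:4 * b:] * N) \<le> Suc d" "degree N \<le> Suc d"
    using deg by (auto intro!: order_trans[OF degree_smult_le])
  have c: "coeff M (Suc d) = 0" "coeff N (Suc d) = 0"
    using deg by (auto intro: coeff_eq_0)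
  have e2: "xadd2 polyX M N = (M - polyX * N) * (M - polyX * N)"
    by (simp add: xadd2_def power2_eq_square)
  have num: "(2 :: 'a poly) = [:2:]" "(4 :: 'a poly) = [:4:]"
    by (simp_all add: numeral_poly)
  have e1: "xadd1 [:a:] [:b:] polyX M N
      = (M * polyX + [:a:] * N) * (M + polyX * N) + ([:2 * b:] * N) * N"
    by (simp add: xadd1_def power2_eq_square num mult.commute)
  have e0: "xadd0 [:a:] [:b:] polyX M N
      = (M * polyX - [:a:] * N) * (M * polyX - [:a:] * N) - ([:4 * b:] * N) * (M + polyX * N)"
    by (simp add: xadd0_def power2_eq_square num mult.commute)
  have bound: "degree (p * q) \<le> Suc d + Suc d" if "degree p \<le> Suc d" "degree q \<le> Suc d" for p q :: "'a poly"
    using that degree_mult_le[of p q] by linarith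
  have "degree (xadd2 polyX M N) \<le> Suc d + Suc d" "degree (xadd1 [:a:] [:b:] polyX M N) \<le> Suc d + Suc d"
    "degree (xadd0 [:a:] [:b:] polyX M N) \<le> Suc d + Suc d"
    unfolding e0 e1 e2
    by (rule bound degree_add_le degree_diff_le; (rule bound)?; rule degs deg_b)+
  moreover have "coeff (xadd2 polyX M N) (Suc d + Suc d) = coeff N d * coeff N d"
    unfolding e2 using degs c by (subst coeff_mult_bounded) (simp_all)
  moreover have "coeff (xadd0 [:a:] [:b:] polyX M N) (Suc d + Suc d) = coeff M d * coeff M d"
    unfolding e0 coeff_diff coeff_mult_bounded[OF degs(4) degs(4)] coeff_mult_bounded[OF deg_b(2) degs(2)]
    using c by (simp add: coeff_mult_polyX)
  moreover have "coeff M d \<noteq> 0 \<or> coeff N d \<noteq> 0"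
    using height_coeff_nonzero[of "(M, N)"] assms by (auto simp: d_def)
  ultimately show ?thesis
    unfolding d_def[symmetric] height3_def by (auto simp: mult_2)
qed

lemma height3_scale_mid:
  fixes c :: "'a::idom"
  assumes "c \<noteq> 0"
  shows "height3 u ([:c:] * v) w d \<longleftrightarrow> height3 u v w d"
  using assms by (simp add: height3_def)

text \<open>A common prime divisor of the coefficients divides M - tN, hence does not divide N.
  Modulo this prime the quadratic is the degenerate one of \<open>xadd_at_pole\<close>, and
  \<open>resultant_identity\<close> makes the prime divide a nonzero constant.\<close>

lemma xadd_primitive:
  fixes M N :: "'a::field_gcd poly"
  assumes cop: "coprime M N" and two: "(2::'a) \<noteq> 0" and disc: "4 * a^3 + 27 * b^2 \<noteq> (0::'a)"
    and \<pi>: "prime_elem \<pi>"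
    and dvd: "\<pi> dvd xadd2 polyX M N" "\<pi> dvd 2 * xadd1 [:a:] [:b:] polyX M N"
      "\<pi> dvd xadd0 [:a:] [:b:] polyX M N"
  shows False
proof -
  let ?t = "polyX :: 'a poly"
  have "\<pi> dvd M - ?t * N"
    using dvd(1) \<pi> by (metis xadd2_def prime_elem_dvd_power)
  then have cong: "[M = ?t * N] (mod \<pi>)" 
    by (simp add: cong_iff_dvd_diff)
  have notN: "\<not> \<pi> dvd N"
  proof
    assume "\<pi> dvd N"
    then have "\<pi> dvd M" using cong \<open>\<pi> dvd M - ?t * N\<close> by (metis dvd_diffD1 dvd_mult dvd_diff diff_add_cancel dvd_add)
    with \<open>\<pi> dvd N\<close> cop have "is_unit \<pi>" by (meson coprime_common_divisor)
    with \<pi> show False by (simp add: prime_elem_def)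
  qed
  have u2: "is_unit (2 :: 'a poly)" "is_unit (4 :: 'a poly)"
    using two by (simp_all add: numeral_poly is_unit_const_poly_iff dvd_field_iff)
      (metis mult_2 mult_2_right no_zero_divisors numeral_Bit0 mult_numeral_1_right mult_2)
  have "[2 * xadd1 [:a:] [:b:] ?t M N = 2 * xadd1 [:a:] [:b:] ?t (?t * N) N] (mod \<pi>)"
    unfolding xadd1_def by (intro cong_add cong_mult cong_refl cong cong_pow)
  then have d1: "\<pi> dvd 2 * (2 * (?t^3 + [:a:] * ?t + [:b:]) * N^2)"
    using dvd(2) unfolding xadd_at_pole by (metis cong_dvd_iff)
  have "[xadd0 [:a:] [:b:] ?t M N = xadd0 [:a:] [:b:] ?t (?t * N) N] (mod \<pi>)"
    unfolding xadd0_def by (intro cong_add cong_diff cong_mult cong_refl cong cong_pow)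
  then have d0: "\<pi> dvd ((?t^2 - [:a:])^2 - 8 * [:b:] * ?t) * N^2"
    using dvd(3) unfolding xadd_at_pole by (metis cong_dvd_iff)
  have d0': "\<pi> dvd (?t^2 - [:a:])^2 - 8 * [:b:] * ?t"
    using d0 notN \<pi> by (metis prime_elem_dvd_mult_iff prime_elem_dvd_power)
  have d1': "\<pi> dvd ?t^3 + [:a:] * ?t + [:b:]"
    using d1 notN \<pi> u2 by (metis prime_elem_dvd_mult_iff prime_elem_dvd_power dvd_unit_imp_unit prime_elem_not_unit)
  have "\<pi> dvd 4 * [:a:]^3 + 27 * [:b:]^2"
    unfolding resultant_identity[of ?t "[:a:]" "[:b:]", symmetric]
    by (intro dvd_diff dvd_mult d0' d1')
  moreover have "4 * [:a:]^3 + 27 * [:b:]^2 = [:4 * a^3 + 27 * b^2:]"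
    by (simp add: numeral_poly power2_eq_square power3_eq_cube)
  ultimately have "is_unit \<pi>"
    using disc by (metis dvd_unit_imp_unit is_unit_triv)
  with \<pi> show False by (simp add: prime_elem_def)
qed

text \<open>Two computations of the height of the coefficient triple at Q are compared: from its
  factorisation into the roots P and R, and from its leading coefficients. The result is an exact
  parallelogram law. Primitivity of the triple is what puts the new root R in lowest terms.\<close>

lemma next_point:
  fixes P Q :: "'a::field_gcd poly \<times> 'a poly"
  assumes two: "(2::'a) \<noteq> 0" and disc: "4 * a^3 + 27 * b^2 \<noteq> (0::'a)"
    and P: "coprime (fst P) (snd P)" and Q: "coprime (fst Q) (snd Q)"
    and biq: "xbiq [:a:] [:b:] polyX P Q = 0"
  obtains R where "coprime (fst R) (snd R)" "xbiq [:a:] [:b:] polyX Q R = 0"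
    "height P + height R = 2 * height Q + 2"
proof -
  define q2 q1 q0 where "q2 = xadd2 polyX (fst Q) (snd Q)"
    and "q1 = xadd1 [:a:] [:b:] polyX (fst Q) (snd Q)" and "q0 = xadd0 [:a:] [:b:] polyX (fst Q) (snd Q)"
  have "q2 * fst P ^ 2 - (2 * q1) * fst P * snd P + q0 * snd P ^ 2 = 0"
    using biq by (simp add: xbiq_sym[of _ _ _ P Q]) (simp add: xbiq_def q2_def q1_def q0_def)
  then obtain M' N' where MN: "q2 = snd P * N'" "2 * q1 = fst P * N' + snd P * M'" "q0 = fst P * M'"
    using other_root[OF P] by metis
  have nz: "fst S \<noteq> 0 \<or> snd S \<noteq> 0" if "coprime (fst S) (snd S)" for S :: "'a poly \<times> 'a poly"
    using that by force
  have h: "height3 q2 (2 * q1) q0 (2 * height Q + 2)"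
    using height3_xadd[of "fst Q" "snd Q" a b] nz[OF Q] height3_scale_mid[OF two, of q2 q1 q0]
    by (simp add: q2_def q1_def q0_def numeral_poly)
  have cop: "coprime M' N'"
  proof (rule ccontr)
    assume "\<not> coprime M' N'"
    then have "\<not> is_unit (gcd M' N')" by (simp add: coprime_iff_gcd_eq_1)
    moreover have "gcd M' N' \<noteq> 0"
      using h MN by (auto simp: height3_def)
    ultimately obtain \<pi> where "prime \<pi>" "\<pi> dvd M'" "\<pi> dvd N'"
      by (metis prime_divisor_exists gcd_greatest_iff)
    then have "\<pi> dvd q2" "\<pi> dvd 2 * q1" "\<pi> dvd q0"
      unfolding MN by auto
    then show False
      using xadd_primitive[OF Q two disc, of \<pi>] \<open>prime \<pi>\<close>
      by (simp add: q2_def q1_def q0_def prime_def)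
  qed
  define R where "R = (M', N')"
  have "height3 q2 (2 * q1) q0 (height P + height R)"
    unfolding MN R_def using height3_product[of "fst P" "snd P" M' N'] nz[OF P] nz[of R] cop
    by (simp add: R_def)
  then have "height P + height R = 2 * height Q + 2"
    using h height3_unique by blast
  moreover have "xbiq [:a:] [:b:] polyX Q R = 0"
  proof -
    have "xbiq [:a:] [:b:] polyX Q R = q2 * M'^2 - (2 * q1) * M' * N' + q0 * N'^2"
      by (simp add: xbiq_def R_def q2_def q1_def q0_def)
    also have "\<dots> = 0"
      unfolding MN by (simp add: algebra_simps power2_eq_square)
    finally show ?thesis .
  qed
  ultimately show ?thesis using cop that[of R] by (simp add: R_def)
qed

text \<open>A sequence with constant second difference 2 is a monic quadratic polynomial in k, and
  heights are natural numbers. The induction carries two consecutive points, since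
  \<open>next_point\<close> starts from a pair.\<close>

lemma height_quadratic_nonneg:
  fixes P Q :: "'a::field_gcd poly \<times> 'a poly"
  assumes two: "(2::'a) \<noteq> 0" and disc: "4 * a^3 + 27 * b^2 \<noteq> (0::'a)"
    and P: "coprime (fst P) (snd P)" and Q: "coprime (fst Q) (snd Q)"
    and biq: "xbiq [:a:] [:b:] polyX P Q = 0"
  shows "int k ^ 2 + int k * (int (height Q) - int (height P) - 1) + int (height P) \<ge> 0"
proof -
  define c where "c = int (height Q) - int (height P) - 1"
  have "\<exists>R S. coprime (fst R) (snd R) \<and> coprime (fst S) (snd S) \<and> xbiq [:a:] [:b:] polyX R S = 0
      \<and> int (height R) = int k ^ 2 + int k * c + int (height P)
      \<and> int (height S) = int (Suc k) ^ 2 + int (Suc k) * c + int (height P)"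
  proof (induction k)
    case 0
    show ?case by (rule exI[of _ P], rule exI[of _ Q]) (use P Q biq in \<open>simp add: c_def\<close>)
  next
    case (Suc k)
    then obtain R S where RS: "coprime (fst R) (snd R)" "coprime (fst S) (snd S)"
      "xbiq [:a:] [:b:] polyX R S = 0"
      "int (height R) = int k ^ 2 + int k * c + int (height P)"
      "int (height S) = int (Suc k) ^ 2 + int (Suc k) * c + int (height P)" by blast
    obtain T where T: "coprime (fst T) (snd T)" "xbiq [:a:] [:b:] polyX S T = 0"
      "height R + height T = 2 * height S + 2"
      using next_point[OF two disc RS(1-3)] .
    have "int (height T) = 2 * int (height S) + 2 - int (height R)"
      using T(3) by linarith
    also have "\<dots> = int (Suc (Suc k)) ^ 2 + int (Suc (Suc k)) * c + int (height P)"
      unfolding RS by (simp add: algebra_simps power2_eq_square)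
    finally show ?case using RS T by blast
  qed
  then show ?thesis unfolding c_def by (metis of_nat_0_le_iff)
qed

subsection \<open>The Frobenius point\<close>


text \<open>For even c the minimum lies at an integer. For odd c = 2j + 1 the nearest integers give
  only j(j + 1) \<le> q, that is c^2 \<le> 4q + 1; as j(j + 1) is even and q is odd, the inequality
  is strict.\<close>

lemma int_quadratic_nonneg_imp_discriminant:
  fixes c q :: int
  assumes nonneg: "\<And>k. k^2 + k * c + q \<ge> 0" and q: "odd q"
  shows "c^2 \<le> 4 * q"
proof (cases "even c")
  case True
  then obtain j where "c = 2 * j" by auto
  then show ?thesis using nonneg[of "-j"] by (simp add: power2_eq_square algebra_simps)
next
  case False
  then obtain j where c: "c = 2 * j + 1" by (auto elim: oddE)
  have "j * (j + 1) \<le> q"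
    using nonneg[of "-j"] by (simp add: c power2_eq_square algebra_simps)
  moreover have "even (j * (j + 1))" by simp
  ultimately have "j * (j + 1) + 1 \<le> q"
    using q by (metis add.commute le_less zless_imp_add1_zle)
  then show ?thesis by (simp add: c power2_eq_square algebra_simps)
qed

lemma xbiq_scale: "xbiq a b t P (d * M, d * N) = d^2 * xbiq a b t P (M, N)"
  by (simp add: xbiq_def algebra_simps power2_eq_square)

text \<open>On the twist f(x) = f(t) y^2, so this discriminant is the square of 2 f(t) y, and
  \<open>xbiq_complete_square\<close> turns the square root into an explicit root of the
  quadratic.\<close>

lemma xadd_discriminant:
  "xadd1 a b t x 1 ^ 2 - xadd0 a b t x 1 * xadd2 t x 1 = 4 * (t^3 + a * t + b) * (x^3 + a * x + b)"
  by (simp add: xadd2_def xadd1_def xadd0_def algebra_simps power2_eq_square power3_eq_cube)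

lemma xbiq_complete_square:
  "xbiq a b t (x, 1) (xadd1 a b t x 1 - w, xadd2 t x 1)
     = xadd2 t x 1 * (w^2 - (xadd1 a b t x 1 ^ 2 - xadd0 a b t x 1 * xadd2 t x 1))"
  by (simp add: xbiq_def algebra_simps power2_eq_square)

definition linear_prod :: "'a::comm_ring_1 set \<Rightarrow> 'a poly" where
  "linear_prod A = (\<Prod>x\<in>A. [:- x, 1:])"

lemma monic_linear_prod: "lead_coeff (linear_prod A) = (1 :: 'a::idom)"
  unfolding linear_prod_def by (induction A rule: infinite_finite_induct) (auto simp: lead_coeff_mult simp del: mult_pCons_left)

lemma degree_linear_prod: "finite A \<Longrightarrow> degree (linear_prod A :: 'a::idom poly) = card A"
proof (induction A rule: finite_induct)
  case (insert x A)
  have "linear_prod A \<noteq> 0" using monic_linear_prod[of A] by auto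
  then have "degree ([:- x, 1:] * linear_prod A) = degree [:- x, 1:] + degree (linear_prod A)"
    by (intro degree_mult_eq) auto
  moreover have "linear_prod (insert x A) = [:- x, 1:] * linear_prod A"
    using insert.hyps by (simp add: linear_prod_def)
  ultimately show ?case using insert by simp
qed (simp add: linear_prod_def)

lemma poly_linear_prod_eq_0_iff:
  "finite A \<Longrightarrow> poly (linear_prod A) x = 0 \<longleftrightarrow> x \<in> (A :: 'a::idom set)"
  unfolding linear_prod_def by (auto simp: poly_prod)

lemma linear_prod_union:
  "finite A \<Longrightarrow> finite B \<Longrightarrow> A \<inter> B = {} \<Longrightarrow> linear_prod (A \<union> B) = linear_prod A * linear_prod B"
  unfolding linear_prod_def by (rule prod.union_disjoint)

lemma linear_prod_dvd:
  fixes p :: "'a::idom poly"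
  assumes "finite A" "\<And>x. x \<in> A \<Longrightarrow> poly p x = 0"
  shows "linear_prod A dvd p"
  using assms
proof (induction A arbitrary: p rule: finite_induct)
  case (insert x A)
  from insert.prems have "poly p x = 0" by simp
  then obtain r where r: "p = [:- x, 1:] * r" by (auto simp: poly_eq_0_iff_dvd elim: dvdE)
  have "poly r y = 0" if "y \<in> A" for y
    using insert.prems[of y] that insert.hyps by (auto simp: r simp del: mult_pCons_left)
  then have "linear_prod A dvd r" by (rule insert.IH)
  then show ?case unfolding r linear_prod_def
    using insert.hyps by (simp add: mult_dvd_mono del: mult_pCons_left)
qed (simp add: linear_prod_def)

lemma coprime_linear_prod:
  fixes p :: "'a::field_gcd poly"
  assumes "finite A" "\<And>x. x \<in> A \<Longrightarrow> poly p x \<noteq> 0"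
  shows "coprime p (linear_prod A)"
  unfolding linear_prod_def
proof (rule prod_coprime_right)
  fix x assume "x \<in> A"
  have "\<not> [:- x, 1:] dvd p" using assms \<open>x \<in> A\<close> by (simp add: poly_eq_0_iff_dvd)
  moreover have "prime_elem [:- x, 1:]"
    by (simp add: irreducible_imp_prime_elem_gcd irreducible_linear_field_poly)
  ultimately show "coprime p [:- x, 1:]"
    by (metis coprime_commute prime_elem_imp_coprime)
qed

text \<open>Additivity of the Frobenius map together with c^q = c for constants: p(t)^q =
  p(t^q).\<close>

lemma power_card_poly:
  fixes p :: "'a::finite_field poly"
  assumes "card (UNIV :: 'a set) = CHAR('a)"
  shows "p ^ card (UNIV :: 'a set) = pcompose p (monom 1 (card (UNIV :: 'a set)))"
proof -
  have pr: "prime CHAR('a poly)" by (simp add: prime_CHAR_semidom)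
  show ?thesis
  proof (induction p)
    case (pCons c p)
    have "pCons c p ^ card (UNIV :: 'a set) = ([:c:] + polyX * p) ^ card (UNIV :: 'a set)"
      by simp
    also have "\<dots> = [:c:] ^ card (UNIV :: 'a set) + (polyX * p) ^ card (UNIV :: 'a set)"
      using freshmans_dream[OF pr, of "card (UNIV :: 'a set)" "[:c:]" "polyX * p"] assms by simp
    also have "\<dots> = [:c:] + monom 1 (card (UNIV :: 'a set)) * p ^ card (UNIV :: 'a set)"
      by (simp add: poly_const_pow finite_field_power_card_eq_same power_mult_distrib monom_altdef del: mult_pCons_left)
    finally show ?case using pCons by (simp add: pcompose_pCons)
  qed (simp add: assms)
qed

text \<open>\<open>S\<close>, \<open>N\<close> and \<open>Z\<close> sort the field elements by the
  quadratic character of F: by Euler's criterion \<open>G\<close> takes the values 1, -1 and 0 on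
  them. The Frobenius point is (\<open>X\<close>, \<open>G\<close>).\<close>

context
  fixes a b :: "'a::{field_gcd, finite_field}" and q m :: nat
    and F G X :: "'a poly" and S N Z :: "'a set"
  assumes q: "q = card (UNIV :: 'a set)" "q = CHAR('a)" and odd: "q = 2 * m + 1"
    and disc: "4 * a^3 + 27 * b^2 \<noteq> 0"
  defines "F \<equiv> polyX^3 + [:a:] * polyX + [:b:]" and "G \<equiv> F ^ m" and "X \<equiv> monom 1 q"
    and "S \<equiv> {x. poly F x \<noteq> 0 \<and> poly G x = 1}" and "N \<equiv> {x. poly F x \<noteq> 0 \<and> poly G x \<noteq> 1}"
    and "Z \<equiv> {x. poly F x = 0}"
begin

lemma two_nonzero: "(2::'a) \<noteq> 0"
proof
  assume "(2::'a) = 0"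
  then have "of_nat 2 = (0::'a)" by simp
  then have "q dvd 2" unfolding q(2) of_nat_eq_0_iff_char_dvd .
  then have "q \<le> 2" by (auto dest: dvd_imp_le)
  moreover have "q \<noteq> 1" using q(2) CHAR_not_1'[where ?'a = 'a] by simp
  ultimately show False using odd by auto
qed

lemma m_pos: "m > 0"
  using odd q(2) CHAR_not_1'[where ?'a = 'a] by (cases m) auto

lemma poly_F: "poly F x = x^3 + a * x + b"
  by (simp add: F_def)

lemma G_square: "poly G x ^ 2 = 1" if "poly F x \<noteq> 0"
proof -
  have "poly F x ^ (2 * m + 1) = poly F x"
    using finite_field_power_card_eq_same[of "poly F x"] unfolding q(1)[symmetric] odd .
  then show ?thesis using that by (simp add: G_def poly_power mult.commute flip: power_mult)
qed

lemma G_N: "x \<in> N \<Longrightarrow> poly G x = -1"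
  using G_square[of x] unfolding N_def by (simp add: power2_eq_1_iff)

lemma partition: "UNIV = S \<union> (N \<union> Z)" "S \<inter> (N \<union> Z) = {}" "N \<inter> Z = {}"
  unfolding S_def N_def Z_def by auto

lemma card_partition: "card S + card N + card Z = q"
proof -
  have "card (S \<union> (N \<union> Z)) = card S + (card N + card Z)"
    using partition(2,3) by (simp add: card_Un_disjoint)
  then show ?thesis using q(1) by (simp flip: partition(1))
qed

text \<open>Both sides are monic of degree q and vanish on the whole field. The square of this
  polynomial is \<open>xadd2\<close> at the Frobenius point, so the factors it shares with the
  numerator can be read off.\<close>

lemma X_minus: "X - polyX = linear_prod S * linear_prod N * linear_prod Z"
proof -
  have "linear_prod (S \<union> (N \<union> Z)) = linear_prod S * linear_prod N * linear_prod Z"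
    using partition(2,3) by (simp add: linear_prod_union mult.assoc)
  then have lp: "linear_prod (UNIV :: 'a set) = linear_prod S * linear_prod N * linear_prod Z"
    by (simp flip: partition(1))
  have "X - polyX - linear_prod UNIV = 0"
  proof (rule ccontr)
    let ?p = "X - polyX - linear_prod UNIV"
    assume nz: "?p \<noteq> 0"
    have roots: "poly ?p x = 0" for x
    proof -
      have "poly (linear_prod UNIV) x = 0" by (simp add: poly_linear_prod_eq_0_iff)
      then show ?thesis
        by (simp add: X_def poly_monom q(1) finite_field_power_card_eq_same)
    qed
    have "q \<ge> 3" using m_pos odd by simp
    have "degree (X - polyX) = q"
    proof -
      have "degree (X + - polyX) = degree X"
        using \<open>q \<ge> 3\<close> by (intro degree_add_eq_left) (simp add: X_def degree_monom_eq)
      moreover have "degree X = q" by (simp add: X_def degree_monom_eq)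
      ultimately show ?thesis by (simp only: diff_conv_add_uminus)
    qed
    moreover have "lead_coeff (X - polyX) = 1"
    proof -
      have "coeff (polyX :: 'a poly) q = 0" using \<open>q \<ge> 3\<close> by (intro coeff_eq_0) simp
      then show ?thesis unfolding \<open>degree (X - polyX) = q\<close> by (simp add: X_def)
    qed
    moreover have "degree (linear_prod (UNIV :: 'a set)) = q" "lead_coeff (linear_prod (UNIV :: 'a set)) = 1"
      using degree_linear_prod[of "UNIV :: 'a set"] monic_linear_prod[of "UNIV :: 'a set"] q(1)
      by simp_all
    ultimately have "degree ?p \<le> q" "coeff ?p q = 0"
      by (simp_all add: degree_diff_le)
    then have "degree ?p < q"
      using nz by (metis leading_coeff_0_iff le_neq_implies_less)
    moreover have "card {x. poly ?p x = 0} \<le> degree ?p"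
      using nz by (rule card_poly_roots_bound)
    moreover have "{x. poly ?p x = 0} = UNIV" using roots by blast
    ultimately show False using q(1) by (metis leD)
  qed
  then show ?thesis unfolding lp[symmetric] by (simp only: right_minus_eq)
qed

text \<open>A double zero x of the cubic forces a = -3x^2 and b = 2x^3, hence discriminant
  0.\<close>

lemma simple_root:
  assumes "x \<in> Z" "F = linear_prod Z * F'"
  shows "poly F' x \<noteq> 0"
proof
  assume "poly F' x = 0"
  have "poly (linear_prod Z) x = 0" using assms by (simp add: poly_linear_prod_eq_0_iff)
  then have "poly (pderiv F) x = 0"
    unfolding assms(2) pderiv_mult using \<open>poly F' x = 0\<close> by simp
  moreover have "pderiv F = [:a, 0, 3:]"
    unfolding F_def by (simp add: pderiv_pCons power3_eq_cube)
  ultimately have "a + 3 * x^2 = 0" by (simp add: algebra_simps power2_eq_square)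
  then have a: "a = - (3 * x^2)" by (simp only: eq_neg_iff_add_eq_0)
  have "b + (x^3 + a * x) = 0" using assms(1) unfolding Z_def by (simp add: poly_F add_ac)
  then have "b = - (x^3 + a * x)" by (simp only: eq_neg_iff_add_eq_0)
  then have b: "b = 2 * x^3" unfolding a by (simp add: power2_eq_square power3_eq_cube)
  have "4 * a^3 + 27 * b^2 = 0" unfolding a b by (simp add: power2_eq_square power3_eq_cube)
  with disc show False by simp
qed

text \<open>Euler's criterion by counting: squaring is two-to-one on nonzero elements, so there are
  m nonzero squares; all of them are zeros of c^m - 1, which has at most m.\<close>

lemma card_square_roots: "c \<noteq> 0 \<Longrightarrow> card {y::'a. y^2 = c} = (if c ^ m = 1 then 2 else 0)"
proof -
  define Sq where "Sq = (\<lambda>y::'a. y^2) ` (UNIV - {0})"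
  have two_roots: "{z. z^2 = y^2} = {y, -y}" for y :: 'a
    by (auto simp: power2_eq_iff)
  have card2: "card {z. z^2 = y^2} = 2" if "y \<noteq> 0" for y :: 'a
  proof -
    have "y \<noteq> -y" using two_nonzero that by (simp add: eq_neg_iff_add_eq_0 flip: mult_2)
    then show ?thesis unfolding two_roots by simp
  qed
  have "card (UNIV - {0::'a}) = (\<Sum>c\<in>Sq. card {y \<in> UNIV - {0}. y^2 = c})"
    unfolding Sq_def card_eq_sum by (rule sum.image_gen) simp
  also have "\<dots> = (\<Sum>c\<in>Sq. 2)"
  proof (rule sum.cong)
    fix c assume "c \<in> Sq"
    then obtain y where y: "y \<noteq> 0" "c = y^2" by (auto simp: Sq_def)
    then have "{y \<in> UNIV - {0}. y^2 = c} = {z. z^2 = y^2}" by auto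
    then show "card {y \<in> UNIV - {0}. y^2 = c} = 2" using card2 y by simp
  qed simp
  finally have "card Sq = m" using q(1) odd by (simp add: card_Diff_subset)
  moreover have sub: "Sq \<subseteq> {c. c ^ m = 1}"
  proof
    fix c assume "c \<in> Sq"
    then obtain y where y: "y \<noteq> 0" "c = y^2" by (auto simp: Sq_def)
    have "y ^ (2 * m + 1) = y"
      using finite_field_power_card_eq_same[of y] unfolding q(1)[symmetric] odd .
    then show "c \<in> {c. c ^ m = 1}" using y by (simp add: power_mult)
  qed
  moreover have "card {c::'a. c ^ m = 1} \<le> m"
  proof -
    let ?p = "monom 1 m - 1 :: 'a poly"
    have "?p \<noteq> 0" using m_pos by (metis degree_1 degree_monom_eq eq_iff_diff_eq_0 less_numeral_extra(3) one_neq_zero)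
    then have "card {x. poly ?p x = 0} \<le> degree ?p" by (rule card_poly_roots_bound)
    also have "degree ?p \<le> m" by (intro degree_diff_le) (auto simp: degree_monom_le)
    finally show ?thesis by (simp add: poly_monom)
  qed
  ultimately have Sq: "Sq = {c. c ^ m = 1}" by (metis card_seteq finite)
  show "card {y::'a. y^2 = c} = (if c ^ m = 1 then 2 else 0)" if "c \<noteq> 0"
  proof (cases "c \<in> Sq")
    case True
    then obtain y where "y \<noteq> 0" "c = y^2" by (auto simp: Sq_def)
    then show ?thesis using card2[of y] True Sq by simp
  next
    case False
    then have "{y. y^2 = c} = {}" using that by (auto simp: Sq_def)
    then show ?thesis using False Sq by simp
  qed
qed

lemma card_affine_points: "card {(x, y). y^2 = x^3 + a * x + b} = 2 * card S + card Z"
proof -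
  have "{(x, y). y^2 = x^3 + a * x + b} = (SIGMA x:UNIV. {y. y^2 = poly F x})"
    by (auto simp: poly_F)
  then have "card {(x, y). y^2 = x^3 + a * x + b} = (\<Sum>x\<in>UNIV. card {y. y^2 = poly F x})"
    by simp
  also have "\<dots> = (\<Sum>x\<in>S \<union> (N \<union> Z). card {y. y^2 = poly F x})"
    by (simp flip: partition(1))
  also have "\<dots> = (\<Sum>x\<in>S. card {y. y^2 = poly F x}) + ((\<Sum>x\<in>N. card {y. y^2 = poly F x})
      + (\<Sum>x\<in>Z. card {y. y^2 = poly F x}))"
    using partition(2,3) by (simp add: sum.union_disjoint)
  also have "(\<Sum>x\<in>S. card {y. y^2 = poly F x}) = (\<Sum>x\<in>S. 2)"
    by (rule sum.cong) (auto simp: S_def G_def card_square_roots)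
  also have "(\<Sum>x\<in>N. card {y. y^2 = poly F x}) = (\<Sum>x\<in>N. 0)"
    by (rule sum.cong) (auto simp: N_def G_def card_square_roots)
  also have "(\<Sum>x\<in>Z. card {y. y^2 = poly F x}) = (\<Sum>x\<in>Z. 1)"
    by (rule sum.cong) (auto simp: Z_def)
  finally show ?thesis by simp
qed

text \<open>The Frobenius point translated by Q, for one choice of sign, has x-coordinate (xadd1 -
  2FG) / (t^q - t)^2. The factor lost in reducing this fraction to lowest terms has degree 2|S| +
  |Z|, the number of affine points: this is how the point count enters the height.\<close>

lemma frobenius_translate:
  obtains P where "coprime (fst P) (snd P)" "xbiq [:a:] [:b:] polyX (X, 1) P = 0"
    "height P + 2 * card S + card Z = 2 * q + 1"
proof -
  have FG: "F * G^2 = X^3 + [:a:] * X + [:b:]"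
  proof -
    have pX: "pcompose polyX X = X" by (simp add: pcompose_pCons)
    have "F * G^2 = F ^ q" by (simp add: G_def odd power_mult mult.commute[of 2])
    also have "\<dots> = pcompose F X" using power_card_poly[of F] q by (simp add: X_def)
    also have "\<dots> = X^3 + [:a:] * X + [:b:]"
      unfolding F_def by (simp only: pcompose_add pcompose_mult power3_eq_cube pcompose_const pX)
    finally show ?thesis .
  qed
  have "linear_prod S dvd G - 1"
    by (rule linear_prod_dvd) (auto simp: S_def)
  then obtain G' where G': "G - 1 = linear_prod S * G'" by auto
  have "linear_prod Z dvd F"
    by (rule linear_prod_dvd) (auto simp: Z_def)
  then obtain F' where F': "F = linear_prod Z * F'" by auto
  \<comment> \<open>The exact common factor: G - 1 vanishes on \<open>S\<close> and occurs squared
    in the numerator, while F contributes each point of \<open>Z\<close> once.\<close>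
  define D where "D = linear_prod S ^ 2 * linear_prod Z"
  define N1 where "N1 = linear_prod N ^ 2 * linear_prod Z"
  define M1 where "M1 = F' * G'^2 - (X + polyX) * N1"
  define q1 where "q1 = xadd1 [:a:] [:b:] polyX X 1"
  have den: "D * N1 = (X - polyX)^2"
    unfolding D_def N1_def X_minus by (simp add: power2_eq_square mult_ac)
  have "D * M1 = F * (G - 1)^2 - (X + polyX) * (D * N1)"
    unfolding M1_def G' F' D_def by (simp add: algebra_simps power2_eq_square del: mult_pCons_left mult_pCons_right)
  also have "\<dots> = F * G^2 + F - (X + polyX) * (X - polyX)^2 - 2 * F * G"
    unfolding den by (simp add: algebra_simps power2_eq_square del: mult_pCons_left mult_pCons_right)
  also have "\<dots> = q1 - 2 * F * G"
  proof -
    have "(X^3 + A * X + B) + (t^3 + A * t + B) - (X + t) * (X - t)^2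
      = (X * t + A * 1) * (X + t * 1) + 2 * B * 1^2" for A B t :: "'a poly"
      by (simp add: algebra_simps power2_eq_square power3_eq_cube)
    from this[of "[:a:]" "[:b:]" polyX]
    have "(X^3 + [:a:] * X + [:b:]) + F - (X + polyX) * (X - polyX)^2 = q1"
      unfolding q1_def xadd1_def F_def .
    then show ?thesis unfolding FG by simp
  qed
  finally have num: "D * M1 = q1 - 2 * F * G" .
  have lp_nz: "linear_prod A \<noteq> 0" for A :: "'a set" using monic_linear_prod[of A] by auto
  have D_nz: "D \<noteq> 0" and N1_nz: "N1 \<noteq> 0" by (simp_all add: D_def N1_def lp_nz)
  have degD: "degree D = 2 * card S + card Z"
    by (simp add: D_def degree_mult_eq degree_power_eq lp_nz degree_linear_prod)
  have degN1: "degree N1 = 2 * card N + card Z"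
    by (simp add: N1_def degree_mult_eq degree_power_eq lp_nz degree_linear_prod)
  have "q \<ge> 3" using m_pos odd by simp
  have degF: "degree F = 3"
  proof -
    have "F = [:b, a, 0, 1:]" by (simp add: F_def power3_eq_cube)
    then show ?thesis by simp
  qed
  have degX: "degree X = q" by (simp add: X_def degree_monom_eq)
  \<comment> \<open>The term X^2 t of \<open>xadd1\<close> dominates: F G has degree at most 3(m +
    1), which is less than 2q + 1 = 4m + 3.\<close>
  have deg_num: "degree (D * M1) = 2 * q + 1"
  proof -
    define rest where "rest = X * polyX^2 + [:a:] * X + [:a:] * polyX + 2 * [:b:] - 2 * F * G"
    have eq: "D * M1 = monom 1 (2 * q + 1) + rest"
    proof -
      have "q1 = X * X * polyX + (X * polyX^2 + [:a:] * X + [:a:] * polyX + 2 * [:b:])"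
        unfolding q1_def xadd1_def
        by (simp add: algebra_simps power2_eq_square del: mult_pCons_left mult_pCons_right)
      moreover have "X * X * polyX = monom 1 (2 * q + 1)"
        by (simp add: X_def monom_altdef mult_2 power_add del: mult_pCons_left mult_pCons_right)
      ultimately show ?thesis unfolding num rest_def by simp
    qed
    have "degree rest < 2 * q + 1"
    proof -
      have "degree (X * polyX^2) \<le> q + 2"
        using degree_mult_le[of X "polyX^2"] degX by (simp add: degree_power_eq)
      moreover have "degree ([:a:] * X) \<le> q" using degX by (simp add: degree_smult_le[THEN order_trans])
      moreover have "degree ([:a:] * polyX) \<le> 1" by simp
      moreover have "degree (2 * [:b:]) \<le> 0" by (simp add: numeral_poly)
      moreover have "degree (2 * F * G) \<le> 3 + m * 3"
      proof -
        have "2 * F * G = [:2:] * (F * G)" by (simp add: numeral_poly)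
        moreover have "degree (F * G) \<le> 3 + m * 3"
          using degree_mult_le[of F G] degree_power_le[of F m] degF by (simp add: G_def mult.commute)
        ultimately show ?thesis by (simp add: degree_smult_le[THEN order_trans])
      qed
      ultimately show ?thesis
        using \<open>q \<ge> 3\<close> odd m_pos unfolding rest_def
        by (intro degree_diff_less degree_add_less) linarith+
    qed
    then show ?thesis unfolding eq by (subst degree_add_eq_left) (simp_all add: degree_monom_eq)
  qed
  then have M1_nz: "M1 \<noteq> 0" by auto
  have degM1: "degree M1 + degree D = 2 * q + 1"
    using deg_num M1_nz D_nz by (simp add: degree_mult_eq)
  \<comment> \<open>No further cancellation: G - 1 is -2 on \<open>N\<close> and -1 on
    \<open>Z\<close>, and the zeros of F are simple.\<close>
  have M1_roots: "poly M1 x \<noteq> 0" if "x \<in> N \<union> Z" for x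
  proof -
    have "poly N1 x = 0" using that by (auto simp: N1_def poly_linear_prod_eq_0_iff)
    then have "poly M1 x = poly F' x * poly G' x ^ 2" by (simp add: M1_def)
    moreover have "poly G x - 1 = poly (linear_prod S) x * poly G' x"
      using arg_cong[OF G', of "\<lambda>p. poly p x"] by simp
    moreover have "poly G x - 1 \<noteq> 0"
    proof (cases "x \<in> Z")
      case True
      then have "poly G x = 0" using m_pos by (simp add: Z_def G_def)
      then show ?thesis by simp
    next
      case False
      then have "poly G x - 1 = - 2" using that G_N[of x] by simp
      then show ?thesis using two_nonzero by (metis neg_equal_0_iff_equal)
    qed
    moreover have "poly F' x \<noteq> 0"
    proof (cases "x \<in> Z")
      case True then show ?thesis using simple_root F' by blast
    next
      case False
      then have "poly F x \<noteq> 0" by (simp add: Z_def)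
      moreover have "poly F x = poly (linear_prod Z) x * poly F' x"
        using arg_cong[OF F', of "\<lambda>p. poly p x"] by simp
      ultimately show ?thesis by auto
    qed
    ultimately show ?thesis by auto
  qed
  have cop: "coprime M1 N1"
    unfolding N1_def using M1_roots
    by (auto simp: coprime_linear_prod)
  have "xbiq [:a:] [:b:] polyX (X, 1) (M1, N1) = 0"
  proof -
    have "D^2 * xbiq [:a:] [:b:] polyX (X, 1) (M1, N1) = xbiq [:a:] [:b:] polyX (X, 1) (D * M1, D * N1)"
      by (simp only: xbiq_scale)
    also have "D * N1 = xadd2 polyX X 1"
      by (simp only: den xadd2_def mult_1_right)
    also have "xbiq [:a:] [:b:] polyX (X, 1) (D * M1, xadd2 polyX X 1)
        = xadd2 polyX X 1 * ((2 * F * G)^2 - 4 * F * (F * G^2))"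
      by (simp only: num q1_def xbiq_complete_square xadd_discriminant FG flip: F_def)
    also have "(2 * F * G)^2 - 4 * F * (F * G^2) = 0"
      by (simp add: power2_eq_square)
    finally have "D^2 * xbiq [:a:] [:b:] polyX (X, 1) (M1, N1) = 0" by simp
    then show ?thesis using D_nz by simp
  qed
  \<comment> \<open>Since |S| + |N| + |Z| = q, the degree of \<open>M1\<close> is 2|N| + |Z| + 1,
    one more than that of \<open>N1\<close>.\<close>
  moreover have "height (M1, N1) = degree M1"
    using degM1 degN1 degD card_partition by (simp add: height_def)
  ultimately show ?thesis
    using that[of "(M1, N1)"] cop degM1 degD by simp
qed

theorem hasse_finite_field:
  "(int q - int (card {(x, y). y^2 = x^3 + a * x + b}))^2 \<le> 4 * int q"
proof -
  obtain P where P: "coprime (fst P) (snd P)" "xbiq [:a:] [:b:] polyX (X, 1) P = 0"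
    "height P + 2 * card S + card Z = 2 * q + 1" by (rule frobenius_translate)
  \<comment> \<open>The neighbour of the Frobenius point on the other side; it covers negative k,
    with -c in place of c.\<close>
  obtain R where R: "coprime (fst R) (snd R)" "xbiq [:a:] [:b:] polyX (X, 1) R = 0"
    "height P + height R = 2 * height (X, 1) + 2"
    using next_point[OF two_nonzero disc P(1), of "(X, 1)"] P(2) by (auto simp: xbiq_sym)
  have hX: "height (X, 1 :: 'a poly) = q" by (simp add: height_def X_def degree_monom_eq)
  define c where "c = int q - int (2 * card S + card Z)"
  have hP: "int (height P) - int q - 1 = c" using P(3) by (simp add: c_def)
  have hR: "int (height R) - int q - 1 = - c" using hP R(3) hX by simp
  have "k^2 + k * c + int q \<ge> 0" for k :: int
  proof (cases "k \<ge> 0")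
    case True
    then show ?thesis
      using height_quadratic_nonneg[OF two_nonzero disc _ P(1,2), of "nat k"] hP hX by simp
  next
    case False
    then show ?thesis
      using height_quadratic_nonneg[OF two_nonzero disc _ R(1,2), of "nat (-k)"] hR hX by simp
  qed
  then have "c^2 \<le> 4 * int q"
    by (rule int_quadratic_nonneg_imp_discriminant) (use odd in simp)
  then show ?thesis unfolding card_affine_points c_def .
qed

end

subsection \<open>The Hasse bound over prime fields\<close>


definition affine_points :: "nat \<Rightarrow> int \<Rightarrow> int \<Rightarrow> (int \<times> int) set" where
  "affine_points p a b =
     {(x, y). x \<in> {0..<int p} \<and> y \<in> {0..<int p} \<and> y^2 mod int p = (x^3 + a * x + b) mod int p}"

definition hasse_bound_holds :: "nat \<Rightarrow> bool" where
  "hasse_bound_holds p \<longleftrightarrow> (\<forall>a b. \<not> int p dvd 4 * a^3 + 27 * b^2 \<longrightarrow>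
     (int p - int (card (affine_points p a b)))^2 \<le> 4 * int p)"

text \<open>
  Isabelle's types cannot depend on a variable prime, but a single finite field suffices: its
  characteristic is chosen as a counterexample to the Hasse bound, if there is one.
\<close>

definition crit_prime :: nat where
  "crit_prime =
     (if \<exists>p. prime p \<and> odd p \<and> \<not> hasse_bound_holds p
      then SOME p. prime p \<and> odd p \<and> \<not> hasse_bound_holds p else 3)"

lemma crit_prime:
  shows prime_crit_prime: "prime crit_prime" and odd_crit_prime: "odd crit_prime"
    and hasse_bound_critical: "hasse_bound_holds crit_prime \<Longrightarrow> prime p \<Longrightarrow> odd p \<Longrightarrow> hasse_bound_holds p"
proof -
  have *: "prime crit_prime \<and> odd crit_prime \<and> \<not> hasse_bound_holds crit_prime"
    if "\<exists>p. prime p \<and> odd p \<and> \<not> hasse_bound_holds p"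
    using someI_ex[OF that] that unfolding crit_prime_def by simp
  show "prime crit_prime" "odd crit_prime"
    using * by (cases "\<exists>p. prime p \<and> odd p \<and> \<not> hasse_bound_holds p"; auto simp: crit_prime_def)+
  show "hasse_bound_holds crit_prime \<Longrightarrow> prime p \<Longrightarrow> odd p \<Longrightarrow> hasse_bound_holds p"
    using * by blast
qed

lemma crit_prime_gt_1: "int crit_prime > 1"
  using prime_crit_prime prime_gt_1_nat by auto

section \<open>The field with \<open>crit_prime\<close> elements\<close>

typedef crit_field = "{0..<int crit_prime}"
  using crit_prime_gt_1 by (intro exI[of _ 0]) simp

setup_lifting type_definition_crit_field

instantiation crit_field :: comm_ring_1
begin

lift_definition zero_crit_field :: crit_field is 0
  using crit_prime_gt_1 by simp
lift_definition one_crit_field :: crit_field is 1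
  using crit_prime_gt_1 by simp
lift_definition plus_crit_field :: "crit_field \<Rightarrow> crit_field \<Rightarrow> crit_field"
  is "\<lambda>x y. (x + y) mod int crit_prime" using crit_prime_gt_1 by simp
lift_definition minus_crit_field :: "crit_field \<Rightarrow> crit_field \<Rightarrow> crit_field"
  is "\<lambda>x y. (x - y) mod int crit_prime" using crit_prime_gt_1 by simp
lift_definition uminus_crit_field :: "crit_field \<Rightarrow> crit_field"
  is "\<lambda>x. (- x) mod int crit_prime" using crit_prime_gt_1 by simp
lift_definition times_crit_field :: "crit_field \<Rightarrow> crit_field \<Rightarrow> crit_field"
  is "\<lambda>x y. (x * y) mod int crit_prime" using crit_prime_gt_1 by simp

instance
  by standard (transfer; use crit_prime_gt_1 in \<open>simp add: mod_simps algebra_simps\<close>)+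

end

lemma Rep_crit_field_of_int: "Rep_crit_field (of_int z) = z mod int crit_prime"
proof -
  have nat: "Rep_crit_field (of_nat n) = int n mod int crit_prime" for n
    by (induction n)
      (use crit_prime_gt_1 in \<open>simp_all add: zero_crit_field.rep_eq one_crit_field.rep_eq
        plus_crit_field.rep_eq mod_simps\<close>)
  show ?thesis
  proof (cases z)
    case (nonneg n) then show ?thesis using nat by simp
  next
    case (neg n)
    then have "of_int z = - (of_nat (Suc n) :: crit_field)" by simp
    then show ?thesis using nat[of "Suc n"] neg
      by (simp add: uminus_crit_field.rep_eq mod_minus_eq del: of_nat_Suc)
  qed
qed

lemma of_int_crit_field_eq_iff:
  "(of_int x :: crit_field) = of_int y \<longleftrightarrow> x mod int crit_prime = y mod int crit_prime"
  by (metis Rep_crit_field_of_int Rep_crit_field_inject)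

lemma of_int_Rep_crit_field: "of_int (Rep_crit_field x) = x"
proof -
  have "Rep_crit_field x \<in> {0..<int crit_prime}" by (rule Rep_crit_field)
  then have "Rep_crit_field (of_int (Rep_crit_field x)) = Rep_crit_field x"
    by (simp add: Rep_crit_field_of_int)
  then show ?thesis by (simp add: Rep_crit_field_inject)
qed

lemma crit_field_power: "x \<noteq> 0 \<Longrightarrow> (x :: crit_field) ^ (crit_prime - 1) = 1"
proof -
  assume "x \<noteq> 0"
  define z where "z = Rep_crit_field x"
  have x: "x = of_int z" by (simp add: z_def of_int_Rep_crit_field)
  have "\<not> int crit_prime dvd z"
    using \<open>x \<noteq> 0\<close> of_int_crit_field_eq_iff[of z 0] by (auto simp: x)
  then have "\<not> crit_prime dvd nat \<bar>z\<bar>"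
    using int_dvd_int_iff[of crit_prime "nat \<bar>z\<bar>"] by simp
  then have "[nat \<bar>z\<bar> ^ (crit_prime - 1) = 1] (mod crit_prime)"
    by (rule fermat_theorem[OF prime_crit_prime])
  then have "[\<bar>z\<bar> ^ (crit_prime - 1) = 1] (mod int crit_prime)"
    by (metis abs_ge_zero cong_int_iff nat_0_le of_nat_1 of_nat_power)
  moreover have "even (crit_prime - 1)" using odd_crit_prime by simp
  ultimately have "[z ^ (crit_prime - 1) = 1] (mod int crit_prime)"
    by (simp add: power_even_abs)
  then have "of_int (z ^ (crit_prime - 1)) = (of_int 1 :: crit_field)"
    by (simp only: of_int_crit_field_eq_iff cong_def)
  then show ?thesis by (simp add: x)
qed

instantiation crit_field :: field
begin

definition inverse_crit_field :: "crit_field \<Rightarrow> crit_field" where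
  "inverse_crit_field x = (if x = 0 then 0 else x ^ (crit_prime - 2))"
definition divide_crit_field :: "crit_field \<Rightarrow> crit_field \<Rightarrow> crit_field" where
  "divide_crit_field (x :: crit_field) y = x * inverse y"

instance
proof
  fix x y :: crit_field
  show "inverse x * x = 1" if "x \<noteq> 0"
  proof -
    have "Suc (crit_prime - 2) = crit_prime - 1"
      using prime_ge_2_nat[OF prime_crit_prime] by simp
    then have "x ^ (crit_prime - 2) * x = x ^ (crit_prime - 1)"
      by (metis power_Suc2)
    then show ?thesis using that crit_field_power by (simp add: inverse_crit_field_def)
  qed
qed (simp_all add: inverse_crit_field_def divide_crit_field_def)

end

text \<open>The trivial Euclidean structure of a field. It leads to the class
  \<open>field_gcd\<close>, under which polynomials over the field have gcds and prime
  factorisations.\<close>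

instantiation crit_field ::
  "{unique_euclidean_ring, normalization_euclidean_semiring, normalization_semidom_multiplicative}"
begin

definition [simp]: "normalize_crit_field = (normalize_field :: crit_field \<Rightarrow> _)"
definition [simp]: "unit_factor_crit_field = (unit_factor_field :: crit_field \<Rightarrow> _)"
definition [simp]: "modulo_crit_field = (mod_field :: crit_field \<Rightarrow> _)"
definition [simp]: "euclidean_size_crit_field = (euclidean_size_field :: crit_field \<Rightarrow> _)"
definition [simp]: "division_segment (x :: crit_field) = 1"

instance
  by standard (simp_all add: dvd_field_iff field_split_simps split: if_splits)

end

instantiation crit_field :: euclidean_ring_gcd
begin

definition gcd_crit_field :: "crit_field \<Rightarrow> crit_field \<Rightarrow> crit_field" where
  "gcd_crit_field = Euclidean_Algorithm.gcd"
definition lcm_crit_field :: "crit_field \<Rightarrow> crit_field \<Rightarrow> crit_field" where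
  "lcm_crit_field = Euclidean_Algorithm.lcm"
definition Gcd_crit_field :: "crit_field set \<Rightarrow> crit_field" where
  "Gcd_crit_field = Euclidean_Algorithm.Gcd"
definition Lcm_crit_field :: "crit_field set \<Rightarrow> crit_field" where
  "Lcm_crit_field = Euclidean_Algorithm.Lcm"

instance
  by standard (simp_all add: gcd_crit_field_def lcm_crit_field_def
      Gcd_crit_field_def Lcm_crit_field_def)

end

instance crit_field :: field_gcd ..

lemma UNIV_crit_field: "bij_betw Rep_crit_field UNIV {0..<int crit_prime}"
  by (metis bij_betw_def Rep_crit_field_inject injI type_definition.Rep_range
      type_definition_crit_field)

instance crit_field :: finite_field
  by (rule finite_fieldI) (use bij_betw_finite[OF UNIV_crit_field] in simp)

lemma card_crit_field: "card (UNIV :: crit_field set) = crit_prime"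
  using bij_betw_same_card[OF UNIV_crit_field] by simp

lemma CHAR_crit_field: "CHAR(crit_field) = crit_prime"
proof -
  have "of_nat crit_prime = (0 :: crit_field)"
    using of_int_crit_field_eq_iff[of "int crit_prime" 0] by simp
  then have "CHAR(crit_field) dvd crit_prime" by (simp add: of_nat_eq_0_iff_char_dvd)
  then show ?thesis
    using prime_crit_prime CHAR_not_1'[where ?'a = crit_field]
    by (metis One_nat_def prime_nat_iff)
qed

lemma card_affine_points_critical:
  "card (affine_points crit_prime a b)
     = card {(x, y). y^2 = x^3 + of_int a * x + (of_int b :: crit_field)}"
proof -
  have "bij_betw (map_prod of_int of_int :: int \<times> int \<Rightarrow> crit_field \<times> crit_field)
     (affine_points crit_prime a b) {(x, y). y^2 = x^3 + of_int a * x + of_int b}"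
  proof (rule bij_betw_byWitness[where f' = "map_prod Rep_crit_field Rep_crit_field"])
    have eq: "(of_int y)^2 = (of_int x)^3 + of_int a * of_int x + (of_int b :: crit_field)
       \<longleftrightarrow> y^2 mod int crit_prime = (x^3 + a * x + b) mod int crit_prime" for x y
      using of_int_crit_field_eq_iff[of "y^2" "x^3 + a * x + b"] by simp
    show "map_prod of_int of_int ` affine_points crit_prime a b
        \<subseteq> {(x, y). y^2 = x^3 + of_int a * x + (of_int b :: crit_field)}"
      by (auto simp: affine_points_def eq)
    show "map_prod Rep_crit_field Rep_crit_field
        ` {(x, y). y^2 = x^3 + of_int a * x + of_int b} \<subseteq> affine_points crit_prime a b"
      using Rep_crit_field
      by (auto simp: affine_points_def eq[symmetric] of_int_Rep_crit_field
          simp del: atLeastLessThan_iff)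
  qed (auto simp: affine_points_def Rep_crit_field_of_int of_int_Rep_crit_field)
  then show ?thesis by (rule bij_betw_same_card)
qed

theorem hasse_bound:
  assumes "prime p" "odd p" "\<not> int p dvd 4 * a^3 + 27 * b^2"
  shows "(int p - int (card (affine_points p a b)))^2 \<le> 4 * int p"
proof -
  have "hasse_bound_holds crit_prime"
    unfolding hasse_bound_holds_def
  proof (intro allI impI)
    fix a b assume disc: "\<not> int crit_prime dvd 4 * a^3 + 27 * b^2"
    have "4 * of_int a ^ 3 + 27 * of_int b ^ 2 = (of_int (4 * a^3 + 27 * b^2) :: crit_field)"
      by simp
    also have "\<dots> \<noteq> 0"
      using disc of_int_crit_field_eq_iff[of "4 * a^3 + 27 * b^2" 0] by (auto simp: mod_eq_0_iff_dvd)
    finally have d: "4 * of_int a ^ 3 + 27 * of_int b ^ 2 \<noteq> (0 :: crit_field)" .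
    obtain m where "crit_prime = 2 * m + 1" using odd_crit_prime by (auto elim: oddE)
    from hasse_finite_field[OF _ _ this d] show
      "(int crit_prime - int (card (affine_points crit_prime a b)))^2 \<le> 4 * int crit_prime"
      unfolding card_affine_points_critical by (simp add: card_crit_field CHAR_crit_field)
  qed
  then show ?thesis
    using hasse_bound_critical assms unfolding hasse_bound_holds_def by blast
qed

subsection \<open>Minimal models and Dirichlet coefficients\<close>


text \<open>The rational number x is integral at p and reduces to z. A relation joins integrality
  and value, so that both propagate through the substitution formulas by the same rules.\<close>

definition rat_mod :: "int \<Rightarrow> rat \<Rightarrow> int \<Rightarrow> bool" where
  "rat_mod p x z \<longleftrightarrow> (\<exists>n d. \<not> p dvd d \<and> x * of_int d = of_int n \<and> [n = z * d] (mod p))"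

lemma rat_mod_of_int: "prime p \<Longrightarrow> rat_mod p (of_int a) a"
  unfolding rat_mod_def by (rule exI[of _ a], rule exI[of _ 1]) (auto simp: prime_int_iff)

lemma rat_mod_add:
  assumes "prime p" "rat_mod p x z" "rat_mod p y w"
  shows "rat_mod p (x + y) (z + w)"
proof -
  obtain n d where nd: "\<not> p dvd d" "x * of_int d = of_int n" "[n = z * d] (mod p)"
    using assms(2) by (auto simp: rat_mod_def)
  obtain m e where me: "\<not> p dvd e" "y * of_int e = of_int m" "[m = w * e] (mod p)"
    using assms(3) by (auto simp: rat_mod_def)
  have "(x + y) * of_int (d * e) = of_int (n * e + m * d)"
    by (simp add: distrib_right mult.assoc[symmetric] nd(2)[symmetric])
      (simp add: me(2)[symmetric] mult_ac)
  moreover have "[n * e + m * d = (z * d) * e + (w * e) * d] (mod p)"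
    using nd(3) me(3) by (intro cong_add cong_mult cong_refl)
  then have "[n * e + m * d = (z + w) * (d * e)] (mod p)"
    by (simp add: algebra_simps)
  moreover have "\<not> p dvd d * e" using assms(1) nd(1) me(1) by (simp add: prime_dvd_mult_iff)
  ultimately show ?thesis unfolding rat_mod_def by blast
qed

lemma rat_mod_mult:
  assumes "prime p" "rat_mod p x z" "rat_mod p y w"
  shows "rat_mod p (x * y) (z * w)"
proof -
  obtain n d where nd: "\<not> p dvd d" "x * of_int d = of_int n" "[n = z * d] (mod p)"
    using assms(2) by (auto simp: rat_mod_def)
  obtain m e where me: "\<not> p dvd e" "y * of_int e = of_int m" "[m = w * e] (mod p)"
    using assms(3) by (auto simp: rat_mod_def)
  have "(x * y) * of_int (d * e) = (x * of_int d) * (y * of_int e)" by simp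
  then have "(x * y) * of_int (d * e) = of_int (n * m)" unfolding nd(2) me(2) by simp
  moreover have "[n * m = (z * d) * (w * e)] (mod p)"
    using nd(3) me(3) by (intro cong_mult)
  then have "[n * m = (z * w) * (d * e)] (mod p)"
    by (simp add: mult_ac)
  moreover have "\<not> p dvd d * e" using assms(1) nd(1) me(1) by (simp add: prime_dvd_mult_iff)
  ultimately show ?thesis unfolding rat_mod_def by blast
qed

lemma rat_mod_numeral: "prime p \<Longrightarrow> rat_mod p (numeral k) (numeral k)"
  using rat_mod_of_int[of p "numeral k"] by simp

lemma rat_mod_uminus: "prime p \<Longrightarrow> rat_mod p x z \<Longrightarrow> rat_mod p (- x) (- z)"
  using rat_mod_mult[OF _ rat_mod_of_int[of p "-1"], of x z] by simp

lemma rat_mod_diff: "prime p \<Longrightarrow> rat_mod p x z \<Longrightarrow> rat_mod p y w \<Longrightarrow> rat_mod p (x - y) (z - w)"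
  using rat_mod_add[OF _ _ rat_mod_uminus, of p x z y w] by simp

lemma rat_mod_power: "prime p \<Longrightarrow> rat_mod p x z \<Longrightarrow> rat_mod p (x ^ k) (z ^ k)"
  using rat_mod_of_int[of p 1] by (induction k) (auto intro: rat_mod_mult)

lemmas rat_mod_intros = rat_mod_of_int rat_mod_numeral rat_mod_add rat_mod_mult rat_mod_uminus
  rat_mod_diff rat_mod_power

lemma rat_mod_unique:
  assumes "prime p" "rat_mod p x z" "rat_mod p x w"
  shows "[z = w] (mod p)"
proof -
  obtain n d where nd: "\<not> p dvd d" "x * of_int d = of_int n" "[n = z * d] (mod p)"
    using assms(2) by (auto simp: rat_mod_def)
  obtain m e where me: "\<not> p dvd e" "x * of_int e = of_int m" "[m = w * e] (mod p)"
    using assms(3) by (auto simp: rat_mod_def)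
  have "of_int (n * e) = x * of_int d * of_int e" by (simp add: nd(2))
  also have "\<dots> = of_int (m * d)" by (simp add: me(2)[symmetric] mult_ac)
  finally have "n * e = m * d" by (simp only: of_int_eq_iff)
  moreover have "[n * e = z * d * e] (mod p)" "[m * d = w * e * d] (mod p)"
    using nd(3) me(3) by (auto intro: cong_mult)
  ultimately have "[z * (d * e) = w * (d * e)] (mod p)"
    by (metis cong_sym cong_trans mult.assoc mult.commute)
  moreover have "coprime (d * e) p"
    using assms(1) nd(1) me(1) by (metis coprime_commute prime_dvd_mult_iff prime_imp_coprime)
  ultimately show ?thesis by (metis cong_mult_rcancel)
qed

lemma rat_mod_exists:
  assumes "prime p" "\<not> p dvd d" "x * of_int d = of_int n"
  shows "\<exists>z. rat_mod p x z"
proof -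
  have "coprime d p" using assms by (metis coprime_commute prime_imp_coprime)
  then obtain v where "[d * v = 1] (mod p)" using cong_solve_coprime_int by blast
  then have "[n * (d * v) = n * 1] (mod p)" by (intro cong_mult cong_refl)
  then have "[n = n * v * d] (mod p)" by (simp add: cong_sym mult_ac)
  then show ?thesis using assms unfolding rat_mod_def by blast
qed

lemma rat_mod_half:
  assumes "prime p" "odd p" "rat_mod p (2 * x) z"
  shows "\<exists>w. rat_mod p x w"
proof -
  obtain n d where nd: "\<not> p dvd d" "2 * x * of_int d = of_int n"
    using assms(3) by (auto simp: rat_mod_def)
  have "\<not> p dvd 2"
  proof
    assume "p dvd 2"
    then have "p = 2" using prime_ge_2_int[OF assms(1)] zdvd_imp_le[of p 2] by simp
    then show False using assms(2) by simp
  qed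
  then have "\<not> p dvd d * 2" using nd(1) assms(1) by (simp add: prime_dvd_mult_iff)
  moreover have "x * of_int (d * 2) = of_int n" using nd(2) by simp
  ultimately show ?thesis using rat_mod_exists assms(1) by blast
qed

lemma rat_fraction:
  fixes x :: rat
  obtains n d :: int where "coprime n d" "d > 0" "x * of_int d = of_int n"
proof -
  obtain n d where "quotient_of x = (n, d)" by fastforce
  then have "x = of_int n / of_int d" "d > 0" "coprime n d"
    by (simp_all add: quotient_of_div quotient_of_denom_pos quotient_of_coprime)
  then show ?thesis by (intro that[of n d]) auto
qed

text \<open>If p divided the denominator of x, clearing denominators would make p divide the
  numerator too. This shows r to be integral even at p = 3, where integrality of 3r would say too
  little.\<close>

lemma rat_mod_cubic_root:
  assumes p: "prime p" and "rat_mod p c z" "x^3 + of_int a * x + c = 0"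
  shows "\<exists>w. rat_mod p x w"
proof -
  obtain n d where nd: "coprime n d" "d > 0" "x * of_int d = of_int n" by (rule rat_fraction)
  obtain m e where me: "\<not> p dvd e" "c * of_int e = of_int m"
    using assms(2) by (auto simp: rat_mod_def)
  have "\<not> p dvd d"
  proof
    assume "p dvd d"
    have "of_int (e * (n^3 + a * n * d^2) + m * d^3) = of_int e * of_int d ^ 3 * (x^3 + of_int a * x + c)"
      by (simp add: nd(3)[symmetric] me(2)[symmetric] algebra_simps power2_eq_square power3_eq_cube)
    then have "e * (n^3 + a * n * d^2) + m * d^3 = 0"
      unfolding assms(3) by (simp only: mult_zero_right of_int_eq_0_iff)
    then have "e * n^3 = d * (- (e * a * n * d) - m * d^2)"
      by (simp add: algebra_simps power2_eq_square power3_eq_cube)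
    then have "p dvd e * n^3" using \<open>p dvd d\<close> by simp
    then have "p dvd n" using p me(1) by (meson prime_dvd_mult_iff prime_dvd_power)
    then have "is_unit p" using \<open>p dvd d\<close> nd(1) by (meson coprime_common_divisor)
    then show False using p by (simp add: prime_int_iff)
  qed
  then show ?thesis using rat_mod_exists[OF p _ nd(3)] by blast
qed

text \<open>The conditions of \<open>isomorphic_over_Q\<close> from \<open>curve a b\<close> to W,
  with the substitution exposed.\<close>

definition substitution_to_curve ::
    "weierstrass \<Rightarrow> int \<Rightarrow> int \<Rightarrow> rat \<Rightarrow> rat \<Rightarrow> rat \<Rightarrow> rat \<Rightarrow> bool" where
  "substitution_to_curve W a b u r s t \<longleftrightarrow>
     u * of_int (wa1 W) = 2 * s \<and> u^2 * of_int (wa2 W) = 3 * r - s^2 \<and>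
     u^3 * of_int (wa3 W) = 2 * t \<and> u^4 * of_int (wa4 W) = of_int a + 3 * r^2 - 2 * s * t \<and>
     u^6 * of_int (wa6 W) = of_int b + r * of_int a + r^3 - t^2"

lemma substitution_to_curve_disc:
  fixes u r s t :: rat
  assumes "substitution_to_curve W a b u r s t"
  shows "u^12 * of_int (disc W) = of_int (disc (curve a b))"
proof -
  define w1 w2 w3 w4 w6 :: rat where "w1 = of_int (wa1 W)" and "w2 = of_int (wa2 W)"
    and "w3 = of_int (wa3 W)" and "w4 = of_int (wa4 W)" and "w6 = of_int (wa6 W)"
  define b2 b4 b6 where "b2 = w1^2 + 4 * w2" and "b4 = 2 * w4 + w1 * w3" and "b6 = w3^2 + 4 * w6"
  have e: "u * w1 = 2 * s" "u^2 * w2 = 3 * r - s^2" "u^3 * w3 = 2 * t"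
    "u^4 * w4 = of_int a + 3 * r^2 - 2 * s * t" "u^6 * w6 = of_int b + r * of_int a + r^3 - t^2"
    using assms unfolding substitution_to_curve_def w1_def w2_def w3_def w4_def w6_def by auto
  have "u^2 * b2 = (u * w1)^2 + 4 * (u^2 * w2)"
    by (simp add: b2_def algebra_simps power2_eq_square)
  then have B2: "u^2 * b2 = 12 * r" unfolding e by (simp add: algebra_simps power2_eq_square)
  have "u^4 * b4 = 2 * (u^4 * w4) + (u * w1) * (u^3 * w3)"
    by (simp add: b4_def algebra_simps eval_nat_numeral)
  then have B4: "u^4 * b4 = 2 * of_int a + 6 * r^2" unfolding e by (simp add: algebra_simps)
  have "u^6 * b6 = (u^3 * w3)^2 + 4 * (u^6 * w6)"
    by (simp add: b6_def algebra_simps eval_nat_numeral)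
  then have B6: "u^6 * b6 = 4 * of_int b + 4 * r * of_int a + 4 * r^3" unfolding e
    by (simp add: algebra_simps power2_eq_square)
  \<comment> \<open>Since 4 b8 = b2 b6 - b4^2, the factor 4 eliminates b8; only the transforms of
    b2, b4 and b6 are then needed.\<close>
  have "4 * of_int (disc W) = - (b2^2 * (b2 * b6 - b4^2)) - 32 * b4^3 - 108 * b6^2 + 36 * b2 * b4 * b6"
    by (simp add: disc_def Let_def b2_def b4_def b6_def w1_def w2_def w3_def w4_def w6_def
        algebra_simps power2_eq_square)
  then have "4 * (u^12 * of_int (disc W)) = u^12 * (- (b2^2 * (b2 * b6 - b4^2)) - 32 * b4^3 - 108 * b6^2 + 36 * b2 * b4 * b6)"
    by simp
  also have "\<dots> = - ((u^2 * b2)^2 * ((u^2 * b2) * (u^6 * b6) - (u^4 * b4)^2)) - 32 * (u^4 * b4)^3 - 108 * (u^6 * b6)^2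
     + 36 * (u^2 * b2) * (u^4 * b4) * (u^6 * b6)"
    by (simp add: algebra_simps eval_nat_numeral)
  also have "\<dots> = 4 * of_int (disc (curve a b))"
    unfolding B2 B4 B6 disc_curve Delta_def
    by (simp add: algebra_simps eval_nat_numeral)
  finally show ?thesis by simp
qed

text \<open>Modulo p the substitution is an injective, hence bijective, map of the affine plane, and
  it pulls the equation of the short curve back to u^6 times that of W. As only congruences are
  required of the parameters, the lemma serves both for reductions of rational substitutions and for
  twists.\<close>

lemma num_points_mod_substitution:
  fixes u r s t :: int
  assumes p: "prime (int p)" and u: "\<not> int p dvd u"
    and c1: "[u * wa1 W = 2 * s] (mod int p)" and c2: "[u^2 * wa2 W = 3 * r - s^2] (mod int p)"
    and c3: "[u^3 * wa3 W = 2 * t] (mod int p)"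
    and c4: "[u^4 * wa4 W = a + 3 * r^2 - 2 * s * t] (mod int p)"
    and c6: "[u^6 * wa6 W = b + r * a + r^3 - t^2] (mod int p)"
  shows "num_points_mod p W = num_points_mod p (curve a b)"
proof -
  let ?p = "int p"
  define T where "T = {0..<?p} \<times> {0..<?p}"
  define \<phi> where "\<phi> = (\<lambda>(x, y). ((u^2 * x + r) mod ?p, (u^3 * y + s * u^2 * x + t) mod ?p))"
  define A where "A W = (\<lambda>(x, y). y^2 + wa1 W * x * y + wa3 W * y - (x^3 + wa2 W * x^2 + wa4 W * x + wa6 W))" for W
  have pos: "?p > 0" using p prime_gt_0_int by blast
  have points: "num_points_mod p V = card {z \<in> T. ?p dvd A V z} + 1" for V
  proof -
    have "{(x, y). x \<in> {0..<?p} \<and> y \<in> {0..<?p} \<and>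
            (y^2 + wa1 V * x * y + wa3 V * y) mod ?p = (x^3 + wa2 V * x^2 + wa4 V * x + wa6 V) mod ?p}
        = {z \<in> T. ?p dvd A V z}"
      by (auto simp: T_def A_def mod_eq_dvd_iff)
    then show ?thesis by (simp add: num_points_mod_def)
  qed
  have "\<phi> ` T \<subseteq> T" using pos by (auto simp: \<phi>_def T_def)
  moreover have inj: "inj_on \<phi> T"
  proof (rule inj_onI, clarify)
    fix x y x' y' assume T: "(x, y) \<in> T" "(x', y') \<in> T" and eq: "\<phi> (x, y) = \<phi> (x', y')"
    have cancel: "z = z'" if "?p dvd u ^ k * (z - z')" "z \<in> {0..<?p}" "z' \<in> {0..<?p}" for z z' k
    proof -
      have "?p dvd z - z'" using that(1) p u by (meson prime_dvd_mult_iff prime_dvd_power)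
      then have "z mod ?p = z' mod ?p" by (simp add: mod_eq_dvd_iff)
      then show ?thesis using that by simp
    qed
    have "?p dvd (u^2 * x + r) - (u^2 * x' + r)"
      using eq by (auto simp: \<phi>_def mod_eq_dvd_iff)
    then have "?p dvd u^2 * (x - x')" by (simp add: algebra_simps)
    then have x: "x = x'" using T by (intro cancel) (auto simp: T_def)
    have "?p dvd (u^3 * y + s * u^2 * x + t) - (u^3 * y' + s * u^2 * x' + t)"
      using eq by (auto simp: \<phi>_def mod_eq_dvd_iff)
    then have "?p dvd u^3 * (y - y')" by (simp add: x algebra_simps)
    then have "y = y'" using T by (intro cancel) (auto simp: T_def)
    with x show "x = x' \<and> y = y'" by simp
  qed
  ultimately have surj: "\<phi> ` T = T"
    by (intro endo_inj_surj) (auto simp: T_def)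
  have "?p dvd A (curve a b) (\<phi> (x, y)) \<longleftrightarrow> ?p dvd A W (x, y)" for x y
  proof -
    define X Y where "X = u^2 * x + r" and "Y = u^3 * y + s * u^2 * x + t"
    have "[A (curve a b) (\<phi> (x, y)) = A (curve a b) (X, Y)] (mod ?p)"
      unfolding \<phi>_def A_def X_def[symmetric] Y_def[symmetric] prod.case
      by (intro cong_diff cong_add cong_mult cong_pow cong_refl) (simp_all add: cong_def)
    then have "?p dvd A (curve a b) (\<phi> (x, y)) \<longleftrightarrow> ?p dvd A (curve a b) (X, Y)"
      by (rule cong_dvd_iff)
    \<comment> \<open>The defects of the five congruences, each with the monomial that it multiplies
      in the expanded equation.\<close>
    moreover define E where "E = (u * wa1 W - 2 * s) * (u^5 * x * y) + (u^3 * wa3 W - 2 * t) * (u^3 * y)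
         - (u^2 * wa2 W - (3 * r - s^2)) * (u^4 * x^2)
         - (u^4 * wa4 W - (a + 3 * r^2 - 2 * s * t)) * (u^2 * x)
         - (u^6 * wa6 W - (b + r * a + r^3 - t^2))"
    have "u^6 * A W (x, y) = A (curve a b) (X, Y) + E"
      by (simp add: E_def A_def curve_def X_def Y_def algebra_simps eval_nat_numeral)
    moreover have "?p dvd E"
      unfolding E_def
      by (rule c1[unfolded cong_iff_dvd_diff] c2[unfolded cong_iff_dvd_diff] c3[unfolded cong_iff_dvd_diff]
          c4[unfolded cong_iff_dvd_diff] c6[unfolded cong_iff_dvd_diff] dvd_diff dvd_add dvd_mult2)+
    ultimately have "?p dvd A (curve a b) (\<phi> (x, y)) \<longleftrightarrow> ?p dvd u^6 * A W (x, y)"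
      by (simp only: dvd_add_left_iff)
    also have "\<dots> \<longleftrightarrow> ?p dvd A W (x, y)"
      using p u by (metis dvd_mult prime_dvd_mult_iff prime_dvd_power)
    finally show ?thesis .
  qed
  then have iff: "?p dvd A (curve a b) (\<phi> z) \<longleftrightarrow> ?p dvd A W z" for z by (cases z) simp
  have "{z \<in> T. ?p dvd A (curve a b) z} = \<phi> ` {z \<in> T. ?p dvd A W z}"
  proof (intro equalityI subsetI)
    fix z assume z: "z \<in> {z \<in> T. ?p dvd A (curve a b) z}"
    then obtain w where "w \<in> T" "z = \<phi> w" using surj by blast
    with z iff show "z \<in> \<phi> ` {z \<in> T. ?p dvd A W z}" by blast
  next
    fix z assume "z \<in> \<phi> ` {z \<in> T. ?p dvd A W z}"
    then obtain w where "w \<in> T" "?p dvd A W w" "z = \<phi> w" by blast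
    then show "z \<in> {z \<in> T. ?p dvd A (curve a b) z}" using surj iff by blast
  qed
  moreover have "inj_on \<phi> {z \<in> T. ?p dvd A W z}" using inj by (rule inj_on_subset) auto
  ultimately show ?thesis unfolding points by (simp add: card_image)
qed

lemma num_points_curve: "num_points_mod p (curve a b) = card (affine_points p a b) + 1"
  by (simp add: num_points_mod_def affine_points_def curve_def)

context
  fixes p :: nat and a b :: int
  assumes prime_p: "prime p" and odd_p: "odd p" and good: "\<not> int p dvd Delta a b"
begin

lemma prime_int_p: "prime (int p)" using prime_p by simp

lemma not_dvd_disc_curve: "\<not> int p dvd disc (curve a b)"
proof -
  have "\<not> int p dvd 2"
  proof
    assume "int p dvd 2"
    then have "p dvd 2" by (metis int_dvd_int_iff of_nat_numeral)
    then show False using prime_p odd_p by (metis primes_dvd_imp_eq two_is_prime_nat even_numeral)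
  qed
  then have "\<not> int p dvd 2 ^ 4" using prime_int_p prime_dvd_power by blast
  then show ?thesis using good prime_int_p by (simp add: disc_curve prime_dvd_mult_iff)
qed

lemma minimal_model_substitution:
  obtains u r s t where "u \<noteq> 0" "substitution_to_curve (minimal_model p (curve a b)) a b u r s t"
  using minimal_model_at_minimal_model[of p "curve a b"]
  unfolding minimal_model_at_def isomorphic_over_Q_def substitution_to_curve_def
  by (auto simp: curve_def Let_def)

lemma not_dvd_disc_minimal_model: "\<not> int p dvd disc (minimal_model p (curve a b))"
proof -
  obtain u r s t where u: "u \<noteq> 0"
    and e: "substitution_to_curve (minimal_model p (curve a b)) a b u r s t"
    by (rule minimal_model_substitution)
  \<comment> \<open>The multiplicity of p in 0 is 0 by convention, so a vanishing discriminant would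
    pass the comparison of multiplicities below.\<close>
  have "disc (minimal_model p (curve a b)) \<noteq> 0"
    using substitution_to_curve_disc[OF e] not_dvd_disc_curve u by auto
  moreover have "multiplicity (int p) (disc (minimal_model p (curve a b))) \<le> multiplicity (int p) (disc (curve a b))"
    using minimal_model_at_minimal_model[of p "curve a b"] isomorphic_over_Q_refl
    unfolding minimal_model_at_def by blast
  moreover have "multiplicity (int p) (disc (curve a b)) = 0"
    using not_dvd_disc_curve by (rule not_dvd_imp_multiplicity_0)
  ultimately show ?thesis
    using prime_int_p by (simp add: multiplicity_eq_zero_iff prime_elem_multiplicity_eq_zero_iff)
qed

text \<open>Both discriminants are prime to p and differ by the factor u^12, so u is a unit at p.
  The equations for a1 and a3 then give the integrality of s and t by halving, and the one for a6
  gives that of r; hence the whole substitution can be reduced modulo p.\<close>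

lemma num_points_minimal_model:
  "num_points_mod p (minimal_model p (curve a b)) = num_points_mod p (curve a b)"
proof -
  define W where "W = minimal_model p (curve a b)"
  obtain u r s t where subst: "substitution_to_curve W a b u r s t"
    using minimal_model_substitution unfolding W_def by metis
  then have e1: "u * of_int (wa1 W) = 2 * s" and e2: "u^2 * of_int (wa2 W) = 3 * r - s^2"
    and e3: "u^3 * of_int (wa3 W) = 2 * t" and e4: "u^4 * of_int (wa4 W) = of_int a + 3 * r^2 - 2 * s * t"
    and e6: "u^6 * of_int (wa6 W) = of_int b + r * of_int a + r^3 - t^2"
    unfolding substitution_to_curve_def by auto
  let ?p = "int p"
  note p = prime_int_p
  obtain n d where nd: "coprime n d" "d > 0" "u * of_int d = of_int n" by (rule rat_fraction)
  have "of_int (n^12 * disc W) = of_int d ^ 12 * (u^12 * of_int (disc W))"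
    by (simp add: nd(3)[symmetric] power_mult_distrib)
  also have "\<dots> = of_int (d^12 * disc (curve a b))"
    unfolding substitution_to_curve_disc[OF subst] by simp
  finally have eq: "n^12 * disc W = d^12 * disc (curve a b)" by (simp only: of_int_eq_iff)
  have "\<not> ?p dvd d"
  proof
    assume "?p dvd d"
    then have "?p dvd n^12 * disc W" unfolding eq by (meson dvd_mult2 dvd_power dvd_trans zero_less_numeral)
    then have "?p dvd n" using p not_dvd_disc_minimal_model unfolding W_def
      by (meson prime_dvd_mult_iff prime_dvd_power)
    then have "is_unit ?p" using \<open>?p dvd d\<close> nd(1) by (meson coprime_common_divisor)
    then show False using p not_prime_unit by blast
  qed
  have "\<not> ?p dvd n"
  proof
    assume "?p dvd n"
    then have "?p dvd d^12 * disc (curve a b)" unfolding eq[symmetric] by (meson dvd_mult2 dvd_power dvd_trans zero_less_numeral)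
    then show False using p not_dvd_disc_curve \<open>\<not> ?p dvd d\<close>
      by (meson prime_dvd_mult_iff prime_dvd_power)
  qed
  obtain u' where u': "rat_mod ?p u u'" using rat_mod_exists[OF p \<open>\<not> ?p dvd d\<close> nd(3)] by blast
  have "\<not> ?p dvd u'"
  proof
    assume "?p dvd u'"
    have "rat_mod ?p (of_int n) (u' * d)"
      unfolding nd(3)[symmetric] by (intro rat_mod_intros p u')
    then have "[n = u' * d] (mod ?p)" using rat_mod_unique[OF p] rat_mod_of_int[OF p] by blast
    then show False using \<open>?p dvd u'\<close> \<open>\<not> ?p dvd n\<close> by (metis cong_dvd_iff dvd_mult2)
  qed
  have oddp: "odd ?p" using odd_p by simp
  have "rat_mod ?p (2 * s) (u' * wa1 W)" unfolding e1[symmetric] by (intro rat_mod_intros p u')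
  then obtain s' where s': "rat_mod ?p s s'" using rat_mod_half[OF p oddp] by blast
  have "rat_mod ?p (2 * t) (u'^3 * wa3 W)" unfolding e3[symmetric] by (intro rat_mod_intros p u')
  then obtain t' where t': "rat_mod ?p t t'" using rat_mod_half[OF p oddp] by blast
  \<comment> \<open>The equation for a6, read as a monic cubic in r.\<close>
  have "r^3 + of_int a * r + (of_int b - t^2 - u^6 * of_int (wa6 W)) = 0"
    unfolding e6 by (simp add: algebra_simps)
  moreover have "rat_mod ?p (of_int b - t^2 - u^6 * of_int (wa6 W)) (b - t'^2 - u'^6 * wa6 W)"
    by (intro rat_mod_intros p u' t')
  ultimately obtain r' where r': "rat_mod ?p r r'" using rat_mod_cubic_root[OF p] by blast
  have "num_points_mod p W = num_points_mod p (curve a b)"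
  proof (rule num_points_mod_substitution[OF p \<open>\<not> ?p dvd u'\<close>])
    note red = rat_mod_unique[OF p]
    show "[u' * wa1 W = 2 * s'] (mod ?p)"
      by (rule red[of "u * of_int (wa1 W)"], intro rat_mod_intros p u', unfold e1, intro rat_mod_intros p s')
    show "[u'^2 * wa2 W = 3 * r' - s'^2] (mod ?p)"
      by (rule red[of "u^2 * of_int (wa2 W)"], intro rat_mod_intros p u', unfold e2, intro rat_mod_intros p s' r')
    show "[u'^3 * wa3 W = 2 * t'] (mod ?p)"
      by (rule red[of "u^3 * of_int (wa3 W)"], intro rat_mod_intros p u', unfold e3, intro rat_mod_intros p t')
    show "[u'^4 * wa4 W = a + 3 * r'^2 - 2 * s' * t'] (mod ?p)"
      by (rule red[of "u^4 * of_int (wa4 W)"], intro rat_mod_intros p u', unfold e4, intro rat_mod_intros p s' t' r')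
    show "[u'^6 * wa6 W = b + r' * a + r'^3 - t'^2] (mod ?p)"
      by (rule red[of "u^6 * of_int (wa6 W)"], intro rat_mod_intros p u', unfold e6, intro rat_mod_intros p t' r')
  qed
  then show ?thesis by (simp add: W_def)
qed

lemma good_reduction_curve: "good_reduction (curve a b) p"
  using not_dvd_disc_minimal_model by (simp add: good_reduction_def)

lemma frob_trace_curve: "frob_trace (curve a b) p = int p - int (card (affine_points p a b))"
  by (simp add: frob_trace_def num_points_minimal_model num_points_curve)

end


lemma cong_affine_points:
  assumes "[a = a'] (mod int p)" "[b = b'] (mod int p)"
  shows "affine_points p a b = affine_points p a' b'"
proof -
  have "[x^3 + a * x + b = x^3 + a' * x + b'] (mod int p)" for x
    by (intro cong_add cong_mult cong_refl assms)
  then show ?thesis unfolding affine_points_def cong_def by simp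
qed

text \<open>The substitution with u = l and r = s = t = 0, which sends (x, y) to (l^2 x, l^3
  y).\<close>

lemma card_affine_points_twist:
  assumes "prime p" "\<not> int p dvd l"
  shows "card (affine_points p (l^4 * a) (l^6 * b)) = card (affine_points p a b)"
proof -
  have "num_points_mod p (curve a b) = num_points_mod p (curve (l^4 * a) (l^6 * b))"
    by (rule num_points_mod_substitution[of p l _ 0 0 0]) (use assms in \<open>simp_all add: curve_def\<close>)
  then show ?thesis by (simp add: num_points_curve)
qed

section \<open>Coefficients of the Euler factors and their bound by the divisor function\<close>

definition quadratic_fps :: "real \<Rightarrow> real \<Rightarrow> real fps" where
  "quadratic_fps c q = 1 - fps_const c * fps_X + fps_const q * fps_X^2"

lemma fps_nth_inverse_quadratic:
  fixes c q :: real
  defines "f \<equiv> quadratic_fps c q"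
  shows "fps_nth (inverse f) 0 = 1" "fps_nth (inverse f) (Suc 0) = c"
    "fps_nth (inverse f) (Suc (Suc m)) = c * fps_nth (inverse f) (Suc m) - q * fps_nth (inverse f) m"
proof -
  have f0: "fps_nth f 0 \<noteq> 0" by (simp add: f_def quadratic_fps_def)
  define g where "g = inverse f"
  have fg: "f * g = 1" using inverse_mult_eq_1'[OF f0] by (simp add: g_def)
  have eq: "f * g = g - fps_const c * (fps_X * g) + fps_const q * (fps_X * (fps_X * g))"
    by (simp add: f_def quadratic_fps_def algebra_simps power2_eq_square)
  show g0: "fps_nth (inverse f) 0 = 1"
    using arg_cong[OF fg, of "\<lambda>h. fps_nth h 0"] unfolding eq g_def[symmetric] by simp
  show "fps_nth (inverse f) (Suc 0) = c"
    using arg_cong[OF fg, of "\<lambda>h. fps_nth h (Suc 0)"] g0 unfolding eq g_def[symmetric] by simp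
  show "fps_nth (inverse f) (Suc (Suc m)) = c * fps_nth (inverse f) (Suc m) - q * fps_nth (inverse f) m"
    using arg_cong[OF fg, of "\<lambda>h. fps_nth h (Suc (Suc m))"] unfolding eq g_def[symmetric]
    by (simp add: algebra_simps)
qed

text \<open>The hypothesis makes the reciprocal zeros a conjugate pair of absolute value sqrt(q).
  The coefficient is the complete homogeneous sum \<open>h m\<close> in them, with m + 1 terms of
  absolute value sqrt(q)^m; this form also covers a double zero.\<close>

lemma inverse_quadratic_coeff_bound:
  fixes c q :: real
  assumes "c^2 \<le> 4 * q"
  shows "\<bar>fps_nth (inverse (quadratic_fps c q)) m\<bar> \<le> real (m + 1) * sqrt q ^ m"
proof -
  define g where "g = fps_nth (inverse (quadratic_fps c q))"
  define \<alpha> where "\<alpha> = Complex (c / 2) (sqrt (4 * q - c^2) / 2)"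
  define h where "h m = (\<Sum>i\<le>m. \<alpha>^i * cnj \<alpha>^(m - i))" for m
  have sum: "\<alpha> + cnj \<alpha> = of_real c" by (simp add: \<alpha>_def complex_eq_iff)
  have "cmod \<alpha> ^ 2 = q"
    using assms by (simp add: \<alpha>_def cmod_power2 power_divide field_simps)
  then have norm: "cmod \<alpha> = sqrt q" by (metis norm_ge_zero real_sqrt_unique)
  have prod: "\<alpha> * cnj \<alpha> = of_real q"
    using \<open>cmod \<alpha> ^ 2 = q\<close> by (simp add: complex_norm_square[symmetric])
  have h_Suc: "h (Suc m) = \<alpha> * h m + cnj \<alpha> ^ Suc m" for m
    unfolding h_def by (subst sum.atMost_Suc_shift) (simp add: sum_distrib_left mult_ac)
  have h_rec: "h (Suc (Suc m)) = of_real c * h (Suc m) - of_real q * h m" for m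
    unfolding h_Suc[of "Suc m"] sum[symmetric] prod[symmetric]
    by (simp add: h_Suc algebra_simps)
  have "of_real (g m) = h m \<and> of_real (g (Suc m)) = h (Suc m)"
  proof (induction m)
    case 0
    show ?case using sum unfolding g_def fps_nth_inverse_quadratic by (simp add: h_Suc) (simp add: h_def)
  next
    case (Suc m)
    have "g (Suc (Suc m)) = c * g (Suc m) - q * g m"
      unfolding g_def by (rule fps_nth_inverse_quadratic)
    then show ?case using Suc by (simp add: h_rec)
  qed
  then have "\<bar>g m\<bar> = cmod (h m)" by (metis norm_of_real real_norm_def)
  also have "\<dots> \<le> (\<Sum>i\<le>m. cmod (\<alpha>^i * cnj \<alpha>^(m - i)))"
    unfolding h_def by (rule norm_sum)
  also have "\<dots> = (\<Sum>i\<le>m. sqrt q ^ m)"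
    by (rule sum.cong) (simp_all add: norm_mult norm_power norm flip: power_add)
  finally show ?thesis by (simp add: g_def)
qed

text \<open>Unique factorisation: divisors correspond to exponent functions bounded by that of
  n.\<close>

lemma num_divisors_eq_prod:
  assumes "n > 0"
  shows "num_divisors n = (\<Prod>p\<in>prime_factors n. multiplicity p n + 1)"
proof -
  define P where "P = prime_factors n"
  have P: "finite P" "\<And>p. p \<in> P \<Longrightarrow> prime p" by (auto simp: P_def)
  define F where "F g = (\<Prod>p\<in>P. p ^ g p)" for g :: "nat \<Rightarrow> nat"
  have mult: "multiplicity p (F g) = (if p \<in> P then g p else 0)" if "prime p" for p g
    unfolding F_def using P that by (simp add: multiplicity_prod_prime_powers)
  have pos: "p > 0" if "p \<in> P" for p using P(2)[OF that] by (rule prime_gt_0_nat)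
  have nz: "F g \<noteq> 0" for g
  proof -
    have "F g > 0" unfolding F_def by (rule prod_pos) (simp add: pos)
    then show ?thesis by simp
  qed
  have "bij_betw F (Pi\<^sub>E P (\<lambda>p. {0..multiplicity p n})) {d. d dvd n}"
  proof (rule bij_betw_byWitness[where f' = "\<lambda>d. restrict (\<lambda>p. multiplicity p d) P"])
    show "\<forall>g\<in>Pi\<^sub>E P (\<lambda>p. {0..multiplicity p n}). restrict (\<lambda>p. multiplicity p (F g)) P = g"
      using P mult by (auto simp: fun_eq_iff PiE_def extensional_def)
    show "\<forall>d\<in>{d. d dvd n}. F (restrict (\<lambda>p. multiplicity p d) P) = d"
    proof
      fix d assume "d \<in> {d. d dvd n}"
      then have d: "d dvd n" "d \<noteq> 0" using assms by auto
      show "F (restrict (\<lambda>p. multiplicity p d) P) = d"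
      proof (rule multiplicity_eq_nat)
        fix p :: nat assume "prime p"
        show "multiplicity p (F (restrict (\<lambda>p. multiplicity p d) P)) = multiplicity p d"
          using d \<open>prime p\<close> assms unfolding mult[OF \<open>prime p\<close>]
          by (cases "p dvd d") (auto simp: P_def prime_factors_dvd not_dvd_imp_multiplicity_0)
      qed (use nz d in auto)
    qed
    show "F ` Pi\<^sub>E P (\<lambda>p. {0..multiplicity p n}) \<subseteq> {d. d dvd n}"
    proof clarify
      fix g assume g: "g \<in> Pi\<^sub>E P (\<lambda>p. {0..multiplicity p n})"
      show "F g dvd n"
      proof (rule multiplicity_le_imp_dvd)
        fix p :: nat assume "prime p"
        show "multiplicity p (F g) \<le> multiplicity p n"
          using g by (auto simp: mult[OF \<open>prime p\<close>])
      qed (rule nz)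
    qed
    show "(\<lambda>d. restrict (\<lambda>p. multiplicity p d) P) ` {d. d dvd n} \<subseteq> Pi\<^sub>E P (\<lambda>p. {0..multiplicity p n})"
      using assms by (auto intro!: dvd_imp_multiplicity_le)
  qed
  then have "card (Pi\<^sub>E P (\<lambda>p. {0..multiplicity p n})) = num_divisors n"
    unfolding num_divisors_def by (rule bij_betw_same_card)
  then show ?thesis by (simp add: card_PiE P P_def)
qed

lemma coprime_nat_int_iff: "coprime a (int n) \<longleftrightarrow> (\<forall>p. prime p \<longrightarrow> p dvd n \<longrightarrow> \<not> int p dvd a)" if "n > 0"
proof
  assume "coprime a (int n)"
  then show "\<forall>p. prime p \<longrightarrow> p dvd n \<longrightarrow> \<not> int p dvd a"
    by (meson coprime_common_divisor int_dvd_int_iff not_prime_unit prime_nat_int_transfer)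
next
  assume *: "\<forall>p. prime p \<longrightarrow> p dvd n \<longrightarrow> \<not> int p dvd a"
  show "coprime a (int n)"
  proof (rule ccontr)
    assume "\<not> coprime a (int n)"
    then have "gcd a (int n) \<noteq> 1" by (simp add: coprime_iff_gcd_eq_1)
    moreover have "gcd a (int n) \<noteq> 0" "gcd a (int n) \<ge> 0" using that by auto
    ultimately have "\<not> is_unit (gcd a (int n))" by (metis abs_of_nonneg zdvd1_eq)
    then obtain q where q: "prime q" "q dvd gcd a (int n)"
      using prime_divisor_exists[OF \<open>gcd a (int n) \<noteq> 0\<close>] by blast
    then have "q dvd a" "q dvd int n" "int (nat q) = q" by (auto simp: prime_ge_0_int)
    then show False using * q(1) by (metis int_dvd_int_iff prime_nat_int_transfer)
  qed
qed

lemma admissible_good: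
  assumes "admissible n a b" "p \<in> prime_factors n"
  shows "prime p" "\<not> int p dvd Delta a b"
proof -
  show "prime p" using assms by auto
  have "n > 0" using assms(2) by (auto intro!: Nat.gr0I)
  then have "\<not> int p dvd a * b * Delta a b"
    using assms \<open>prime p\<close> unfolding admissible_def
    by (metis coprime_nat_int_iff in_prime_factors_imp_dvd)
  then show "\<not> int p dvd Delta a b" by auto
qed

text \<open>The coefficient read off from the short equation itself. It makes sense for all a and b
  and depends only on their residues at the primes of n; for odd n and admissible pairs it is the
  true coefficient.\<close>

definition trace_coeff :: "int \<Rightarrow> int \<Rightarrow> nat \<Rightarrow> real" where
  "trace_coeff a b n = (\<Prod>p\<in>prime_factors n. fps_nth (inverse (quadratic_fps (int p - int (card (affine_points p a b))) p)) (multiplicity p n)) / sqrt (real n)"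

lemma L_coeff_normalized_eq:
  assumes "odd n" "admissible n a b"
  shows "L_coeff_normalized (curve a b) n = trace_coeff a b n"
proof -
  have "euler_poly (curve a b) p = quadratic_fps (int p - int (card (affine_points p a b))) p" if "p \<in> prime_factors n" for p
  proof -
    note g = admissible_good[OF assms(2) that]
    have "odd p" using that assms(1) by (metis dvd_trans in_prime_factors_imp_dvd)
    show ?thesis unfolding euler_poly_def quadratic_fps_def
      using good_reduction_curve[OF g(1) \<open>odd p\<close> g(2)] frob_trace_curve[OF g(1) \<open>odd p\<close> g(2)] by simp
  qed
  then show ?thesis unfolding L_coeff_normalized_def L_coeff_def trace_coeff_def by simp
qed

text \<open>By the Hasse bound a prime power p^e contributes at most (e + 1) p^(e/2); the product of
  these is d(n) sqrt(n).\<close>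

lemma trace_coeff_bound:
  assumes "odd n" "admissible n a b"
  shows "\<bar>trace_coeff a b n\<bar> \<le> real (num_divisors n)"
proof -
  have "n > 0" using assms(1) by (auto intro!: Nat.gr0I)
  have "\<bar>\<Prod>p\<in>prime_factors n. fps_nth (inverse (quadratic_fps (int p - int (card (affine_points p a b))) p)) (multiplicity p n)\<bar>
    \<le> (\<Prod>p\<in>prime_factors n. real (multiplicity p n + 1) * sqrt (real p) ^ multiplicity p n)"
    unfolding abs_prod
  proof (rule prod_mono, intro conjI)
    fix p assume p: "p \<in> prime_factors n"
    note g = admissible_good[OF assms(2) p]
    have "odd p" using p assms(1) by (metis dvd_trans in_prime_factors_imp_dvd)
    have "(int p - int (card (affine_points p a b)))^2 \<le> 4 * int p"
      using hasse_bound[OF g(1) \<open>odd p\<close>] g(2) by (simp add: Delta_def)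
    then have "real_of_int ((int p - int (card (affine_points p a b)))^2) \<le> real_of_int (4 * int p)"
      by (simp only: of_int_le_iff)
    then show "\<bar>fps_nth (inverse (quadratic_fps (int p - int (card (affine_points p a b))) p)) (multiplicity p n)\<bar> \<le> real (multiplicity p n + 1) * sqrt (real p) ^ multiplicity p n"
      by (intro inverse_quadratic_coeff_bound) simp
  qed simp
  also have "\<dots> = real (num_divisors n) * sqrt (\<Prod>p\<in>prime_factors n. real p ^ multiplicity p n)"
  proof -
    have "sqrt (\<Prod>p\<in>A. g p) = (\<Prod>p\<in>A. sqrt (g p))" for A and g :: "nat \<Rightarrow> real"
      by (induction A rule: infinite_finite_induct) (simp_all add: real_sqrt_mult)
    then show ?thesis using \<open>n > 0\<close> by (simp add: num_divisors_eq_prod prod.distrib real_sqrt_power)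
  qed
  also have "(\<Prod>p\<in>prime_factors n. real p ^ multiplicity p n) = real n"
    using arg_cong[OF prime_factorization_nat[OF \<open>n > 0\<close>], of real] by simp
  finally show ?thesis
    using \<open>n > 0\<close> by (simp add: trace_coeff_def divide_le_eq)
qed

subsection \<open>Congruences between products\<close>


definition sym_interval :: "nat \<Rightarrow> int set" where
  "sym_interval n = {- int n..int n} - {0}"

text \<open>The majorant, as a function of the product m = x y alone, for a product of two kernel
  weights; see \<open>recip_weight_mult_le\<close>.\<close>

definition trunc_recip :: "real \<Rightarrow> real \<Rightarrow> int \<Rightarrow> real" where
  "trunc_recip A c m = min A (c / \<bar>real_of_int m\<bar>)"

definition harmonic :: "nat \<Rightarrow> real" where
  "harmonic n = (\<Sum>j=1..n. 1 / real j)"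

lemma finite_sym_interval [simp]: "finite (sym_interval n)"
  by (simp add: sym_interval_def)

lemma nat_abs_sym_interval: "m \<in> sym_interval n \<Longrightarrow> nat \<bar>m\<bar> \<in> {1..n}"
  by (auto simp: sym_interval_def nat_le_iff)

lemma harmonic_nonneg: "harmonic n \<ge> 0"
  unfolding harmonic_def by (intro sum_nonneg) auto

lemma harmonic_mono: "m \<le> n \<Longrightarrow> harmonic m \<le> harmonic n"
  unfolding harmonic_def by (intro sum_mono2) auto

lemma sum_sym_interval:
  fixes g :: "int \<Rightarrow> real"
  shows "(\<Sum>m\<in>sym_interval n. g m) = (\<Sum>j=1..n. g (int j)) + (\<Sum>j=1..n. g (- int j))"
proof -
  have "sym_interval n = int ` {1..n} \<union> (\<lambda>j. - int j) ` {1..n}"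
  proof (intro equalityI subsetI)
    fix m assume "m \<in> sym_interval n"
    then have "nat \<bar>m\<bar> \<in> {1..n}" by (rule nat_abs_sym_interval)
    moreover have "m = int (nat \<bar>m\<bar>) \<or> m = - int (nat \<bar>m\<bar>)" by arith
    ultimately show "m \<in> int ` {1..n} \<union> (\<lambda>j. - int j) ` {1..n}" by blast
  qed (auto simp: sym_interval_def)
  moreover have "int ` {1..n} \<inter> (\<lambda>j. - int j) ` {1..n} = {}" by auto
  moreover have "inj_on int {1..n}" "inj_on (\<lambda>j. - int j) {1..n}" by (auto simp: inj_on_def)
  ultimately show ?thesis by (simp add: sum.union_disjoint sum.reindex)
qed

lemma trunc_recip_nonneg: "A \<ge> 0 \<Longrightarrow> c \<ge> 0 \<Longrightarrow> trunc_recip A c m \<ge> 0"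
  by (simp add: trunc_recip_def)

lemma sum_trunc_recip_le:
  assumes "c \<ge> 0"
  shows "(\<Sum>m\<in>sym_interval n. trunc_recip A c m) \<le> 2 * c * harmonic n"
proof -
  have "(\<Sum>j=1..n. trunc_recip A c (int j)) \<le> (\<Sum>j=1..n. c * (1 / real j))"
    "(\<Sum>j=1..n. trunc_recip A c (- int j)) \<le> (\<Sum>j=1..n. c * (1 / real j))"
    by (intro sum_mono; simp add: trunc_recip_def)+
  then show ?thesis
    unfolding sum_sym_interval harmonic_def sum_distrib_left[symmetric] by simp
qed

text \<open>A residue class meets each block of q consecutive integers at most once. The first block
  costs at most A and the j-th block after it at most c / (q j); up to q^2 there are q blocks, which
  gives a harmonic sum of length at most q.\<close>

lemma sum_trunc_recip_class_pos:
  assumes "q > 0" "A \<ge> 0" "c \<ge> 0" "harmonic q \<le> L"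
  shows "(\<Sum>m' | m' \<in> {1..int (q^2)} \<and> int q dvd m - m'. trunc_recip A c m') \<le> A + c * L / real q"
proof -
  define P where "P = {m'. m' \<in> {1..int (q^2)} \<and> int q dvd m - m'}"
  define J where "J m' = nat ((m' - 1) div int q)" for m'
  define g where "g j = (if j = 0 then A else c / (real q * real j))" for j :: nat
  have g_nonneg: "g j \<ge> 0" for j using assms by (simp add: g_def)
  have J: "int (J m') = (m' - 1) div int q" if "m' \<in> P" for m'
    using that assms(1) unfolding J_def P_def by (simp add: pos_imp_zdiv_nonneg_iff)
  have inj: "inj_on J P"
  proof (rule inj_onI)
    fix x y assume xy: "x \<in> P" "y \<in> P" "J x = J y"
    then have "(x - 1) div int q = (y - 1) div int q" using J by metis
    moreover have "(x - 1) mod int q = (y - 1) mod int q"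
    proof -
      have "int q dvd m - y" "int q dvd m - x" using xy by (simp_all add: P_def)
      then have "int q dvd (m - y) - (m - x)" by (rule dvd_diff)
      then show ?thesis by (simp add: mod_eq_dvd_iff)
    qed
    ultimately have "(x - 1) div int q * int q + (x - 1) mod int q = (y - 1) div int q * int q + (y - 1) mod int q"
      by (simp only:)
    then show "x = y" by (simp only: div_mult_mod_eq)
  qed
  have "trunc_recip A c x \<le> g (J x)" if x: "x \<in> P" for x
  proof (cases "J x = 0")
    case True then show ?thesis by (simp add: g_def trunc_recip_def)
  next
    case False
    have "int q * int (J x) \<le> x - 1"
      unfolding J[OF x] using assms(1) mult_div_mod_eq[of "int q" "x - 1"] pos_mod_sign[of "int q" "x - 1"]
      by linarith
    then have "real_of_int (int q * int (J x)) \<le> real_of_int x" by (simp only: of_int_le_iff)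
    then have le: "real q * real (J x) \<le> \<bar>real_of_int x\<bar>" by simp
    have "real q * real (J x) > 0" using False assms(1) by simp
    then have "c / \<bar>real_of_int x\<bar> \<le> c / (real q * real (J x))"
      using le assms(3) by (intro divide_left_mono) auto
    then show ?thesis using False by (simp add: g_def trunc_recip_def)
  qed
  then have "(\<Sum>x\<in>P. trunc_recip A c x) \<le> (\<Sum>x\<in>P. g (J x))" by (rule sum_mono)
  also have "\<dots> = (\<Sum>j\<in>J ` P. g j)" using inj by (simp add: sum.reindex)
  also have "\<dots> \<le> (\<Sum>j\<in>{0..q}. g j)"
  proof (rule sum_mono2)
    show "J ` P \<subseteq> {0..q}"
    proof clarify
      fix x assume x: "x \<in> P"
      have "(x - 1) div int q \<le> int (q^2) div int q"
        using x assms(1) by (intro zdiv_mono1) (auto simp: P_def)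
      then have "int (J x) \<le> int q" using J[OF x] assms(1) by (simp add: power2_eq_square)
      then show "J x \<in> {0..q}" by simp
    qed
  qed (auto simp: g_nonneg)
  also have "\<dots> = A + (\<Sum>j=1..q. g j)"
    by (simp add: sum.atLeast_Suc_atMost[of 0] g_def)
  also have "(\<Sum>j=1..q. g j) = c * harmonic q / real q"
    unfolding harmonic_def g_def by (simp add: sum_distrib_left sum_divide_distrib mult_ac)
  also have "A + c * harmonic q / real q \<le> A + c * L / real q"
    using assms by (intro add_left_mono divide_right_mono mult_left_mono) auto
  finally show ?thesis by (simp add: P_def)
qed

lemma sum_trunc_recip_class:
  assumes "q > 0" "A \<ge> 0" "c \<ge> 0" "harmonic q \<le> L"
  shows "(\<Sum>m' | m' \<in> sym_interval (q^2) \<and> int q dvd m - m'. trunc_recip A c m')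
           \<le> 2 * A + 2 * c * L / real q"
proof -
  let ?P = "\<lambda>m. {m'. m' \<in> {1..int (q^2)} \<and> int q dvd m - m'}"
  have split: "{m'. m' \<in> sym_interval (q^2) \<and> int q dvd m - m'} = ?P m \<union> uminus ` ?P (- m)"
  proof (intro equalityI subsetI)
    fix x assume x: "x \<in> {m'. m' \<in> sym_interval (q^2) \<and> int q dvd m - m'}"
    show "x \<in> ?P m \<union> uminus ` ?P (- m)"
    proof (cases "x > 0")
      case False
      have "int q dvd - (m - x)" using x by (simp only: dvd_minus_iff) simp
      then have "- x \<in> ?P (- m)" using False x by (auto simp: sym_interval_def)
      then have "- (- x) \<in> uminus ` ?P (- m)" by (rule imageI)
      then show ?thesis unfolding minus_minus by (rule UnI2)
    qed (use x in \<open>auto simp: sym_interval_def\<close>)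
  next
    fix x assume "x \<in> ?P m \<union> uminus ` ?P (- m)"
    then show "x \<in> {m'. m' \<in> sym_interval (q^2) \<and> int q dvd m - m'}"
    proof
      assume "x \<in> uminus ` ?P (- m)"
      then obtain y where y: "x = - y" "y \<in> ?P (- m)" by blast
      then have "int q dvd - (- m - y)" by (simp only: dvd_minus_iff) simp
      then show ?thesis using y by (auto simp: sym_interval_def add.commute)
    qed (auto simp: sym_interval_def)
  qed
  have "(\<Sum>m'\<in>?P m \<union> uminus ` ?P (- m). trunc_recip A c m')
      = (\<Sum>m'\<in>?P m. trunc_recip A c m') + (\<Sum>m'\<in>uminus ` ?P (- m). trunc_recip A c m')"
  proof (rule sum.union_disjoint)
    show "finite (?P m)" "finite (uminus ` ?P (- m))"
      by (auto intro!: finite_imageI intro: finite_subset[of _ "{1..int (q^2)}"])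
  qed auto
  also have "(\<Sum>m'\<in>uminus ` ?P (- m). trunc_recip A c m') = (\<Sum>m'\<in>?P (- m). trunc_recip A c m')"
    by (subst sum.reindex) (auto simp: trunc_recip_def)
  finally have "(\<Sum>m'\<in>?P m \<union> uminus ` ?P (- m). trunc_recip A c m')
      \<le> (A + c * L / real q) + (A + c * L / real q)"
    using sum_trunc_recip_class_pos[OF assms, of m] sum_trunc_recip_class_pos[OF assms, of "- m"] by linarith
  then show ?thesis unfolding split by (simp add: algebra_simps)
qed

text \<open>The first factor determines the second and is, up to sign, a divisor of m.\<close>

lemma card_factorizations_le:
  assumes "m \<noteq> 0"
  shows "card {(x, y). x \<in> sym_interval n \<and> y \<in> sym_interval n \<and> x * y = m}
           \<le> 2 * num_divisors (nat \<bar>m\<bar>)"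
proof -
  define S where "S = {(x, y). x \<in> sym_interval n \<and> y \<in> sym_interval n \<and> x * y = m}"
  define D where "D = {d. d dvd nat \<bar>m\<bar>}"
  have "finite D" unfolding D_def by (rule finite_divisors_nat) (use assms in simp)
  have "inj_on fst S" using assms by (auto simp: inj_on_def S_def)
  moreover have "fst ` S \<subseteq> int ` D \<union> (\<lambda>d. - int d) ` D"
  proof clarify
    fix x y assume xy: "(x, y) \<in> S" "fst (x, y) \<notin> (\<lambda>d. - int d) ` D"
    then have "x dvd m" by (auto simp: S_def)
    then have D: "nat \<bar>x\<bar> \<in> D" unfolding D_def by (simp add: nat_abs_dvd_iff)
    show "fst (x, y) \<in> int ` D"
    proof (cases "x \<ge> 0")
      case True
      then have "x = int (nat \<bar>x\<bar>)" by simp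
      then show ?thesis using D by (metis fst_conv image_eqI)
    next
      case False
      then have "x = - int (nat \<bar>x\<bar>)" by simp
      then show ?thesis using D xy(2) by (metis fst_conv image_eqI)
    qed
  qed
  ultimately have "card S \<le> card (int ` D \<union> (\<lambda>d. - int d) ` D)"
    using \<open>finite D\<close> by (intro card_inj_on_le) auto
  also have "\<dots> \<le> card D + card D"
    using \<open>finite D\<close> by (intro order_trans[OF card_Un_le] add_mono card_image_le)
  finally show ?thesis by (simp add: S_def D_def num_divisors_def)
qed

lemma sum_products_le:
  fixes g :: "int \<Rightarrow> real"
  assumes g: "\<And>m. g m \<ge> 0" and d: "\<And>m. m \<in> {1..n^2} \<Longrightarrow> real (num_divisors m) \<le> K"
  shows "(\<Sum>(x, y)\<in>sym_interval n \<times> sym_interval n. g (x * y)) \<le> 2 * K * (\<Sum>m\<in>sym_interval (n^2). g m)"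
proof -
  let ?S = "sym_interval n \<times> sym_interval n"
  let ?f = "\<lambda>(x, y). x * y :: int"
  have sub: "?f ` ?S \<subseteq> sym_interval (n^2)"
  proof clarify
    fix x y assume "x \<in> sym_interval n" "y \<in> sym_interval n"
    then have "\<bar>x\<bar> \<le> int n" "\<bar>y\<bar> \<le> int n" "x * y \<noteq> 0" by (auto simp: sym_interval_def)
    then have "\<bar>x * y\<bar> \<le> int n * int n" unfolding abs_mult by (intro mult_mono) auto
    with \<open>x * y \<noteq> 0\<close> show "x * y \<in> sym_interval (n^2)"
      by (auto simp: sym_interval_def power2_eq_square)
  qed
  have "(\<Sum>(x, y)\<in>?S. g (x * y)) = (\<Sum>z\<in>?S. g (?f z))" by (simp add: case_prod_unfold)
  also have "\<dots> = (\<Sum>m\<in>?f ` ?S. \<Sum>z | z \<in> ?S \<and> ?f z = m. g (?f z))"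
    by (rule sum.image_gen) simp
  also have "\<dots> = (\<Sum>m\<in>?f ` ?S. real (card {z \<in> ?S. ?f z = m}) * g m)"
    by (intro sum.cong) auto
  also have "\<dots> \<le> (\<Sum>m\<in>?f ` ?S. 2 * K * g m)"
  proof (intro sum_mono mult_right_mono g)
    fix m assume "m \<in> ?f ` ?S"
    then have m: "m \<in> sym_interval (n^2)" using sub by blast
    have "{z \<in> ?S. ?f z = m} = {(x, y). x \<in> sym_interval n \<and> y \<in> sym_interval n \<and> x * y = m}" by auto
    then have "card {z \<in> ?S. ?f z = m} \<le> 2 * num_divisors (nat \<bar>m\<bar>)"
      using card_factorizations_le[of m n] m by (simp add: sym_interval_def)
    moreover have "nat \<bar>m\<bar> \<in> {1..n^2}" using m by (rule nat_abs_sym_interval)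
    then have "real (num_divisors (nat \<bar>m\<bar>)) \<le> K" by (rule d)
    ultimately show "real (card {z \<in> ?S. ?f z = m}) \<le> 2 * K" by linarith
  qed
  also have "\<dots> \<le> (\<Sum>m\<in>sym_interval (n^2). 2 * K * g m)"
  proof (rule sum_mono2[OF _ sub])
    fix m assume m: "m \<in> sym_interval (n^2) - ?f ` ?S"
    then have "nat \<bar>m\<bar> \<in> {1..n^2}" using nat_abs_sym_interval by blast
    then have "K \<ge> 0" using d by (meson of_nat_0_le_iff order_trans)
    then show "0 \<le> 2 * K * g m" using g by simp
  qed simp
  finally show ?thesis by (simp add: sum_distrib_left)
qed

definition congruent_products :: "nat \<Rightarrow> ((int \<times> int) \<times> (int \<times> int)) set" where
  "congruent_products q = {((x, y), (z, w)). x \<in> sym_interval q \<and> y \<in> sym_interval q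
     \<and> z \<in> sym_interval q \<and> w \<in> sym_interval q \<and> int q dvd x * y - z * w}"

lemma finite_congruent_products: "finite (congruent_products q)"
  by (rule finite_subset[of _ "(sym_interval q \<times> sym_interval q) \<times> (sym_interval q \<times> sym_interval q)"])
    (auto simp: congruent_products_def)

text \<open>For fixed x y the product z w runs through one class modulo q and takes each value at
  most 2K times. The summand 2A comes from the two blocks next to 0.\<close>

lemma energy_bound:
  assumes q: "q > 0" and A: "A \<ge> 0" and c: "c \<ge> 0" and L: "harmonic (q^2) \<le> L"
    and d: "\<And>m. m \<in> {1..q^2} \<Longrightarrow> real (num_divisors m) \<le> K"
  shows "(\<Sum>((x, y), (z, w))\<in>congruent_products q. trunc_recip A c (x * y) * trunc_recip A c (z * w))
     \<le> (2 * K)^2 * (2 * c * L) * (2 * A + 2 * c * L / real q)"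
proof -
  let ?S = "sym_interval q \<times> sym_interval q"
  let ?\<mu> = "trunc_recip A c"
  define C where "C m = (\<Sum>m' | m' \<in> sym_interval (q^2) \<and> int q dvd m - m'. ?\<mu> m')" for m
  have \<mu>: "?\<mu> m \<ge> 0" for m using A c by (rule trunc_recip_nonneg)
  have "q \<le> q^2" using q by (simp add: power2_eq_square)
  then have Lq: "harmonic q \<le> L" using L harmonic_mono order_trans by blast
  have "1 \<in> {1..q^2}" using q by simp
  then have K: "K \<ge> 0" using d by (meson of_nat_0_le_iff order_trans)
  have L0: "L \<ge> 0" using L harmonic_nonneg order_trans by blast
  have "(\<Sum>((x, y), (z, w))\<in>congruent_products q. ?\<mu> (x * y) * ?\<mu> (z * w))
     = (\<Sum>((x, y), (z, w))\<in>?S \<times> ?S. if int q dvd x * y - z * w then ?\<mu> (x * y) * ?\<mu> (z * w) else 0)"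
    by (rule sum.mono_neutral_cong_left) (auto simp: congruent_products_def split: if_splits)
  also have "\<dots> = (\<Sum>(x, y)\<in>?S. \<Sum>(z, w)\<in>?S. if int q dvd x * y - z * w then ?\<mu> (x * y) * ?\<mu> (z * w) else 0)"
    by (simp add: sum.cartesian_product case_prod_unfold)
  also have "\<dots> \<le> (\<Sum>(x, y)\<in>?S. ?\<mu> (x * y) * (2 * K * C (x * y)))"
  proof (intro sum_mono, clarify)
    fix x y
    have "(\<Sum>(z, w)\<in>?S. if int q dvd x * y - z * w then ?\<mu> (x * y) * ?\<mu> (z * w) else 0)
       = ?\<mu> (x * y) * (\<Sum>(z, w)\<in>?S. if int q dvd x * y - z * w then ?\<mu> (z * w) else 0)"
      unfolding sum_distrib_left by (rule sum.cong) auto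
    also have "\<dots> \<le> ?\<mu> (x * y) * (2 * K * (\<Sum>m'\<in>sym_interval (q^2). if int q dvd x * y - m' then ?\<mu> m' else 0))"
      by (intro mult_left_mono \<mu> sum_products_le d) (auto simp: \<mu>)
    also have "(\<Sum>m'\<in>sym_interval (q^2). if int q dvd x * y - m' then ?\<mu> m' else 0) = C (x * y)"
      unfolding C_def by (rule sum.mono_neutral_cong_right) auto
    finally show "(\<Sum>(z, w)\<in>?S. if int q dvd x * y - z * w then ?\<mu> (x * y) * ?\<mu> (z * w) else 0)
      \<le> ?\<mu> (x * y) * (2 * K * C (x * y))" .
  qed
  also have "\<dots> \<le> (\<Sum>(x, y)\<in>?S. ?\<mu> (x * y) * (2 * K * (2 * A + 2 * c * L / real q)))"
    unfolding C_def using K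
    by (intro sum_mono, clarify) (intro mult_left_mono \<mu> sum_trunc_recip_class q A c Lq; simp)
  also have "\<dots> = (\<Sum>(x, y)\<in>?S. ?\<mu> (x * y)) * (2 * K * (2 * A + 2 * c * L / real q))"
    by (simp add: sum_distrib_right case_prod_unfold)
  also have "\<dots> \<le> (2 * K * (2 * c * L)) * (2 * K * (2 * A + 2 * c * L / real q))"
  proof (rule mult_right_mono)
    have "(\<Sum>(x, y)\<in>?S. ?\<mu> (x * y)) \<le> 2 * K * (\<Sum>m\<in>sym_interval (q^2). ?\<mu> m)"
      by (intro sum_products_le d \<mu>)
    also have "\<dots> \<le> 2 * K * (2 * c * harmonic (q^2))"
      using K by (intro mult_left_mono sum_trunc_recip_le c) auto
    also have "\<dots> \<le> 2 * K * (2 * c * L)"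
      using K c L by (intro mult_left_mono) auto
    finally show "(\<Sum>(x, y)\<in>?S. ?\<mu> (x * y)) \<le> 2 * K * (2 * c * L)" .
    show "0 \<le> 2 * K * (2 * A + 2 * c * L / real q)" using K A c L0 by simp
  qed
  finally show ?thesis by (simp add: power2_eq_square mult_ac)
qed


section \<open>Moments over the units modulo \<open>s\<close>\<close>

definition units_mod :: "nat \<Rightarrow> int set" where
  "units_mod s = {u \<in> {0..<int s}. coprime u (int s)}"

lemma finite_units_mod [simp]: "finite (units_mod s)"
  by (rule finite_subset[of _ "{0..<int s}"]) (auto simp: units_mod_def)

lemma abs_sym_interval: "x \<in> sym_interval n \<Longrightarrow> \<bar>x\<bar> \<le> int n"
  by (auto simp: sym_interval_def)

text \<open>All members of A agree modulo s/g, so each is determined by its quotient by s/g, for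
  which there are g values.\<close>

lemma card_le_of_dvd_mult_diff:
  assumes s: "s > 0" and g: "g dvd s" and A: "A \<subseteq> {0..<int s}"
    and dvd: "\<And>u u'. u \<in> A \<Longrightarrow> u' \<in> A \<Longrightarrow> int s dvd int g * (u - u')"
  shows "card A \<le> g"
proof -
  obtain q where q: "s = g * q" using g by auto
  then have pos: "g > 0" "q > 0" using s by auto
  have "inj_on (\<lambda>u. u div int q) A"
  proof (rule inj_onI)
    fix u u' assume u: "u \<in> A" "u' \<in> A" "u div int q = u' div int q"
    have "int g * int q dvd int g * (u - u')" using dvd[OF u(1,2)] by (simp add: q)
    then have "int q dvd u - u'" using pos by simp
    then have "u mod int q = u' mod int q" by (simp add: mod_eq_dvd_iff)
    then have "u div int q * int q + u mod int q = u' div int q * int q + u' mod int q"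
      using u(3) by (simp only:)
    then show "u = u'" by (simp only: div_mult_mod_eq)
  qed
  moreover have "(\<lambda>u. u div int q) ` A \<subseteq> {0..<int g}"
  proof clarify
    fix u assume "u \<in> A"
    then have "0 \<le> u" "u < int g * int q" using A by (auto simp: q)
    have "int q * (u div int q) \<le> u"
      using pos mult_div_mod_eq[of "int q" u] pos_mod_sign[of "int q" u] by linarith
    then have "u div int q * int q \<le> u" by (simp only: mult.commute)
    then have "u div int q * int q < int g * int q" using \<open>u < int g * int q\<close> by simp
    then have "u div int q < int g" by (rule mult_right_less_imp_less) simp
    then show "u div int q \<in> {0..<int g}"
      using pos \<open>0 \<le> u\<close> by (simp add: pos_imp_zdiv_nonneg_iff)
  qed
  ultimately have "card A \<le> card {0..<int g}" by (intro card_inj_on_le) auto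
  then show ?thesis by simp
qed

lemma dvd_gcd_mult:
  fixes s x z d :: int
  assumes "s dvd d * x" "s dvd d * z"
  shows "s dvd gcd (gcd x z) s * d"
proof -
  obtain k l where g: "k * x + l * z = gcd x z" using bezout_int by blast
  obtain m n where h: "m * gcd x z + n * s = gcd (gcd x z) s" using bezout_int by blast
  have "gcd (gcd x z) s * d = (m * (k * x + l * z) + n * s) * d" by (simp only: g h)
  also have "\<dots> = m * (k * (d * x) + l * (d * z)) + n * d * s" by (simp add: algebra_simps)
  also have "s dvd \<dots>" using assms by simp
  finally show ?thesis .
qed

text \<open>Two solutions differ by some d with s | dx and s | dz, hence with s | gcd(x, z, s)
  d.\<close>

lemma card_simultaneous_le:
  assumes "s > 0"
  shows "card {u \<in> units_mod s. int s dvd u * x - t \<and> int s dvd u * z - y}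
           \<le> nat (gcd (gcd x z) (int s))"
proof (rule card_le_of_dvd_mult_diff[OF assms])
  show "nat (gcd (gcd x z) (int s)) dvd s"
    by (metis gcd_dvd2 gcd_ge_0_int int_dvd_int_iff int_nat_eq)
next
  fix u u' assume u: "u \<in> {u \<in> units_mod s. int s dvd u * x - t \<and> int s dvd u * z - y}"
    "u' \<in> {u \<in> units_mod s. int s dvd u * x - t \<and> int s dvd u * z - y}"
  then have "int s dvd u * x - t" "int s dvd u' * x - t" "int s dvd u * z - y" "int s dvd u' * z - y"
    by auto
  then have "int s dvd (u * x - t) - (u' * x - t)" "int s dvd (u * z - y) - (u' * z - y)"
    by (blast intro: dvd_diff)+
  then have "int s dvd (u - u') * x" "int s dvd (u - u') * z" by (simp_all add: algebra_simps)
  then have "int s dvd gcd (gcd x z) (int s) * (u - u')" by (rule dvd_gcd_mult)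
  then show "int s dvd int (nat (gcd (gcd x z) (int s))) * (u - u')" by simp
qed (auto simp: units_mod_def)

lemma unit_mult_mod_nonzero:
  assumes u: "coprime u (int s)" and h: "h \<in> {1..<int s}"
  shows "u * h mod int s \<in> {1..<int s}"
proof -
  have "\<not> int s dvd u * h"
  proof
    assume "int s dvd u * h"
    then have "int s dvd h" using u by (simp add: coprime_dvd_mult_right_iff coprime_commute)
    then show False using h zdvd_not_zless by auto
  qed
  then have "u * h mod int s \<noteq> 0" by (simp add: dvd_eq_mod_eq_0)
  moreover have "u * h mod int s \<ge> 0" "u * h mod int s < int s" using h by auto
  ultimately show ?thesis by auto
qed

definition recip_weight :: "real \<Rightarrow> int \<Rightarrow> real" where
  "recip_weight \<alpha> x = min \<alpha> (1 / \<bar>real_of_int x\<bar>)"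

definition quad_weight :: "real \<Rightarrow> (int \<times> int) \<times> (int \<times> int) \<Rightarrow> real" where
  "quad_weight \<alpha> = (\<lambda>((x, y), (z, w)). (recip_weight \<alpha> x * recip_weight \<alpha> y) * (recip_weight \<alpha> z * recip_weight \<alpha> w))"

lemma recip_weight_nonneg: "\<alpha> \<ge> 0 \<Longrightarrow> recip_weight \<alpha> x \<ge> 0"
  by (simp add: recip_weight_def)

lemma quad_weight_nonneg: "\<alpha> \<ge> 0 \<Longrightarrow> quad_weight \<alpha> q \<ge> 0"
  by (simp add: quad_weight_def case_prod_unfold recip_weight_nonneg)

lemma recip_weight_mult_le:
  assumes "\<alpha> \<ge> 0" "\<delta> > 0"
  shows "recip_weight \<alpha> (int \<delta> * x) * recip_weight \<alpha> (int \<delta> * y) \<le> trunc_recip (\<alpha>^2) (1 / real \<delta> ^ 2) (x * y)"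
  unfolding trunc_recip_def
proof (rule min.boundedI)
  show "recip_weight \<alpha> (int \<delta> * x) * recip_weight \<alpha> (int \<delta> * y) \<le> \<alpha>^2"
    unfolding power2_eq_square using assms
    by (intro mult_mono recip_weight_nonneg) (auto simp: recip_weight_def)
  have "recip_weight \<alpha> (int \<delta> * x) * recip_weight \<alpha> (int \<delta> * y)
      \<le> (1 / \<bar>real_of_int (int \<delta> * x)\<bar>) * (1 / \<bar>real_of_int (int \<delta> * y)\<bar>)"
    using assms by (intro mult_mono recip_weight_nonneg) (auto simp: recip_weight_def)
  also have "\<dots> = 1 / real \<delta> ^ 2 / \<bar>real_of_int (x * y)\<bar>"
    by (simp add: abs_mult power2_eq_square)
  finally show "recip_weight \<alpha> (int \<delta> * x) * recip_weight \<alpha> (int \<delta> * y) \<le> 1 / real \<delta> ^ 2 / \<bar>real_of_int (x * y)\<bar>" .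
qed

definition scale_quad :: "nat \<Rightarrow> (int \<times> int) \<times> (int \<times> int) \<Rightarrow> (int \<times> int) \<times> (int \<times> int)" where
  "scale_quad \<delta> = (\<lambda>((x, y), (z, w)). ((int \<delta> * x, int \<delta> * y), (int \<delta> * z, int \<delta> * w)))"

definition quads :: "nat \<Rightarrow> ((int \<times> int) \<times> (int \<times> int)) set" where
  "quads s = (sym_interval s \<times> sym_interval s) \<times> (sym_interval s \<times> sym_interval s)"

text \<open>The crosswise pairing makes the two products congruent: modulo s both x y and z w equal
  u x z. The weights can then be bounded through x y and z w alone.\<close>

definition unit_quads :: "nat \<Rightarrow> int \<Rightarrow> ((int \<times> int) \<times> (int \<times> int)) set" where
  "unit_quads s u = {((x, y), (z, w)). ((x, y), (z, w)) \<in> quads s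
     \<and> int s dvd u * x - w \<and> int s dvd u * z - y}"

lemma finite_quads [simp]: "finite (quads s)" by (simp add: quads_def)

lemma unit_quads_subset: "unit_quads s u \<subseteq> quads s" by (auto simp: unit_quads_def)

text \<open>The factor \<delta>, the multiplicity of a quadruple, is outweighed by the decay of the
  weights: scaling by \<delta> divides the bound 1/|xy| by \<delta>^2. The resulting bound is
  uniform in \<delta>.\<close>

lemma sum_scaled_quads_le:
  assumes s: "s = \<delta> * q" "s > 0" and \<alpha>: "\<alpha> \<ge> 0" and L: "harmonic (s^2) \<le> L" "L \<ge> 1"
    and K: "\<And>m. m \<in> {1..s^2} \<Longrightarrow> real (num_divisors m) \<le> K"
  shows "real \<delta> * (\<Sum>p\<in>scale_quad \<delta> ` congruent_products q. quad_weight \<alpha> p) \<le> 16 * K^2 * L^2 * (\<alpha>^2 + 1 / real s)"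
proof -
  have pos: "\<delta> > 0" "q > 0" using s by auto
  have "q^2 \<le> s^2" using s pos by (intro power_mono) auto
  then have Lq: "harmonic (q^2) \<le> L" using harmonic_mono L(1) order_trans by blast
  let ?c = "1 / real \<delta> ^ 2"
  have "(\<Sum>p\<in>scale_quad \<delta> ` congruent_products q. quad_weight \<alpha> p)
     \<le> (\<Sum>p\<in>congruent_products q. quad_weight \<alpha> (scale_quad \<delta> p))"
    using sum_image_le[of "congruent_products q" "quad_weight \<alpha>" "scale_quad \<delta>"]
    by (simp add: o_def finite_congruent_products quad_weight_nonneg[OF \<alpha>])
  also have "\<dots> \<le> (\<Sum>((x, y), (z, w))\<in>congruent_products q. trunc_recip (\<alpha>^2) ?c (x * y) * trunc_recip (\<alpha>^2) ?c (z * w))"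
    by (intro sum_mono) (auto simp: quad_weight_def scale_quad_def
        intro!: mult_mono recip_weight_mult_le \<alpha> pos mult_nonneg_nonneg recip_weight_nonneg trunc_recip_nonneg)
  also have "\<dots> \<le> (2 * K)^2 * (2 * ?c * L) * (2 * \<alpha>^2 + 2 * ?c * L / real q)"
  proof (rule energy_bound[OF pos(2) _ _ Lq])
    fix m assume "m \<in> {1..q^2}"
    then have "m \<in> {1..s^2}" using \<open>q^2 \<le> s^2\<close> unfolding atLeastAtMost_iff by linarith
    then show "real (num_divisors m) \<le> K" by (rule K)
  qed auto
  finally have "real \<delta> * (\<Sum>p\<in>scale_quad \<delta> ` congruent_products q. quad_weight \<alpha> p)
     \<le> real \<delta> * ((2 * K)^2 * (2 * ?c * L) * (2 * \<alpha>^2 + 2 * ?c * L / real q))"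
    by (intro mult_left_mono) auto
  also have "\<dots> = 16 * K^2 * L * ((1 / real \<delta>) * (\<alpha>^2 + L / (real \<delta> * real s)))"
    using pos by (simp add: s(1) power2_eq_square field_simps)
  also have "\<dots> \<le> 16 * K^2 * L * (1 * (\<alpha>^2 + L / real s))"
  proof (intro mult_left_mono mult_mono add_left_mono)
    show "L / (real \<delta> * real s) \<le> L / real s"
    proof (rule divide_left_mono)
      show "real s \<le> real \<delta> * real s" using pos mult_right_mono[of 1 "real \<delta>" "real s"] by simp
    qed (use pos s L in auto)
  qed (use pos L in auto)
  also have "\<dots> \<le> 16 * K^2 * L * (L * (\<alpha>^2 + 1 / real s))"
  proof (rule mult_left_mono)
    have "\<alpha>^2 \<le> L * \<alpha>^2" using mult_right_mono[OF L(2), of "\<alpha>^2"] by simp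
    then show "1 * (\<alpha>^2 + L / real s) \<le> L * (\<alpha>^2 + 1 / real s)" by (simp add: algebra_simps)
  qed (use L in auto)
  finally show ?thesis by (simp add: power2_eq_square mult_ac)
qed

text \<open>By the two congruences, gcd(x, z, s) divides w and y as well; after division the
  products are still congruent modulo the cofactor.\<close>

lemma unit_quads_scaled:
  assumes s: "s > 0" and p: "((x, y), (z, w)) \<in> unit_quads s u"
  defines "\<delta> \<equiv> nat (gcd (gcd x z) (int s))"
  shows "\<delta> dvd s \<and> ((x, y), (z, w)) \<in> scale_quad \<delta> ` congruent_products (s div \<delta>)"
proof -
  have int\<delta>: "int \<delta> = gcd (gcd x z) (int s)" by (simp add: \<delta>_def)
  have dvds: "\<delta> dvd s" by (metis int\<delta> gcd_dvd2 int_dvd_int_iff)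
  then obtain q where q: "s = \<delta> * q" by auto
  then have pos: "\<delta> > 0" "q > 0" using s by auto
  have mem: "x \<in> sym_interval s" "y \<in> sym_interval s" "z \<in> sym_interval s" "w \<in> sym_interval s"
    and dv: "int s dvd u * x - w" "int s dvd u * z - y"
    using p by (auto simp: unit_quads_def quads_def)
  have d\<delta>: "int \<delta> dvd x" "int \<delta> dvd z" "int \<delta> dvd int s" unfolding int\<delta> by (auto intro: dvd_trans)
  have "int \<delta> dvd u * x - w" "int \<delta> dvd u * z - y" using dv d\<delta>(3) dvd_trans by blast+
  then have "int \<delta> dvd w" "int \<delta> dvd y" using d\<delta> by (auto simp: dvd_diff_right_iff)
  with d\<delta> obtain x' y' z' w' where e: "x = int \<delta> * x'" "y = int \<delta> * y'" "z = int \<delta> * z'" "w = int \<delta> * w'"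
    by (auto elim!: dvdE)
  have sym: "v \<in> sym_interval q" if "int \<delta> * v \<in> sym_interval s" for v
  proof -
    have "int s = int \<delta> * int q" by (simp add: q)
    then have "\<bar>int \<delta> * v\<bar> \<le> int \<delta> * int q" using abs_sym_interval[OF that] by (simp only:)
    then have "int \<delta> * \<bar>v\<bar> \<le> int \<delta> * int q" by (simp add: abs_mult)
    then have "\<bar>v\<bar> \<le> int q" using pos by simp
    then show ?thesis using that by (auto simp: sym_interval_def)
  qed
  have "int \<delta> * int q dvd int \<delta> * (u * x' - w')" "int \<delta> * int q dvd int \<delta> * (u * z' - y')"
    using dv by (simp_all add: q e algebra_simps)
  then have "int q dvd u * x' - w'" "int q dvd u * z' - y'" using pos by simp_all
  then have "int q dvd z' * (u * x' - w') - x' * (u * z' - y')" by (blast intro: dvd_diff dvd_mult)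
  moreover have "z' * (u * x' - w') - x' * (u * z' - y') = x' * y' - z' * w'" by (simp add: algebra_simps)
  ultimately have "((x', y'), (z', w')) \<in> congruent_products q"
    using mem sym unfolding e by (simp add: congruent_products_def)
  moreover have "s div \<delta> = q" using pos by (simp add: q)
  ultimately show ?thesis using dvds
    by (auto simp: scale_quad_def e intro!: rev_image_eqI)
qed

text \<open>After expanding the square and interchanging sums, a quadruple occurs for at most gcd(x,
  z, s) units u, by \<open>card_simultaneous_le\<close>, and it belongs to the scaled set of
  \<open>unit_quads_scaled\<close>. Two factors K count representations as products, the third one
  counts the divisors of s.\<close>

lemma moment_bound:
  fixes w :: "int \<Rightarrow> real" and r :: "int \<Rightarrow> int"
  assumes s: "s > 0" and \<alpha>: "\<alpha> \<ge> 0" and L: "harmonic (s^2) \<le> L" "L \<ge> 1"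
    and K: "\<And>m. m \<in> {1..s^2} \<Longrightarrow> real (num_divisors m) \<le> K"
    and w_nonneg: "\<And>h. w h \<ge> 0" and w_mod: "\<And>h. w (h mod int s) = w h"
    and r: "\<And>h. h \<in> {1..<int s} \<Longrightarrow> r h \<in> sym_interval s \<and> int s dvd r h - h \<and> w h \<le> recip_weight \<alpha> (r h)"
  shows "(\<Sum>u\<in>units_mod s. (\<Sum>h\<in>{1..<int s}. w (u * h) * w h)^2) \<le> 16 * K^3 * L^2 * (\<alpha>^2 + 1 / real s)"
proof -
  let ?H = "{1..<int s}"
  let ?V = "quad_weight \<alpha>"
  define D where "D = {d. d dvd s}"
  have finD: "finite D" unfolding D_def using s by (rule finite_divisors_nat)
  define P where "P \<delta> = scale_quad \<delta> ` congruent_products (s div \<delta>)" for \<delta>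
  have finP: "finite (P \<delta>)" for \<delta> by (simp add: P_def finite_congruent_products)
  note V = quad_weight_nonneg[OF \<alpha>]
  have step1: "(\<Sum>h\<in>?H. w (u * h) * w h)^2 \<le> (\<Sum>p\<in>unit_quads s u. ?V p)" if u: "u \<in> units_mod s" for u
  proof -
    have uH: "u * h mod int s \<in> ?H" if "h \<in> ?H" for h
      using u that by (intro unit_mult_mod_nonzero) (simp_all add: units_mod_def)
    have "(\<Sum>h\<in>?H. w (u * h) * w h)^2 = (\<Sum>(h, k)\<in>?H \<times> ?H. (w (u * h) * w h) * (w (u * k) * w k))"
      by (simp add: power2_eq_square sum_product sum.cartesian_product)
    also have "\<dots> \<le> (\<Sum>p\<in>unit_quads s u. ?V p)"
    proof (rule sum_le_included[where i = "\<lambda>q. (fst (fst q) mod int s, fst (snd q) mod int s)"])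
      show "finite (unit_quads s u)" using unit_quads_subset finite_quads by (rule finite_subset)
      show "\<forall>p\<in>?H \<times> ?H. \<exists>q\<in>unit_quads s u. (fst (fst q) mod int s, fst (snd q) mod int s) = p \<and>
          (case p of (h, k) \<Rightarrow> (w (u * h) * w h) * (w (u * k) * w k)) \<le> ?V q"
      proof clarify
        fix h k assume hk: "h \<in> ?H" "k \<in> ?H"
        let ?h = "u * h mod int s" and ?k = "u * k mod int s"
        have R: "int s dvd r h - h" "int s dvd r k - k" "int s dvd r ?h - ?h" "int s dvd r ?k - ?k"
          using r hk uH by blast+
        have M: "int s dvd u * h - ?h" "int s dvd u * k - ?k" by (simp_all add: minus_mod_eq_mult_div)
        have "int s dvd u * (r h - h) - (r ?h - ?h) + (u * h - ?h)"
          by (rule dvd_add[OF dvd_diff[OF dvd_mult[OF R(1)] R(3)] M(1)])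
        then have d1: "int s dvd u * r h - r ?h" by (simp add: algebra_simps)
        have "int s dvd u * (r k - k) - (r ?k - ?k) + (u * k - ?k)"
          by (rule dvd_add[OF dvd_diff[OF dvd_mult[OF R(2)] R(4)] M(2)])
        then have d2: "int s dvd u * r k - r ?k" by (simp add: algebra_simps)
        \<comment> \<open>h is paired with uk and k with uh, as the crosswise order of
          \<open>unit_quads\<close> demands.\<close>
        have "((r h, r ?k), (r k, r ?h)) \<in> unit_quads s u"
          using d1 d2 r hk uH by (auto simp: unit_quads_def quads_def)
        moreover have "r h mod int s = h" "r k mod int s = k"
        proof -
          have "r h mod int s = h mod int s" "r k mod int s = k mod int s"
            using R by (simp_all add: mod_eq_dvd_iff)
          then show "r h mod int s = h" "r k mod int s = k" using hk by auto
        qed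
        moreover have "(w (u * h) * w h) * (w (u * k) * w k) \<le> ?V ((r h, r ?k), (r k, r ?h))"
        proof -
          have "(w (u * h) * w h) * (w (u * k) * w k) = (w h * w ?k) * (w k * w ?h)"
            by (simp add: w_mod mult_ac)
          also have "\<dots> \<le> (recip_weight \<alpha> (r h) * recip_weight \<alpha> (r ?k)) * (recip_weight \<alpha> (r k) * recip_weight \<alpha> (r ?h))"
            using r hk uH by (intro mult_mono mult_nonneg_nonneg w_nonneg recip_weight_nonneg \<alpha>) blast+
          finally show ?thesis by (simp add: quad_weight_def)
        qed
        ultimately show "\<exists>q\<in>unit_quads s u. (fst (fst q) mod int s, fst (snd q) mod int s) = (h, k) \<and>
            (w (u * h) * w h) * (w (u * k) * w k) \<le> ?V q"
          by (intro bexI[of _ "((r h, r ?k), (r k, r ?h))"]) auto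
      qed
    qed (auto simp: V)
    finally show ?thesis .
  qed
  have "(\<Sum>u\<in>units_mod s. (\<Sum>h\<in>?H. w (u * h) * w h)^2) \<le> (\<Sum>u\<in>units_mod s. \<Sum>p\<in>unit_quads s u. ?V p)"
    by (rule sum_mono) (rule step1)
  also have "\<dots> = (\<Sum>u\<in>units_mod s. \<Sum>p\<in>quads s. if p \<in> unit_quads s u then ?V p else 0)"
    by (intro sum.cong sum.mono_neutral_cong_left) (use unit_quads_subset in auto)
  also have "\<dots> = (\<Sum>p\<in>quads s. \<Sum>u\<in>units_mod s. if p \<in> unit_quads s u then ?V p else 0)"
    by (rule sum.swap)
  also have "\<dots> \<le> (\<Sum>p\<in>quads s. \<Sum>\<delta>\<in>D. if p \<in> P \<delta> then real \<delta> * ?V p else 0)"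
  proof (rule sum_mono)
    fix p assume "p \<in> quads s"
    obtain x y z t where p: "p = ((x, y), (z, t))" by (metis surj_pair)
    have nonneg: "(if p \<in> P \<delta> then real \<delta> * ?V p else 0) \<ge> 0" for \<delta> using V by simp
    have "(\<Sum>u\<in>units_mod s. if p \<in> unit_quads s u then ?V p else 0)
        = real (card {u \<in> units_mod s. p \<in> unit_quads s u}) * ?V p"
      by (simp add: sum.If_cases Int_def)
    also have "\<dots> \<le> (\<Sum>\<delta>\<in>D. if p \<in> P \<delta> then real \<delta> * ?V p else 0)"
    proof (cases "\<exists>u\<in>units_mod s. p \<in> unit_quads s u")
      case False
      then have E: "{u \<in> units_mod s. p \<in> unit_quads s u} = {}" by blast
      show ?thesis
        unfolding E using sum_nonneg[of D "\<lambda>\<delta>. if p \<in> P \<delta> then real \<delta> * ?V p else 0", OF nonneg] by simp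
    next
      case True
      define \<delta> where "\<delta> = nat (gcd (gcd x z) (int s))"
      from True have \<delta>: "\<delta> \<in> D" "p \<in> P \<delta>"
        using unit_quads_scaled[OF s] unfolding p D_def P_def \<delta>_def by blast+
      have "card {u \<in> units_mod s. p \<in> unit_quads s u} \<le> \<delta>"
      proof -
        have "card {u \<in> units_mod s. p \<in> unit_quads s u}
            \<le> card {u \<in> units_mod s. int s dvd u * x - t \<and> int s dvd u * z - y}"
          by (intro card_mono) (auto simp: p unit_quads_def)
        also have "\<dots> \<le> \<delta>" unfolding \<delta>_def by (rule card_simultaneous_le[OF s])
        finally show ?thesis .
      qed
      then have "real (card {u \<in> units_mod s. p \<in> unit_quads s u}) * ?V p \<le> real \<delta> * ?V p"
        using V by (intro mult_right_mono) auto
      also have "\<dots> \<le> (\<Sum>\<delta>\<in>D. if p \<in> P \<delta> then real \<delta> * ?V p else 0)"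
        using member_le_sum[of \<delta> D "\<lambda>\<delta>. if p \<in> P \<delta> then real \<delta> * ?V p else 0"] \<delta> finD nonneg by simp
      finally show ?thesis .
    qed
    finally show "(\<Sum>u\<in>units_mod s. if p \<in> unit_quads s u then ?V p else 0)
        \<le> (\<Sum>\<delta>\<in>D. if p \<in> P \<delta> then real \<delta> * ?V p else 0)" .
  qed
  also have "\<dots> = (\<Sum>\<delta>\<in>D. \<Sum>p\<in>quads s. if p \<in> P \<delta> then real \<delta> * ?V p else 0)"
    by (rule sum.swap)
  also have "\<dots> \<le> (\<Sum>\<delta>\<in>D. real \<delta> * (\<Sum>p\<in>P \<delta>. ?V p))"
  proof (rule sum_mono)
    fix \<delta> assume "\<delta> \<in> D"
    have "(\<Sum>p\<in>quads s. if p \<in> P \<delta> then real \<delta> * ?V p else 0) = (\<Sum>p\<in>quads s \<inter> P \<delta>. real \<delta> * ?V p)"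
      by (simp add: sum.inter_restrict)
    also have "\<dots> \<le> (\<Sum>p\<in>P \<delta>. real \<delta> * ?V p)"
      using V by (intro sum_mono2 finP) auto
    finally show "(\<Sum>p\<in>quads s. if p \<in> P \<delta> then real \<delta> * ?V p else 0) \<le> real \<delta> * (\<Sum>p\<in>P \<delta>. ?V p)"
      by (simp add: sum_distrib_left)
  qed
  also have "\<dots> \<le> (\<Sum>\<delta>\<in>D. 16 * K^2 * L^2 * (\<alpha>^2 + 1 / real s))"
  proof (rule sum_mono)
    fix \<delta> assume "\<delta> \<in> D"
    then have "s = \<delta> * (s div \<delta>)" by (simp add: D_def)
    from sum_scaled_quads_le[OF this s \<alpha> L K]
    show "real \<delta> * (\<Sum>p\<in>P \<delta>. ?V p) \<le> 16 * K^2 * L^2 * (\<alpha>^2 + 1 / real s)" by (simp add: P_def)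
  qed
  also have "\<dots> = real (card D) * (16 * K^2 * L^2 * (\<alpha>^2 + 1 / real s))" by simp
  also have "\<dots> \<le> K * (16 * K^2 * L^2 * (\<alpha>^2 + 1 / real s))"
  proof (rule mult_right_mono)
    have "s \<in> {1..s^2}" using s by (simp add: power2_eq_square)
    then show "real (card D) \<le> K" using K[of s] by (simp add: D_def num_divisors_def)
  qed auto
  finally show ?thesis by (simp add: power2_eq_square power3_eq_cube mult_ac)
qed

text \<open>With g = gcd(h, s), the orbit of h consists of multiples g j', each hit by at most g
  units; the factor g cancels against 1/|g j'|.\<close>

lemma unit_orbit_sum_le:
  fixes w :: "int \<Rightarrow> real"
  assumes s: "s > 0" and h: "h \<in> {1..<int s}" and L: "harmonic s \<le> L"
    and w_nonneg: "\<And>h. w h \<ge> 0" and w_mod: "\<And>h. w (h mod int s) = w h"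
    and r: "\<And>h. h \<in> {1..<int s} \<Longrightarrow> r h \<in> sym_interval s \<and> int s dvd r h - h \<and> w h \<le> recip_weight \<alpha> (r h)"
  shows "(\<Sum>u\<in>units_mod s. w (u * h)) \<le> 2 * L"
proof -
  define g where "g = nat (gcd h (int s))"
  have intg: "int g = gcd h (int s)" by (simp add: g_def)
  have dvds: "g dvd s" by (metis intg gcd_dvd2 int_dvd_int_iff)
  then obtain q where q: "s = g * q" by auto
  then have pos: "g > 0" "q > 0" using s by auto
  let ?J = "(\<lambda>j. int g * j) ` sym_interval q"
  have "(\<Sum>u\<in>units_mod s. w (u * h)) \<le> (\<Sum>u\<in>units_mod s. \<Sum>j\<in>?J. if int s dvd u * h - j then 1 / \<bar>real_of_int j\<bar> else 0)"
  proof (rule sum_mono)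
    fix u assume u: "u \<in> units_mod s"
    let ?h = "u * h mod int s"
    have hH: "?h \<in> {1..<int s}"
      using u h by (intro unit_mult_mod_nonzero) (simp_all add: units_mod_def)
    define j where "j = r ?h"
    have j: "j \<in> sym_interval s" "int s dvd j - ?h" "w ?h \<le> recip_weight \<alpha> j" using r[OF hH] by (auto simp: j_def)
    have "int s dvd u * h - ?h" by (simp add: minus_mod_eq_mult_div)
    then have "int s dvd (u * h - ?h) - (j - ?h)" using j(2) by (rule dvd_diff)
    then have dj: "int s dvd u * h - j" by simp
    have "int g dvd int s" "int g dvd h" using intg by simp_all
    then have "int g dvd j" using dj by (metis dvd_diff_right_iff dvd_mult dvd_trans)
    then obtain j' where j': "j = int g * j'" by auto
    have "int s = int g * int q" by (simp add: q)
    then have "\<bar>int g * j'\<bar> \<le> int g * int q" using abs_sym_interval[OF j(1)] unfolding j' by (simp only:)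
    then have "int g * \<bar>j'\<bar> \<le> int g * int q" by (simp add: abs_mult)
    then have "\<bar>j'\<bar> \<le> int q" using pos by simp
    moreover have "j' \<noteq> 0" using j(1) j' by (auto simp: sym_interval_def)
    ultimately have jJ: "j \<in> ?J" unfolding j' by (intro imageI) (auto simp: sym_interval_def)
    have "w (u * h) = w ?h" by (simp add: w_mod)
    also have "\<dots> \<le> 1 / \<bar>real_of_int j\<bar>" using j(3) by (simp add: recip_weight_def)
    also have "\<dots> \<le> (\<Sum>j\<in>?J. if int s dvd u * h - j then 1 / \<bar>real_of_int j\<bar> else 0)"
      using member_le_sum[of j ?J "\<lambda>j. if int s dvd u * h - j then 1 / \<bar>real_of_int j\<bar> else 0"] jJ dj by simp
    finally show "w (u * h) \<le> (\<Sum>j\<in>?J. if int s dvd u * h - j then 1 / \<bar>real_of_int j\<bar> else 0)" .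
  qed
  also have "\<dots> = (\<Sum>j\<in>?J. \<Sum>u\<in>units_mod s. if int s dvd u * h - j then 1 / \<bar>real_of_int j\<bar> else 0)"
    by (rule sum.swap)
  also have "\<dots> \<le> (\<Sum>j\<in>?J. real g * (1 / \<bar>real_of_int j\<bar>))"
  proof (rule sum_mono)
    fix j
    have "card {u \<in> units_mod s. int s dvd u * h - j} \<le> g"
      using card_simultaneous_le[OF s, of h j h j] by (simp add: g_def)
    then have "real (card {u \<in> units_mod s. int s dvd u * h - j}) * (1 / \<bar>real_of_int j\<bar>) \<le> real g * (1 / \<bar>real_of_int j\<bar>)"
      by (intro mult_right_mono) auto
    then show "(\<Sum>u\<in>units_mod s. if int s dvd u * h - j then 1 / \<bar>real_of_int j\<bar> else 0) \<le> real g * (1 / \<bar>real_of_int j\<bar>)"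
      by (simp add: sum.If_cases Int_def)
  qed
  also have "\<dots> = (\<Sum>j\<in>sym_interval q. 1 / \<bar>real_of_int j\<bar>)"
  proof -
    have "inj_on (\<lambda>j. int g * j) (sym_interval q)" using pos by (auto simp: inj_on_def)
    then show ?thesis using pos by (simp add: sum.reindex abs_mult)
  qed
  also have "\<dots> = 2 * harmonic q" by (simp add: sum_sym_interval harmonic_def)
  also have "\<dots> \<le> 2 * harmonic s" using q pos by (simp add: harmonic_mono)
  finally show ?thesis using L by simp
qed

subsection \<open>Incomplete exponential sums\<close>


lemma sum_Cauchy_Schwarz:
  fixes f g :: "'a \<Rightarrow> real"
  shows "(\<Sum>i\<in>A. f i * g i)^2 \<le> (\<Sum>i\<in>A. f i ^ 2) * (\<Sum>i\<in>A. g i ^ 2)"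
proof (cases "finite A")
  case True
  define F G P where "F = (\<Sum>i\<in>A. f i ^ 2)" and "G = (\<Sum>i\<in>A. g i ^ 2)" and "P = (\<Sum>i\<in>A. f i * g i)"
  have "0 \<le> (\<Sum>i\<in>A. (G * f i - P * g i)^2)" by (intro sum_nonneg) simp
  also have "\<dots> = (\<Sum>i\<in>A. G^2 * f i ^ 2 - 2 * G * P * (f i * g i) + P^2 * g i ^ 2)"
    by (intro sum.cong) (simp_all add: power2_eq_square algebra_simps)
  also have "\<dots> = G^2 * F - 2 * G * P * P + P^2 * G"
    unfolding F_def G_def P_def by (simp add: sum.distrib sum_subtractf sum_distrib_left)
  also have "\<dots> = G * (F * G - P^2)" by (simp add: power2_eq_square algebra_simps)
  finally have *: "0 \<le> G * (F * G - P^2)" .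
  have "G \<ge> 0" unfolding G_def by (intro sum_nonneg) simp
  show ?thesis
  proof (cases "G = 0")
    case False
    then have "0 \<le> F * G - P^2" using * \<open>G \<ge> 0\<close> by (simp add: zero_le_mult_iff)
    then show ?thesis by (simp add: F_def G_def P_def)
  next
    case g0: True
    then have "\<forall>i\<in>A. g i ^ 2 = 0" unfolding G_def using True by (subst (asm) sum_nonneg_eq_0_iff) auto
    then show ?thesis by simp
  qed
qed simp

definition ee :: "nat \<Rightarrow> int \<Rightarrow> complex" where
  "ee s x = cis (2 * pi * (real_of_int x / real s))"

lemma ee_0 [simp]: "ee s 0 = 1" by (simp add: ee_def)

lemma norm_ee [simp]: "norm (ee s x) = 1" by (simp add: ee_def)

lemma cnj_ee: "cnj (ee s x) = ee s (- x)" by (simp add: ee_def cis_cnj)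

lemma ee_add: "ee s (x + y) = ee s x * ee s y"
  by (simp add: ee_def cis_mult add_divide_distrib distrib_left)

lemma ee_mult_period: "s > 0 \<Longrightarrow> ee s (int s * k) = 1"
  by (simp add: ee_def)

lemma ee_cong: "s > 0 \<Longrightarrow> int s dvd x - y \<Longrightarrow> ee s x = ee s y"
proof -
  assume s: "s > 0" and "int s dvd x - y"
  then obtain k where "x - y = int s * k" by auto
  then have "x = y + int s * k" by simp
  then show ?thesis using s by (simp add: ee_add ee_mult_period)
qed

lemma norm_one_minus_ee: "norm (1 - ee s x) = 2 * \<bar>sin (pi * real_of_int x / real s)\<bar>"
proof -
  define \<theta> where "\<theta> = pi * real_of_int x / real s"
  have "ee s x = cis (2 * \<theta>)" by (simp add: ee_def \<theta>_def mult.assoc)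
  then have "norm (1 - ee s x) ^ 2 = (1 - cos (2 * \<theta>))^2 + sin (2 * \<theta>)^2"
    by (simp add: cmod_power2)
  also have "\<dots> = 2 - 2 * cos (2 * \<theta>)"
    using sin_cos_squared_add[of "2 * \<theta>"] by (simp add: power2_eq_square algebra_simps)
  also have "\<dots> = (2 * \<bar>sin \<theta>\<bar>)^2" by (simp add: cos_double_sin power_mult_distrib)
  finally show ?thesis unfolding \<theta>_def[symmetric] by (rule power2_eq_imp_eq) auto
qed

text \<open>Doubling the angle in sin y \<ge> y / sqrt 2, valid up to \<pi>/4, gives a constant
  below Jordan's 2/\<pi>. The loss is harmless: in \<open>centered\<close> it is absorbed by \<pi>
  \<ge> 2.\<close>

lemma sin_ge_half:
  assumes "0 \<le> x" "x \<le> pi / 2"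
  shows "sin x \<ge> x / 2"
proof -
  define y where "y = x / 2"
  have y: "0 \<le> y" "y \<le> pi / 4" using assms by (simp_all add: y_def)
  have cos: "cos z \<ge> sqrt 2 / 2" if "0 \<le> z" "z \<le> y" for z
    using cos_monotone_0_pi_le[of z "pi / 4"] that y by (simp add: cos_45)
  have "sin 0 - sqrt 2 / 2 * 0 \<le> sin y - sqrt 2 / 2 * y"
  proof (rule DERIV_nonneg_imp_nondecreasing[OF y(1)])
    fix z assume z: "0 \<le> z" "z \<le> y"
    then show "\<exists>d. ((\<lambda>x. sin x - sqrt 2 / 2 * x) has_real_derivative d) (at z) \<and> 0 \<le> d"
      using cos[of z] by (intro exI[of _ "cos z - sqrt 2 / 2"]) (auto intro!: derivative_eq_intros)
  qed
  moreover have "0 \<le> sin y" using y pi_gt_zero by (intro sin_ge_zero) linarith+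
  ultimately have "(sqrt 2 / 2 * y) * (sqrt 2 / 2) \<le> sin y * cos y"
    using y cos[of y] by (intro mult_mono) auto
  moreover have "(sqrt 2 / 2 * y) * (sqrt 2 / 2) = y / 2" by (simp add: field_simps)
  ultimately have "y / 2 \<le> sin y * cos y" by (simp only:)
  then have "y \<le> 2 * sin y * cos y" by simp
  also have "\<dots> = sin x" using sin_double[of y] by (simp add: y_def)
  finally show ?thesis by (simp add: y_def)
qed

lemma sum_ee:
  assumes s: "s > 0"
  shows "(\<Sum>h\<in>{0..<int s}. ee s (h * x)) = (if int s dvd x then of_nat s else 0)"
proof (cases "int s dvd x")
  case True
  then have "ee s (h * x) = 1" for h
    using ee_cong[OF s, of "h * x" 0] by simp
  then show ?thesis using True by simp
next
  case False
  define z where "z = ee s x"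
  have pow: "ee s (int j * x) = z ^ j" for j
    by (induction j) (simp_all add: z_def distrib_right ee_add)
  have "z \<noteq> 1"
  proof
    assume z1: "z = 1"
    define m where "m = x mod int s"
    have "m \<noteq> 0" "m \<ge> 0" using False s by (auto simp: m_def dvd_eq_mod_eq_0)
    moreover have "m < int s" using s by (simp add: m_def)
    ultimately have m: "0 < m" "m < int s" by auto
    have "ee s m = z" unfolding z_def m_def by (rule ee_cong[OF s]) (simp add: mod_eq_dvd_iff[symmetric])
    then have "norm (1 - ee s m) = 0" using z1 by simp
    then have "sin (pi * real_of_int m / real s) = 0" unfolding norm_one_minus_ee by simp
    moreover have "pi * real_of_int m / real s < pi" using m s by (simp add: divide_less_eq)
    moreover have "0 < pi * real_of_int m / real s" using m s by simp
    ultimately show False using sin_gt_zero by (metis less_irrefl)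
  qed
  have "{0..<int s} = int ` {..<s}" by (metis image_int_atLeastLessThan lessThan_atLeast0 of_nat_0)
  then have "(\<Sum>h\<in>{0..<int s}. ee s (h * x)) = (\<Sum>j<s. z ^ j)"
    by (simp add: sum.reindex pow)
  also have "\<dots> = (z ^ s - 1) / (z - 1)" using \<open>z \<noteq> 1\<close> by (rule geometric_sum)
  also have "z ^ s = 1" using pow[of s] ee_mult_period[OF s, of x] by simp
  finally show ?thesis using False by simp
qed

lemma sum_mult_unit:
  fixes g :: "int \<Rightarrow> 'a::comm_monoid_add"
  assumes s: "s > 0" and u: "coprime u (int s)" and g: "\<And>x. g (x mod int s) = g x"
  shows "(\<Sum>x\<in>{0..<int s}. g (u * x)) = (\<Sum>x\<in>{0..<int s}. g x)"
    and "(\<Sum>x\<in>{1..<int s}. g (u * x)) = (\<Sum>x\<in>{1..<int s}. g x)"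
    and "(\<Sum>x\<in>units_mod s. g (u * x)) = (\<Sum>x\<in>units_mod s. g x)"
proof -
  let ?\<phi> = "\<lambda>x. u * x mod int s"
  have inj: "inj_on ?\<phi> {0..<int s}"
  proof (rule inj_onI)
    fix x y assume xy: "x \<in> {0..<int s}" "y \<in> {0..<int s}" "u * x mod int s = u * y mod int s"
    then have "int s dvd u * (x - y)" by (simp add: mod_eq_dvd_iff algebra_simps)
    then have "int s dvd x - y" using u by (simp add: coprime_dvd_mult_right_iff coprime_commute)
    then have "x mod int s = y mod int s" by (simp add: mod_eq_dvd_iff)
    then show "x = y" using xy by simp
  qed
  have closed: "(\<Sum>x\<in>A. g (u * x)) = (\<Sum>x\<in>A. g x)"
    if "A \<subseteq> {0..<int s}" "?\<phi> ` A \<subseteq> A" for A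
  proof -
    have "finite A" using that(1) finite_subset by blast
    have injA: "inj_on ?\<phi> A" using inj that(1) inj_on_subset by blast
    then have "?\<phi> ` A = A" using endo_inj_surj[OF \<open>finite A\<close> that(2)] by blast
    then have "(\<Sum>x\<in>A. g x) = (\<Sum>x\<in>?\<phi> ` A. g x)" by simp
    also have "\<dots> = (\<Sum>x\<in>A. g (?\<phi> x))" using injA by (simp add: sum.reindex)
    finally show ?thesis by (simp add: g)
  qed
  show "(\<Sum>x\<in>{0..<int s}. g (u * x)) = (\<Sum>x\<in>{0..<int s}. g x)"
    by (rule closed) (use s in auto)
  show "(\<Sum>x\<in>{1..<int s}. g (u * x)) = (\<Sum>x\<in>{1..<int s}. g x)"
  proof (rule closed)
    show "?\<phi> ` {1..<int s} \<subseteq> {1..<int s}"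
      by (rule image_subsetI) (rule unit_mult_mod_nonzero[OF u])
  qed auto
  show "(\<Sum>x\<in>units_mod s. g (u * x)) = (\<Sum>x\<in>units_mod s. g x)"
  proof (rule closed)
    show "?\<phi> ` units_mod s \<subseteq> units_mod s"
      using u s by (auto simp: units_mod_def)
  qed (auto simp: units_mod_def)
qed

definition box_kernel :: "nat \<Rightarrow> nat \<Rightarrow> int \<Rightarrow> complex" where
  "box_kernel s X h = (\<Sum>x\<in>{- int X..int X}. ee s (h * x))"

definition kernel_weight :: "nat \<Rightarrow> nat \<Rightarrow> int \<Rightarrow> real" where
  "kernel_weight s X h = norm (box_kernel s X h) / real s"

lemma kernel_weight_nonneg: "kernel_weight s X h \<ge> 0"
  by (simp add: kernel_weight_def)

lemma box_kernel_mod: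
  assumes "s > 0"
  shows "box_kernel s X (h mod int s) = box_kernel s X h"
  unfolding box_kernel_def
proof (rule sum.cong)
  fix x
  have "int s dvd (h mod int s - h) * x" by (simp add: mod_eq_dvd_iff[symmetric])
  then show "ee s (h mod int s * x) = ee s (h * x)"
    by (intro ee_cong[OF assms]) (simp add: algebra_simps)
qed simp

lemma kernel_weight_mod: "s > 0 \<Longrightarrow> kernel_weight s X (h mod int s) = kernel_weight s X h"
  by (simp add: kernel_weight_def box_kernel_mod)

lemma kernel_weight_0: "kernel_weight s X 0 = real (2 * X + 1) / real s"
proof -
  have "box_kernel s X 0 = of_nat (2 * X + 1)" by (simp add: box_kernel_def nat_add_distrib nat_mult_distrib)
  then show ?thesis by (simp only: kernel_weight_def norm_of_nat)
qed

lemma kernel_weight_le: "kernel_weight s X h \<le> real (2 * X + 1) / real s"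
proof -
  have "norm (box_kernel s X h) \<le> (\<Sum>x\<in>{- int X..int X}. norm (ee s (h * x)))"
    unfolding box_kernel_def by (rule norm_sum)
  also have "\<dots> = real (2 * X + 1)" by simp
  finally show ?thesis by (simp add: kernel_weight_def divide_right_mono)
qed

lemma box_kernel_telescope:
  "box_kernel s X h * (1 - ee s h) = ee s (- (h * int X)) - ee s (h * (int X + 1))"
proof (induction X)
  case 0
  then show ?case by (simp add: box_kernel_def)
next
  case (Suc X)
  have "{- int (Suc X)..int (Suc X)} = insert (- int (Suc X)) (insert (int (Suc X)) {- int X..int X})" by auto
  then have "box_kernel s (Suc X) h = ee s (h * (- int (Suc X))) + (ee s (h * int (Suc X)) + box_kernel s X h)"
    by (simp add: box_kernel_def)
  then have box: "box_kernel s (Suc X) h = ee s (- (h * int (Suc X))) + (ee s (h * int (Suc X)) + box_kernel s X h)"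
    by (simp only: mult_minus_right)
  have shift: "ee s (- (h * int (Suc X))) * ee s h = ee s (- (h * int X))"
    "ee s (h * int (Suc X)) * ee s h = ee s (h * (int (Suc X) + 1))"
    "ee s (h * (int X + 1)) = ee s (h * int (Suc X))"
    by (simp_all add: ee_add[symmetric] algebra_simps)
  have "box_kernel s (Suc X) h * (1 - ee s h)
      = (ee s (- (h * int (Suc X))) - ee s (- (h * int (Suc X))) * ee s h)
       + (ee s (h * int (Suc X)) - ee s (h * int (Suc X)) * ee s h) + box_kernel s X h * (1 - ee s h)"
    unfolding box by (simp add: algebra_simps)
  also have "\<dots> = ee s (- (h * int (Suc X))) - ee s (h * (int (Suc X) + 1))"
    unfolding shift Suc by simp
  finally show ?case .
qed

definition centered :: "nat \<Rightarrow> int \<Rightarrow> int" where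
  "centered s h = (if 2 * h \<le> int s then h else h - int s)"

text \<open>One bound is the number of terms. The other sums a geometric progression by
  \<open>box_kernel_telescope\<close>, with the denominator |1 - e(r/s)| bounded below at the
  representative r of least absolute value.\<close>

lemma centered:
  assumes s: "s > 0" and h: "h \<in> {1..<int s}"
  shows "centered s h \<in> sym_interval s \<and> int s dvd centered s h - h
    \<and> kernel_weight s X h \<le> recip_weight (real (2 * X + 1) / real s) (centered s h)"
proof (intro conjI)
  let ?r = "centered s h"
  show "?r \<in> sym_interval s" "int s dvd ?r - h"
    using h by (auto simp: centered_def sym_interval_def)
  have r: "?r \<noteq> 0" "2 * \<bar>?r\<bar> \<le> int s" using h by (auto simp: centered_def)
  have "box_kernel s X h = box_kernel s X ?r"
    using box_kernel_mod[OF s, of X ?r] box_kernel_mod[OF s, of X h] \<open>int s dvd ?r - h\<close>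
    by (metis mod_eq_dvd_iff)
  then have kw: "kernel_weight s X h = norm (box_kernel s X ?r) / real s" by (simp add: kernel_weight_def)
  have abs_sin: "\<bar>sin (pi * real_of_int ?r / real s)\<bar> = \<bar>sin (pi * \<bar>real_of_int ?r\<bar> / real s)\<bar>"
    by (cases "?r \<ge> 0") auto
  have half_le: "y \<le> 2 * \<bar>z\<bar>" if "y / 2 \<le> z" for y z :: real using that by linarith
  have "2 * \<bar>real_of_int ?r\<bar> \<le> real s" using r(2) by linarith
  then have "pi * \<bar>real_of_int ?r\<bar> / real s \<le> pi / 2" using s by (simp add: field_simps)
  then have "pi * \<bar>real_of_int ?r\<bar> / real s / 2 \<le> sin (pi * \<bar>real_of_int ?r\<bar> / real s)"
    by (intro sin_ge_half) auto
  then have lower: "pi * \<bar>real_of_int ?r\<bar> / real s \<le> norm (1 - ee s ?r)"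
    unfolding norm_one_minus_ee abs_sin by (rule half_le)
  have "norm (box_kernel s X ?r) * norm (1 - ee s ?r) \<le> 2"
    unfolding norm_mult[symmetric] box_kernel_telescope
    by (rule order_trans[OF norm_triangle_ineq4]) simp
  then have "norm (box_kernel s X ?r) * (pi * \<bar>real_of_int ?r\<bar> / real s) \<le> 2"
    using lower by (meson mult_left_mono norm_ge_zero order_trans)
  moreover have "2 * (norm (box_kernel s X ?r) * (\<bar>real_of_int ?r\<bar> / real s))
      \<le> pi * (norm (box_kernel s X ?r) * (\<bar>real_of_int ?r\<bar> / real s))"
    using pi_ge_two by (intro mult_right_mono) auto
  ultimately have "norm (box_kernel s X ?r) * (\<bar>real_of_int ?r\<bar> / real s) \<le> 1" by (simp add: mult_ac)
  then have "kernel_weight s X h \<le> 1 / \<bar>real_of_int ?r\<bar>"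
    unfolding kw using r(1) s by (simp add: field_simps)
  then show "kernel_weight s X h \<le> recip_weight (real (2 * X + 1) / real s) ?r"
    using kernel_weight_le by (simp add: recip_weight_def)
qed

lemma sum_kernel_weight_le:
  assumes s: "s > 0"
  shows "(\<Sum>h\<in>{1..<int s}. kernel_weight s X h) \<le> 2 * harmonic s"
proof -
  have "(\<Sum>h\<in>{1..<int s}. kernel_weight s X h) \<le> (\<Sum>x\<in>sym_interval s. 1 / \<bar>real_of_int x\<bar>)"
  proof (rule sum_le_included[where i = "\<lambda>x. x mod int s"])
    show "\<forall>h\<in>{1..<int s}. \<exists>x\<in>sym_interval s. x mod int s = h \<and> kernel_weight s X h \<le> 1 / \<bar>real_of_int x\<bar>"
    proof
      fix h assume h: "h \<in> {1..<int s}"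
      have "centered s h mod int s = h mod int s" using centered[OF s h, of X] by (simp add: mod_eq_dvd_iff)
      then show "\<exists>x\<in>sym_interval s. x mod int s = h \<and> kernel_weight s X h \<le> 1 / \<bar>real_of_int x\<bar>"
        using centered[OF s h, of X] h by (intro bexI[of _ "centered s h"]) (auto simp: recip_weight_def)
    qed
  qed auto
  also have "\<dots> = 2 * harmonic s" by (simp add: sum_sym_interval harmonic_def)
  finally show ?thesis .
qed

definition fourier :: "nat \<Rightarrow> (int \<Rightarrow> int \<Rightarrow> real) \<Rightarrow> int \<Rightarrow> int \<Rightarrow> complex" where
  "fourier s f h k = (\<Sum>a\<in>{0..<int s}. \<Sum>b\<in>{0..<int s}. of_real (f a b) * (ee s (- (h * a)) * ee s (- (k * b))))"

context
  fixes s :: nat and f :: "int \<Rightarrow> int \<Rightarrow> real"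
  assumes s: "s > 0" and f_mod: "\<And>a b. f (a mod int s) (b mod int s) = f a b"
begin

lemma sum_box_kernel:
  "(\<Sum>h\<in>{0..<int s}. box_kernel s X h * ee s (- (h * a)))
     = of_nat s * (\<Sum>x\<in>{- int X..int X}. if int s dvd x - a then 1 else 0)"
proof -
  have "(\<Sum>h\<in>{0..<int s}. box_kernel s X h * ee s (- (h * a)))
      = (\<Sum>h\<in>{0..<int s}. \<Sum>x\<in>{- int X..int X}. ee s (h * (x - a)))"
    unfolding box_kernel_def sum_distrib_right
    by (intro sum.cong refl) (simp add: ee_add[symmetric] algebra_simps)
  also have "\<dots> = (\<Sum>x\<in>{- int X..int X}. \<Sum>h\<in>{0..<int s}. ee s (h * (x - a)))" by (rule sum.swap)
  finally show ?thesis by (simp add: sum_ee[OF s] sum_distrib_left if_distrib cong: if_cong)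
qed

lemma sum_residue_delta:
  fixes g :: "int \<Rightarrow> complex"
  shows "(\<Sum>a\<in>{0..<int s}. g a * (if int s dvd x - a then 1 else 0)) = g (x mod int s)"
proof -
  have "(\<Sum>a\<in>{0..<int s}. g a * (if int s dvd x - a then 1 else 0))
      = (\<Sum>a\<in>{0..<int s}. if a = x mod int s then g a else 0)"
  proof (rule sum.cong)
    fix a assume "a \<in> {0..<int s}"
    then have "int s dvd x - a \<longleftrightarrow> a = x mod int s" by (auto simp: mod_eq_dvd_iff[symmetric])
    then show "g a * (if int s dvd x - a then 1 else 0) = (if a = x mod int s then g a else 0)" by simp
  qed simp
  then show ?thesis using s by simp
qed

text \<open>Orthogonality counts the elements of an interval in a residue class with multiplicity,
  so the box may be longer than s.\<close>

lemma completion: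
  "(\<Sum>h\<in>{0..<int s}. \<Sum>k\<in>{0..<int s}. box_kernel s X h * box_kernel s Y k * fourier s f h k)
     = of_nat s ^ 2 * of_real (\<Sum>x\<in>{- int X..int X}. \<Sum>y\<in>{- int Y..int Y}. f x y)"
proof -
  let ?Z = "{0..<int s}"
  let ?I = "\<lambda>X a. (\<Sum>x\<in>{- int X..int X}. if int s dvd x - a then 1 else 0 :: complex)"
  have "(\<Sum>h\<in>?Z. \<Sum>k\<in>?Z. box_kernel s X h * box_kernel s Y k * fourier s f h k)
     = (\<Sum>h\<in>?Z. \<Sum>k\<in>?Z. \<Sum>a\<in>?Z. \<Sum>b\<in>?Z. of_real (f a b) * ((box_kernel s X h * ee s (- (h * a))) * (box_kernel s Y k * ee s (- (k * b)))))"
    unfolding fourier_def sum_distrib_left by (intro sum.cong refl) (simp add: mult_ac)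
  also have "\<dots> = (\<Sum>h\<in>?Z. \<Sum>a\<in>?Z. \<Sum>k\<in>?Z. \<Sum>b\<in>?Z. of_real (f a b) * ((box_kernel s X h * ee s (- (h * a))) * (box_kernel s Y k * ee s (- (k * b)))))"
    by (rule sum.cong[OF refl], rule sum.swap)
  also have "\<dots> = (\<Sum>a\<in>?Z. \<Sum>h\<in>?Z. \<Sum>b\<in>?Z. \<Sum>k\<in>?Z. of_real (f a b) * ((box_kernel s X h * ee s (- (h * a))) * (box_kernel s Y k * ee s (- (k * b)))))"
    by (subst sum.swap, rule sum.cong[OF refl], rule sum.cong[OF refl], rule sum.swap)
  also have "\<dots> = (\<Sum>a\<in>?Z. \<Sum>b\<in>?Z. of_real (f a b) * ((\<Sum>h\<in>?Z. box_kernel s X h * ee s (- (h * a))) * (\<Sum>k\<in>?Z. box_kernel s Y k * ee s (- (k * b)))))"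
    by (rule sum.cong[OF refl], rule trans[OF sum.swap]) (simp only: sum_product, simp only: sum_distrib_left)
  also have "\<dots> = of_nat s ^ 2 * (\<Sum>a\<in>?Z. \<Sum>b\<in>?Z. of_real (f a b) * (?I X a * ?I Y b))"
    unfolding sum_box_kernel by (simp add: sum_distrib_left power2_eq_square mult_ac)
  also have "(\<Sum>a\<in>?Z. \<Sum>b\<in>?Z. of_real (f a b) * (?I X a * ?I Y b))
      = (\<Sum>a\<in>?Z. \<Sum>b\<in>?Z. \<Sum>x\<in>{- int X..int X}. \<Sum>y\<in>{- int Y..int Y}.
          of_real (f a b) * ((if int s dvd x - a then 1 else 0) * (if int s dvd y - b then 1 else 0)))"
    by (simp only: sum_product, simp only: sum_distrib_left)
  also have "\<dots> = (\<Sum>x\<in>{- int X..int X}. \<Sum>y\<in>{- int Y..int Y}. \<Sum>a\<in>?Z. \<Sum>b\<in>?Z.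
          of_real (f a b) * ((if int s dvd x - a then 1 else 0) * (if int s dvd y - b then 1 else 0)))"
    (is "?lhs = ?rhs")
  proof -
    have "?lhs = (\<Sum>a\<in>?Z. \<Sum>x\<in>{- int X..int X}. \<Sum>b\<in>?Z. \<Sum>y\<in>{- int Y..int Y}.
          of_real (f a b) * ((if int s dvd x - a then 1 else 0) * (if int s dvd y - b then 1 else 0)))"
      by (rule sum.cong[OF refl], rule sum.swap)
    also have "\<dots> = (\<Sum>x\<in>{- int X..int X}. \<Sum>a\<in>?Z. \<Sum>y\<in>{- int Y..int Y}. \<Sum>b\<in>?Z.
          of_real (f a b) * ((if int s dvd x - a then 1 else 0) * (if int s dvd y - b then 1 else 0)))"
      by (subst sum.swap, rule sum.cong[OF refl], rule sum.cong[OF refl], rule sum.swap)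
    also have "\<dots> = ?rhs" by (rule sum.cong[OF refl], rule sum.swap)
    finally show ?thesis .
  qed
  also have "\<dots> = (\<Sum>x\<in>{- int X..int X}. \<Sum>y\<in>{- int Y..int Y}. of_real (f x y))"
  proof (intro sum.cong refl)
    fix x y
    have "(\<Sum>a\<in>?Z. \<Sum>b\<in>?Z. of_real (f a b) * ((if int s dvd x - a then 1 else 0) * (if int s dvd y - b then 1 else 0)))
      = (\<Sum>a\<in>?Z. (\<Sum>b\<in>?Z. complex_of_real (f a b) * (if int s dvd y - b then 1 else 0)) * (if int s dvd x - a then 1 else 0))"
      unfolding sum_distrib_right by (intro sum.cong refl) (simp add: mult_ac)
    also have "\<dots> = of_real (f x y)"
      unfolding sum_residue_delta by (simp add: f_mod)
    finally show "(\<Sum>a\<in>?Z. \<Sum>b\<in>?Z. of_real (f a b) * ((if int s dvd x - a then 1 else 0) * (if int s dvd y - b then 1 else 0)))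
      = complex_of_real (f x y)" .
  qed
  finally show ?thesis by simp
qed

end

lemma parseval:
  assumes s: "s > 0"
  shows "(\<Sum>h\<in>{0..<int s}. norm (\<Sum>a\<in>{0..<int s}. g a * ee s (- (h * a)))^2) = real s * (\<Sum>a\<in>{0..<int s}. norm (g a)^2)"
proof -
  let ?Z = "{0..<int s}"
  have "complex_of_real (\<Sum>h\<in>?Z. norm (\<Sum>a\<in>?Z. g a * ee s (- (h * a)))^2)
     = (\<Sum>h\<in>?Z. (\<Sum>a\<in>?Z. g a * ee s (- (h * a))) * cnj (\<Sum>a\<in>?Z. g a * ee s (- (h * a))))"
    by (simp only: of_real_sum complex_norm_square)
  also have "\<dots> = (\<Sum>h\<in>?Z. \<Sum>a\<in>?Z. \<Sum>b\<in>?Z. g a * cnj (g b) * ee s (h * (b - a)))"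
    by (simp add: sum_product cnj_ee) (intro sum.cong refl, simp add: mult_ac ee_add[symmetric] algebra_simps)
  also have "\<dots> = (\<Sum>a\<in>?Z. \<Sum>h\<in>?Z. \<Sum>b\<in>?Z. g a * cnj (g b) * ee s (h * (b - a)))" by (rule sum.swap)
  also have "\<dots> = (\<Sum>a\<in>?Z. \<Sum>b\<in>?Z. \<Sum>h\<in>?Z. g a * cnj (g b) * ee s (h * (b - a)))"
    by (rule sum.cong[OF refl], rule sum.swap)
  also have "\<dots> = (\<Sum>a\<in>?Z. \<Sum>b\<in>?Z. if a = b then g a * cnj (g a) * of_nat s else 0)"
  proof (intro sum.cong refl)
    fix a b assume ab: "a \<in> ?Z" "b \<in> ?Z"
    have "int s dvd b - a \<longleftrightarrow> a = b" using ab by (auto simp: mod_eq_dvd_iff[symmetric])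
    then show "(\<Sum>h\<in>?Z. g a * cnj (g b) * ee s (h * (b - a))) = (if a = b then g a * cnj (g a) * of_nat s else 0)"
      by (simp add: sum_distrib_left[symmetric] sum_ee[OF s])
  qed
  also have "\<dots> = of_real (real s * (\<Sum>a\<in>?Z. norm (g a)^2))"
    by (simp add: sum_distrib_left complex_norm_square[symmetric] mult.commute del: of_real_power)
  finally show ?thesis by (simp only: of_real_eq_iff)
qed

subsection \<open>Box sums of functions invariant under units\<close>


lemma fourier_parseval:
  assumes s: "s > 0" and D: "\<And>a b. \<bar>f a b\<bar> \<le> D"
  shows "(\<Sum>h\<in>{0..<int s}. \<Sum>k\<in>{0..<int s}. norm (fourier s f h k)^2) \<le> real s ^ 4 * D^2"
proof -
  let ?Z = "{0..<int s}"
  have F: "fourier s f h k = (\<Sum>a\<in>?Z. (\<Sum>b\<in>?Z. of_real (f a b) * ee s (- (k * b))) * ee s (- (h * a)))" for h k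
    unfolding fourier_def sum_distrib_right by (intro sum.cong refl) (simp add: mult_ac)
  have "(\<Sum>h\<in>?Z. \<Sum>k\<in>?Z. norm (fourier s f h k)^2) = (\<Sum>k\<in>?Z. \<Sum>h\<in>?Z. norm (fourier s f h k)^2)"
    by (rule sum.swap)
  also have "\<dots> = (\<Sum>k\<in>?Z. real s * (\<Sum>a\<in>?Z. norm (\<Sum>b\<in>?Z. of_real (f a b) * ee s (- (k * b)))^2))"
    unfolding F parseval[OF s] ..
  also have "\<dots> = real s * (\<Sum>a\<in>?Z. \<Sum>k\<in>?Z. norm (\<Sum>b\<in>?Z. of_real (f a b) * ee s (- (k * b)))^2)"
    unfolding sum_distrib_left[symmetric] by (subst sum.swap) simp
  also have "\<dots> = real s * (\<Sum>a\<in>?Z. real s * (\<Sum>b\<in>?Z. norm (complex_of_real (f a b))^2))"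
    unfolding parseval[OF s] ..
  also have "\<dots> \<le> real s * (\<Sum>a\<in>?Z. real s * (\<Sum>b\<in>?Z. D^2))"
  proof (intro mult_left_mono sum_mono)
    fix a b
    show "norm (complex_of_real (f a b))^2 \<le> D^2"
      using D[of a b] by (simp add: abs_le_square_iff[symmetric])
  qed auto
  also have "\<dots> = real s ^ 4 * D^2" by (simp add: eval_nat_numeral)
  finally show ?thesis .
qed

lemma fourier_mod:
  assumes s: "s > 0"
  shows "fourier s f (h mod int s) k = fourier s f h k" "fourier s f h (k mod int s) = fourier s f h k"
proof -
  have "ee s (- (x mod int s * a)) = ee s (- (x * a))" for x a
  proof (rule ee_cong[OF s])
    have "- (x mod int s * a) - - (x * a) = (x - x mod int s) * a" by (simp add: algebra_simps)
    then show "int s dvd - (x mod int s * a) - - (x * a)" by (simp only: minus_mod_eq_mult_div) simp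
  qed
  then show "fourier s f (h mod int s) k = fourier s f h k" "fourier s f h (k mod int s) = fourier s f h k"
    unfolding fourier_def by simp_all
qed

text \<open>Substituting (ua, vb) for (a, b) moves the units to the frequencies, so the coefficients
  inherit the invariance with the same u and v.\<close>

lemma fourier_invariant:
  assumes s: "s > 0" and f_mod: "\<And>a b. f (a mod int s) (b mod int s) = f a b"
    and inv: "\<And>a b. f (u * a) (v * b) = f a b"
    and u: "coprime u (int s)" and v: "coprime v (int s)"
  shows "fourier s f (u * h) (v * k) = fourier s f h k"
proof -
  let ?Z = "{0..<int s}"
  define g where "g a b = complex_of_real (f a b) * (ee s (- (h * a)) * ee s (- (k * b)))" for a b
  have ee: "ee s (- (x * (a mod int s))) = ee s (- (x * a))" for x a
  proof (rule ee_cong[OF s])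
    have "- (x * (a mod int s)) - - (x * a) = (a - a mod int s) * x" by (simp add: algebra_simps)
    then show "int s dvd - (x * (a mod int s)) - - (x * a)" by (simp only: minus_mod_eq_mult_div) simp
  qed
  have "f (a mod int s) b = f a b" "f a (b mod int s) = f a b" for a b
    using f_mod[of a b] f_mod[of a "b mod int s"] f_mod[of "a mod int s" b] by simp_all
  then have g: "g (a mod int s) b = g a b" "g a (b mod int s) = g a b" for a b
    by (simp_all add: g_def ee)
  have "fourier s f (u * h) (v * k) = (\<Sum>a\<in>?Z. \<Sum>b\<in>?Z. g (u * a) (v * b))"
    unfolding fourier_def g_def inv by (intro sum.cong refl) (simp add: mult_ac)
  also have "\<dots> = (\<Sum>a\<in>?Z. \<Sum>b\<in>?Z. g (u * a) b)"
    using sum_mult_unit(1)[OF s v, of "g (u * a)" for a] g by simp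
  also have "\<dots> = (\<Sum>a\<in>?Z. \<Sum>b\<in>?Z. g a b)"
    using sum_mult_unit(1)[OF s u, of "\<lambda>a. \<Sum>b\<in>?Z. g a b"] g by simp
  finally show ?thesis by (simp add: fourier_def g_def)
qed

text \<open>Frequencies split into 0 and the nonzero residues, both stable under units. This common
  property lets one averaging argument serve all three parts of the square of frequencies other than
  (0, 0).\<close>

definition unit_invariant :: "nat \<Rightarrow> int set \<Rightarrow> bool" where
  "unit_invariant s H \<longleftrightarrow> H \<subseteq> {0..<int s} \<and> (\<forall>u (g :: int \<Rightarrow> real). coprime u (int s) \<longrightarrow>
     (\<forall>x. g (x mod int s) = g x) \<longrightarrow> (\<Sum>h\<in>H. g (u * h)) = (\<Sum>h\<in>H. g h))"

lemma unit_invariantD: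
  fixes g :: "int \<Rightarrow> real"
  assumes "unit_invariant s H" "coprime u (int s)" "\<And>x. g (x mod int s) = g x"
  shows "(\<Sum>h\<in>H. g (u * h)) = (\<Sum>h\<in>H. g h)"
  using assms unfolding unit_invariant_def by blast

lemma unit_invariant_zero: "s > 0 \<Longrightarrow> unit_invariant s {0}"
  by (simp add: unit_invariant_def)

lemma unit_invariant_nonzero: "s > 0 \<Longrightarrow> unit_invariant s {1..<int s}"
  using sum_mult_unit(2) by (auto simp: unit_invariant_def)

text \<open>The i-th power map on the units has fibres of size at most m.\<close>

lemma sum_powers_le:
  fixes g :: "int \<Rightarrow> real"
  assumes s: "s > 0" and g: "\<And>x. g x \<ge> 0" "\<And>x. g (x mod int s) = g x"
    and m: "\<And>v. real (card {l \<in> units_mod s. int s dvd l ^ i - v}) \<le> m"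
  shows "(\<Sum>l\<in>units_mod s. g (l ^ i)) \<le> m * (\<Sum>u\<in>units_mod s. g u)"
proof -
  let ?U = "units_mod s" and ?\<phi> = "\<lambda>l. l ^ i mod int s"
  have m0: "m \<ge> 0" using m[of 0] by linarith
  have sub: "?\<phi> ` ?U \<subseteq> ?U" using s by (auto simp: units_mod_def)
  have "(\<Sum>l\<in>?U. g (l ^ i)) = (\<Sum>l\<in>?U. g (?\<phi> l))" by (simp add: g)
  also have "\<dots> = (\<Sum>u\<in>?\<phi> ` ?U. \<Sum>l | l \<in> ?U \<and> ?\<phi> l = u. g (?\<phi> l))"
    by (rule sum.image_gen) simp
  also have "\<dots> = (\<Sum>u\<in>?\<phi> ` ?U. real (card {l \<in> ?U. ?\<phi> l = u}) * g u)"
    by (intro sum.cong) auto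
  also have "\<dots> \<le> (\<Sum>u\<in>?\<phi> ` ?U. m * g u)"
  proof (intro sum_mono mult_right_mono g)
    fix u
    have "card {l \<in> ?U. ?\<phi> l = u} \<le> card {l \<in> ?U. int s dvd l ^ i - u}"
      by (intro card_mono) (auto simp: minus_mod_eq_mult_div)
    then show "real (card {l \<in> ?U. ?\<phi> l = u}) \<le> m" using m[of u] by linarith
  qed
  also have "\<dots> \<le> (\<Sum>u\<in>?U. m * g u)"
    using sub m0 g by (intro sum_mono2) auto
  finally show ?thesis by (simp add: sum_distrib_left)
qed

text \<open>Replacing v by uv and then uh by h removes u, so the double sum over units is phi(s)
  times a single one.\<close>

lemma sum_unit_pairs:
  fixes w :: "int \<Rightarrow> real"
  assumes s: "s > 0" and w: "\<And>h. w (h mod int s) = w h"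
  shows "(\<Sum>u\<in>units_mod s. \<Sum>v\<in>units_mod s. (\<Sum>h\<in>{1..<int s}. w (u * h) * w (v * h))^2)
     = real (card (units_mod s)) * (\<Sum>u\<in>units_mod s. (\<Sum>h\<in>{1..<int s}. w (u * h) * w h)^2)"
proof -
  have wm: "w (x mod int s * y) = w (x * y)" "w (y * (x mod int s)) = w (y * x)" for x y
    using w[of "x mod int s * y"] w[of "y * (x mod int s)"] w[of "x * y"] w[of "y * x"]
    by (simp_all add: mod_mult_left_eq mod_mult_right_eq)
  have "(\<Sum>v\<in>units_mod s. (\<Sum>h\<in>{1..<int s}. w (u * h) * w (v * h))^2)
     = (\<Sum>v\<in>units_mod s. (\<Sum>h\<in>{1..<int s}. w (v * h) * w h)^2)" if "u \<in> units_mod s" for u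
  proof -
    have u: "coprime u (int s)" using that by (simp add: units_mod_def)
    have "(\<Sum>v\<in>units_mod s. (\<Sum>h\<in>{1..<int s}. w (u * h) * w (v * h))^2)
        = (\<Sum>v\<in>units_mod s. (\<Sum>h\<in>{1..<int s}. w (u * h) * w (u * v * h))^2)"
      using sum_mult_unit(3)[OF s u, of "\<lambda>v. (\<Sum>h\<in>{1..<int s}. w (u * h) * w (v * h))^2"] by (simp add: wm)
    also have "\<dots> = (\<Sum>v\<in>units_mod s. (\<Sum>h\<in>{1..<int s}. w (v * h) * w h)^2)"
    proof (intro sum.cong refl)
      fix v
      show "(\<Sum>h\<in>{1..<int s}. w (u * h) * w (u * v * h))^2 = (\<Sum>h\<in>{1..<int s}. w (v * h) * w h)^2"
        using sum_mult_unit(2)[OF s u, of "\<lambda>h. w (v * h) * w h"] by (simp add: wm w mult_ac)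
    qed
    finally show ?thesis .
  qed
  then show ?thesis by simp
qed

definition orbit_weight :: "nat \<Rightarrow> nat \<Rightarrow> nat \<Rightarrow> nat \<Rightarrow> nat \<Rightarrow> int \<Rightarrow> int \<Rightarrow> real" where
  "orbit_weight s i j X Y h k = (\<Sum>l\<in>units_mod s. kernel_weight s X (l ^ i * h) * kernel_weight s Y (l ^ j * k))"

lemma kernel_weight_mult_mod:
  assumes "s > 0"
  shows "kernel_weight s X (x * (h mod int s)) = kernel_weight s X (x * h)"
    "kernel_weight s X (h mod int s * x) = kernel_weight s X (h * x)"
  using kernel_weight_mod[OF assms, of X "x * (h mod int s)"] kernel_weight_mod[OF assms, of X "x * h"]
    kernel_weight_mod[OF assms, of X "h mod int s * x"] kernel_weight_mod[OF assms, of X "h * x"]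
  by (simp_all add: mod_mult_left_eq mod_mult_right_eq)

text \<open>The invariance allows averaging over l before Cauchy--Schwarz is applied. The Fourier
  coefficients are then disposed of by Parseval, and what remains is a mean square in which the
  kernels at different l interact.\<close>

lemma averaged_error:
  assumes s: "s > 0" and f_mod: "\<And>a b. f (a mod int s) (b mod int s) = f a b"
    and inv: "\<And>l a b. coprime l (int s) \<Longrightarrow> f (l ^ i * a) (l ^ j * b) = f a b"
    and D: "\<And>a b. \<bar>f a b\<bar> \<le> D"
    and H: "unit_invariant s H" and K: "unit_invariant s K"
  shows "(real (card (units_mod s)) * (\<Sum>h\<in>H. \<Sum>k\<in>K. kernel_weight s X h * kernel_weight s Y k * norm (fourier s f h k)))^2
     \<le> real s ^ 4 * D^2 * (\<Sum>h\<in>H. \<Sum>k\<in>K. orbit_weight s i j X Y h k ^ 2)"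
proof -
  let ?F = "\<lambda>h k. norm (fourier s f h k)"
  let ?wX = "kernel_weight s X" and ?wY = "kernel_weight s Y"
  define E where "E = (\<Sum>h\<in>H. \<Sum>k\<in>K. ?wX h * ?wY k * ?F h k)"
  have E_eq: "E = (\<Sum>h\<in>H. \<Sum>k\<in>K. ?wX (l ^ i * h) * ?wY (l ^ j * k) * ?F h k)" if "l \<in> units_mod s" for l
  proof -
    have l: "coprime l (int s)" "coprime (l ^ i) (int s)" "coprime (l ^ j) (int s)"
      using that by (simp_all add: units_mod_def)
    have Finv: "?F (l ^ i * h) (l ^ j * k) = ?F h k" for h k
      using fourier_invariant[OF s f_mod inv[OF l(1)] l(2,3)] by simp
    have "E = (\<Sum>h\<in>H. \<Sum>k\<in>K. ?wX (l ^ i * h) * ?wY k * ?F (l ^ i * h) k)"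
      unfolding E_def
      by (rule unit_invariantD[OF H l(2), of "\<lambda>h. \<Sum>k\<in>K. ?wX h * ?wY k * ?F h k", symmetric])
        (simp add: kernel_weight_mod[OF s] fourier_mod[OF s])
    also have "\<dots> = (\<Sum>h\<in>H. \<Sum>k\<in>K. ?wX (l ^ i * h) * ?wY (l ^ j * k) * ?F (l ^ i * h) (l ^ j * k))"
    proof (rule sum.cong[OF refl])
      fix h
      show "(\<Sum>k\<in>K. ?wX (l ^ i * h) * ?wY k * ?F (l ^ i * h) k)
         = (\<Sum>k\<in>K. ?wX (l ^ i * h) * ?wY (l ^ j * k) * ?F (l ^ i * h) (l ^ j * k))"
        by (rule unit_invariantD[OF K l(3), of "\<lambda>k. ?wX (l ^ i * h) * ?wY k * ?F (l ^ i * h) k", symmetric])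
          (simp add: kernel_weight_mod[OF s] fourier_mod[OF s])
    qed
    finally show ?thesis by (simp only: Finv)
  qed
  have finHK: "finite H" "finite K" using H K finite_subset unfolding unit_invariant_def by blast+
  have "real (card (units_mod s)) * E = (\<Sum>l\<in>units_mod s. E)" by simp
  also have "\<dots> = (\<Sum>l\<in>units_mod s. \<Sum>h\<in>H. \<Sum>k\<in>K. ?wX (l ^ i * h) * ?wY (l ^ j * k) * ?F h k)"
    by (intro sum.cong refl E_eq)
  also have "\<dots> = (\<Sum>h\<in>H. \<Sum>k\<in>K. \<Sum>l\<in>units_mod s. ?wX (l ^ i * h) * ?wY (l ^ j * k) * ?F h k)"
    by (subst sum.swap, rule sum.cong[OF refl], rule sum.swap)
  also have "\<dots> = (\<Sum>h\<in>H. \<Sum>k\<in>K. orbit_weight s i j X Y h k * ?F h k)"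
    by (simp add: orbit_weight_def sum_distrib_right)
  also have "\<dots> = (\<Sum>z\<in>H \<times> K. orbit_weight s i j X Y (fst z) (snd z) * ?F (fst z) (snd z))"
    by (simp add: sum.cartesian_product case_prod_unfold)
  finally have "(real (card (units_mod s)) * E)^2
     \<le> (\<Sum>z\<in>H \<times> K. orbit_weight s i j X Y (fst z) (snd z) ^ 2) * (\<Sum>z\<in>H \<times> K. ?F (fst z) (snd z) ^ 2)"
    by (simp only: sum_Cauchy_Schwarz)
  also have "\<dots> \<le> (\<Sum>z\<in>H \<times> K. orbit_weight s i j X Y (fst z) (snd z) ^ 2) * (real s ^ 4 * D^2)"
  proof (rule mult_left_mono)
    have "(\<Sum>z\<in>H \<times> K. ?F (fst z) (snd z) ^ 2) \<le> (\<Sum>z\<in>{0..<int s} \<times> {0..<int s}. ?F (fst z) (snd z) ^ 2)"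
      using H K by (intro sum_mono2) (auto simp: unit_invariant_def)
    also have "\<dots> \<le> real s ^ 4 * D^2"
      using fourier_parseval[OF s D] by (simp add: sum.cartesian_product case_prod_unfold)
    finally show "(\<Sum>z\<in>H \<times> K. ?F (fst z) (snd z) ^ 2) \<le> real s ^ 4 * D^2" .
  qed (auto intro: sum_nonneg)
  also have "\<dots> = real s ^ 4 * D^2 * (\<Sum>h\<in>H. \<Sum>k\<in>K. orbit_weight s i j X Y h k ^ 2)"
    by (simp add: sum.cartesian_product case_prod_unfold)
  finally show ?thesis unfolding E_def .
qed

context
  fixes s :: nat and L K :: real
  assumes s: "s > 0" and L: "harmonic (s^2) \<le> L" "L \<ge> 1"
    and K: "\<And>m. m \<in> {1..s^2} \<Longrightarrow> real (num_divisors m) \<le> K"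
begin

lemma harmonic_s_le: "harmonic s \<le> L"
proof -
  have "s \<le> s^2" using s by (simp add: power2_eq_square)
  then show ?thesis using L(1) harmonic_mono order_trans by blast
qed

lemma one_le_K: "K \<ge> 1"
proof -
  have "1 \<in> {1..s^2}" using s by simp
  then show ?thesis using K[of 1] by (simp add: num_divisors_def)
qed

text \<open>The lower bound on the length gives 1/s \<le> \<alpha>^2 for \<alpha> = (2X + 1)/s, so
  the second term of \<open>moment_bound\<close> is absorbed in the first and the constant 16
  doubles.\<close>

lemma kernel_moment:
  assumes "real (2 * X + 1) ^ 2 \<ge> real s"
  shows "(\<Sum>u\<in>units_mod s. (\<Sum>h\<in>{1..<int s}. kernel_weight s X (u * h) * kernel_weight s X h)^2)
     \<le> 32 * K^3 * L^2 * (real (2 * X + 1) / real s)^2"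
proof -
  let ?\<alpha> = "real (2 * X + 1) / real s"
  have "(\<Sum>u\<in>units_mod s. (\<Sum>h\<in>{1..<int s}. kernel_weight s X (u * h) * kernel_weight s X h)^2)
     \<le> 16 * K^3 * L^2 * (?\<alpha>^2 + 1 / real s)"
    by (rule moment_bound[OF s _ L K kernel_weight_nonneg kernel_weight_mod[OF s] centered[OF s]]) simp_all
  also have "\<dots> \<le> 16 * K^3 * L^2 * (?\<alpha>^2 + ?\<alpha>^2)"
  proof (intro mult_left_mono add_left_mono)
    have "1 / real s = real s / real s ^ 2" using s by (simp add: power2_eq_square)
    also have "\<dots> \<le> real (2 * X + 1) ^ 2 / real s ^ 2" using assms by (rule divide_right_mono) simp
    finally show "1 / real s \<le> ?\<alpha>^2" by (simp only: power_divide)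
  qed (use one_le_K in auto)
  finally show ?thesis by simp
qed

lemma power_kernel_moment:
  assumes m: "\<And>v. real (card {l \<in> units_mod s. int s dvd l ^ i - v}) \<le> m" and X: "real (2 * X + 1) ^ 2 \<ge> real s"
  shows "(\<Sum>l\<in>units_mod s. \<Sum>l'\<in>units_mod s.
       (\<Sum>h\<in>{1..<int s}. kernel_weight s X (l ^ i * h) * kernel_weight s X (l' ^ i * h))^2)
     \<le> m^2 * real (card (units_mod s)) * (32 * K^3 * L^2 * (real (2 * X + 1) / real s)^2)"
proof -
  let ?w = "kernel_weight s X" and ?U = "units_mod s"
  define g where "g u v = (\<Sum>h\<in>{1..<int s}. ?w (u * h) * ?w (v * h))^2" for u v
  have g: "g u v \<ge> 0" "g (u mod int s) v = g u v" "g u (v mod int s) = g u v" for u v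
    by (simp_all add: g_def kernel_weight_mult_mod[OF s])
  have m0: "m \<ge> 0" using m[of 0] by linarith
  have "(\<Sum>l\<in>?U. \<Sum>l'\<in>?U. g (l ^ i) (l' ^ i)) \<le> (\<Sum>l\<in>?U. m * (\<Sum>v\<in>?U. g (l ^ i) v))"
    by (intro sum_mono sum_powers_le[OF s _ _ m] g)
  also have "\<dots> = m * (\<Sum>l\<in>?U. \<Sum>v\<in>?U. g (l ^ i) v)" by (simp add: sum_distrib_left)
  also have "\<dots> \<le> m * (m * (\<Sum>u\<in>?U. \<Sum>v\<in>?U. g u v))"
    by (intro mult_left_mono m0 sum_powers_le[OF s _ _ m, of "\<lambda>u. \<Sum>v\<in>?U. g u v"])
      (auto intro: sum_nonneg g(1) simp: g(2))
  also have "(\<Sum>u\<in>?U. \<Sum>v\<in>?U. g u v)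
      = real (card ?U) * (\<Sum>u\<in>?U. (\<Sum>h\<in>{1..<int s}. ?w (u * h) * ?w h)^2)"
    unfolding g_def by (rule sum_unit_pairs[where w = ?w, OF s kernel_weight_mod[OF s]])
  also have "m * (m * \<dots>) \<le> m * (m * (real (card ?U) * (32 * K^3 * L^2 * (real (2 * X + 1) / real s)^2)))"
    by (intro mult_left_mono m0 kernel_moment X) auto
  finally show ?thesis by (simp add: g_def power2_eq_square mult_ac)
qed

text \<open>The square of an orbit weight is a sum over pairs (l, l') in which the sums over h and k
  separate. Cauchy--Schwarz over the pairs isolates one fourth moment in X and one in Y, each
  involving a single power of l.\<close>

lemma orbit_weight_both_nonzero:
  assumes mi: "\<And>v. real (card {l \<in> units_mod s. int s dvd l ^ i - v}) \<le> m"
    and mj: "\<And>v. real (card {l \<in> units_mod s. int s dvd l ^ j - v}) \<le> m"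
    and X: "real (2 * X + 1) ^ 2 \<ge> real s" and Y: "real (2 * Y + 1) ^ 2 \<ge> real s"
  shows "(\<Sum>h\<in>{1..<int s}. \<Sum>k\<in>{1..<int s}. orbit_weight s i j X Y h k ^ 2)
    \<le> 32 * m^2 * K^3 * L^2 * real (card (units_mod s)) * ((real (2 * X + 1) / real s) * (real (2 * Y + 1) / real s))"
proof -
  let ?U = "units_mod s" and ?H = "{1..<int s}"
  let ?p = "\<lambda>l h. kernel_weight s X (l ^ i * h)" and ?q = "\<lambda>l k. kernel_weight s Y (l ^ j * k)"
  define P where "P = (\<lambda>z. \<Sum>h\<in>?H. ?p (fst z) h * ?p (snd z) h)"
  define Q where "Q = (\<lambda>z. \<Sum>k\<in>?H. ?q (fst z) k * ?q (snd z) k)"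
  define T where "T = (\<Sum>h\<in>?H. \<Sum>k\<in>?H. orbit_weight s i j X Y h k ^ 2)"
  define c where "c = 32 * m^2 * K^3 * L^2 * real (card ?U)"
  have m0: "m \<ge> 0" using mi[of 0] by linarith
  have "c \<ge> 0" unfolding c_def using one_le_K by simp
  have "T = (\<Sum>h\<in>?H. \<Sum>k\<in>?H. \<Sum>z\<in>?U \<times> ?U. (?p (fst z) h * ?p (snd z) h) * (?q (fst z) k * ?q (snd z) k))"
    unfolding T_def orbit_weight_def power2_eq_square sum_product sum.cartesian_product case_prod_unfold
    by (intro sum.cong refl) (simp add: mult_ac)
  also have "\<dots> = (\<Sum>z\<in>?U \<times> ?U. \<Sum>h\<in>?H. \<Sum>k\<in>?H. (?p (fst z) h * ?p (snd z) h) * (?q (fst z) k * ?q (snd z) k))"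
    by (rule trans[OF sum.cong[OF refl sum.swap] sum.swap])
  also have "\<dots> = (\<Sum>z\<in>?U \<times> ?U. P z * Q z)"
    unfolding P_def Q_def sum_product ..
  finally have "T^2 \<le> (\<Sum>z\<in>?U \<times> ?U. P z ^ 2) * (\<Sum>z\<in>?U \<times> ?U. Q z ^ 2)"
    by (simp only: sum_Cauchy_Schwarz)
  also have "\<dots> \<le> (c * (real (2 * X + 1) / real s)^2) * (c * (real (2 * Y + 1) / real s)^2)"
  proof (rule mult_mono)
    show "(\<Sum>z\<in>?U \<times> ?U. P z ^ 2) \<le> c * (real (2 * X + 1) / real s)^2"
      using power_kernel_moment[OF mi X] unfolding P_def c_def
      by (simp add: sum.cartesian_product case_prod_unfold mult_ac)
    show "(\<Sum>z\<in>?U \<times> ?U. Q z ^ 2) \<le> c * (real (2 * Y + 1) / real s)^2"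
      using power_kernel_moment[OF mj Y] unfolding Q_def c_def
      by (simp add: sum.cartesian_product case_prod_unfold mult_ac)
  qed (use \<open>c \<ge> 0\<close> in \<open>auto intro: sum_nonneg\<close>)
  also have "\<dots> = (c * ((real (2 * X + 1) / real s) * (real (2 * Y + 1) / real s)))^2"
    by (simp add: power2_eq_square mult_ac)
  finally have "T \<le> c * ((real (2 * X + 1) / real s) * (real (2 * Y + 1) / real s))"
    by (rule power2_le_imp_le) (use \<open>c \<ge> 0\<close> in simp)
  then show ?thesis by (simp add: T_def c_def)
qed

text \<open>One factor of the square is bounded pointwise, by 2mL, and the other on average over
  h.\<close>

lemma sum_orbit_squares:
  assumes m: "\<And>v. real (card {l \<in> units_mod s. int s dvd l ^ i - v}) \<le> m"
  shows "(\<Sum>h\<in>{1..<int s}. (\<Sum>l\<in>units_mod s. kernel_weight s X (l ^ i * h))^2)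
     \<le> 4 * m * L^2 * real (card (units_mod s))"
proof -
  let ?U = "units_mod s" and ?H = "{1..<int s}" and ?w = "kernel_weight s X"
  have m0: "m \<ge> 0" using m[of 0] by linarith
  have le: "(\<Sum>l\<in>?U. ?w (l ^ i * h)) \<le> m * (2 * L)" if h: "h \<in> ?H" for h
  proof -
    have "(\<Sum>l\<in>?U. ?w (l ^ i * h)) \<le> m * (\<Sum>u\<in>?U. ?w (u * h))"
      using sum_powers_le[OF s _ _ m, of "\<lambda>u. ?w (u * h)"]
      by (simp add: kernel_weight_nonneg kernel_weight_mult_mod[OF s])
    also have "\<dots> \<le> m * (2 * L)"
      by (intro mult_left_mono m0 unit_orbit_sum_le[OF s h harmonic_s_le kernel_weight_nonneg kernel_weight_mod[OF s] centered[OF s]])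
    finally show ?thesis .
  qed
  have "(\<Sum>h\<in>?H. (\<Sum>l\<in>?U. ?w (l ^ i * h))^2) \<le> (\<Sum>h\<in>?H. m * (2 * L) * (\<Sum>l\<in>?U. ?w (l ^ i * h)))"
    unfolding power2_eq_square
    by (intro sum_mono mult_right_mono le sum_nonneg kernel_weight_nonneg)
  also have "\<dots> = m * (2 * L) * (\<Sum>l\<in>?U. \<Sum>h\<in>?H. ?w (l ^ i * h))"
    unfolding sum_distrib_left[symmetric] by (subst sum.swap) simp
  also have "(\<Sum>l\<in>?U. \<Sum>h\<in>?H. ?w (l ^ i * h)) = (\<Sum>l\<in>?U. \<Sum>h\<in>?H. ?w h)"
  proof (rule sum.cong[OF refl])
    fix l assume "l \<in> ?U"
    then have "coprime (l ^ i) (int s)" by (simp add: units_mod_def)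
    then show "(\<Sum>h\<in>?H. ?w (l ^ i * h)) = (\<Sum>h\<in>?H. ?w h)"
      by (rule sum_mult_unit(2)[OF s]) (rule kernel_weight_mod[OF s])
  qed
  also have "m * (2 * L) * \<dots> \<le> m * (2 * L) * (\<Sum>l\<in>?U. 2 * L)"
  proof (intro mult_left_mono sum_mono)
    show "(\<Sum>h\<in>?H. ?w h) \<le> 2 * L" using sum_kernel_weight_le[OF s, of X] harmonic_s_le by linarith
  qed (use m0 L in auto)
  finally show ?thesis by (simp add: power2_eq_square mult_ac)
qed

lemma box_sum_error:
  assumes f_mod: "\<And>a b. f (a mod int s) (b mod int s) = f a b"
    and inv: "\<And>l a b. coprime l (int s) \<Longrightarrow> f (l ^ i * a) (l ^ j * b) = f a b"
    and D: "\<And>a b. \<bar>f a b\<bar> \<le> D"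
    and mi: "\<And>v. real (card {l \<in> units_mod s. int s dvd l ^ i - v}) \<le> m"
    and mj: "\<And>v. real (card {l \<in> units_mod s. int s dvd l ^ j - v}) \<le> m"
    and X: "real (2 * X + 1) ^ 2 \<ge> real s" and Y: "real (2 * Y + 1) ^ 2 \<ge> real s"
    and \<phi>: "real s \<le> c^2 * real (card (units_mod s))" "c \<ge> 0"
  shows "\<bar>(\<Sum>x\<in>{- int X..int X}. \<Sum>y\<in>{- int Y..int Y}. f x y)
      - real (2 * X + 1) * real (2 * Y + 1) / real s ^ 2 * (\<Sum>a\<in>{0..<int s}. \<Sum>b\<in>{0..<int s}. f a b)\<bar>
    \<le> 18 * c * m * K^2 * L * D * sqrt (real s) * (real (2 * X + 1) + real (2 * Y + 1))"
proof -
  let ?Z = "{0..<int s}" and ?H = "{1..<int s}"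
  let ?wX = "kernel_weight s X" and ?wY = "kernel_weight s Y"
  let ?F = "fourier s f"
  define \<alpha> \<beta> where "\<alpha> = real (2 * X + 1) / real s" and "\<beta> = real (2 * Y + 1) / real s"
  define N where "N = real (card (units_mod s))"
  have pos: "\<alpha> > 0" "\<beta> > 0" using s by (simp_all add: \<alpha>_def \<beta>_def)
  have D0: "D \<ge> 0" using D[of 0 0] by linarith
  have N: "N > 0"
  proof (rule ccontr)
    assume "\<not> N > 0"
    then have "N = 0" by (simp add: N_def)
    then show False using \<phi>(1) s by (simp add: N_def)
  qed
  have m1: "m \<ge> 1"
  proof -
    have "units_mod s \<noteq> {}" using N by (auto simp: N_def)
    then obtain l where "l \<in> units_mod s" by blast
    then have "l \<in> {l' \<in> units_mod s. int s dvd l' ^ i - l ^ i}" by simp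
    moreover have "finite {l' \<in> units_mod s. int s dvd l' ^ i - l ^ i}" by simp
    ultimately have "card {l' \<in> units_mod s. int s dvd l' ^ i - l ^ i} > 0"
      using card_gt_0_iff by blast
    then show ?thesis using mi[of "l ^ i"] by linarith
  qed
  define err where "err H K = (\<Sum>h\<in>H. \<Sum>k\<in>K. ?wX h * ?wY k * norm (?F h k))" for H K
  \<comment> \<open>Chosen so that N B^2 bounds the orbit weights on all three frequency ranges: 36
    = 6^2 covers the constant 32 for two nonzero frequencies and the constant 4 for one.\<close>
  define B where "B = 6 * m * K^2 * L * (\<alpha> + \<beta>)"
  have B0: "B \<ge> 0" unfolding B_def using m1 pos L by simp
  \<comment> \<open>The estimate (N err)^2 \<le> s^4 D^2 N B^2 together with s \<le> c^2 N leaves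
    s^(3/2) in place of s^2: this is the gain from averaging.\<close>
  have sq: "err H Ks \<le> c * D * (sqrt (real s))^3 * B"
    if H: "unit_invariant s H" "unit_invariant s Ks"
      and le: "(\<Sum>h\<in>H. \<Sum>k\<in>Ks. orbit_weight s i j X Y h k ^ 2) \<le> N * B^2" for H Ks
  proof -
    have "(N * err H Ks)^2 \<le> real s ^ 4 * D^2 * (\<Sum>h\<in>H. \<Sum>k\<in>Ks. orbit_weight s i j X Y h k ^ 2)"
      unfolding N_def err_def by (rule averaged_error[where f = f, OF s f_mod inv D H])
    also have "\<dots> \<le> real s ^ 4 * D^2 * (N * B^2)" by (rule mult_left_mono[OF le]) simp
    finally have "N * (N * err H Ks ^ 2) \<le> N * (real s ^ 4 * D^2 * B^2)"
      by (simp add: power2_eq_square mult_ac)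
    then have "N * err H Ks ^ 2 \<le> real s ^ 4 * D^2 * B^2" using N by simp
    then have "c^2 * (N * err H Ks ^ 2) \<le> c^2 * (real s ^ 4 * D^2 * B^2)" by (rule mult_left_mono) simp
    moreover have "real s * err H Ks ^ 2 \<le> c^2 * N * err H Ks ^ 2"
      using \<phi>(1) unfolding N_def by (rule mult_right_mono) simp
    ultimately have "real s * err H Ks ^ 2 \<le> real s * (c^2 * real s ^ 3 * D^2 * B^2)"
      by (simp add: eval_nat_numeral mult_ac)
    then have "err H Ks ^ 2 \<le> c^2 * real s ^ 3 * D^2 * B^2" using s by simp
    also have "\<dots> = (c * D * (sqrt (real s))^3 * B)^2"
    proof -
      have "((sqrt (real s))^3)^2 = real s ^ 3"
      proof -
        have "(r ^ 3)^2 = (r * r) * (r * r) * (r * r)" for r :: real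
          by (simp only: power2_eq_square power3_eq_cube mult_ac)
        from this[of "sqrt (real s)"] show ?thesis by (simp add: power3_eq_cube)
      qed
      then show ?thesis by (simp add: power_mult_distrib mult_ac)
    qed
    finally show ?thesis by (rule power2_le_imp_le) (use \<phi>(2) D0 B0 in simp)
  qed
  have K2: "1 \<le> K" "K^3 \<le> K^4" using one_le_K by (auto intro: power_increasing)
  have "L^2 \<ge> 0" "K^4 \<ge> 1" using K2 by (auto intro: one_le_power)
  have BB: "B^2 = 36 * m^2 * K^4 * L^2 * (\<alpha> + \<beta>)^2"
    unfolding B_def by (simp add: power_mult_distrib power_mult[symmetric])
  have nz: "err ?H ?H \<le> c * D * (sqrt (real s))^3 * B"
  proof (rule sq)
    have "(\<Sum>h\<in>?H. \<Sum>k\<in>?H. orbit_weight s i j X Y h k ^ 2) \<le> 32 * m^2 * K^3 * L^2 * N * (\<alpha> * \<beta>)"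
      unfolding N_def \<alpha>_def \<beta>_def by (rule orbit_weight_both_nonzero[OF mi mj X Y])
    also have "\<dots> \<le> 36 * m^2 * K^4 * L^2 * N * (\<alpha> + \<beta>)^2"
    proof (intro mult_mono)
      show "\<alpha> * \<beta> \<le> (\<alpha> + \<beta>)^2" using pos by (simp add: power2_eq_square algebra_simps)
    qed (use K2 N pos L in auto)
    finally show "(\<Sum>h\<in>?H. \<Sum>k\<in>?H. orbit_weight s i j X Y h k ^ 2) \<le> N * B^2" by (simp add: BB mult_ac)
  qed (use unit_invariant_nonzero s in auto)
  \<comment> \<open>For a frequency equal to 0 the kernel weight is \<alpha> or \<beta> itself, so
    that its square factors out of the sum.\<close>
  have one_var: "4 * m * L^2 * N * \<gamma>^2 \<le> N * B^2" if "0 \<le> \<gamma>" "\<gamma> \<le> \<alpha> + \<beta>" for \<gamma>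
  proof -
    have "m \<le> m^2" using m1 by (simp add: power2_eq_square)
    have "4 * m * 1 \<le> 36 * m^2 * K^4" using \<open>m \<le> m^2\<close> \<open>K^4 \<ge> 1\<close> m1 by (intro mult_mono) auto
    then have "4 * m \<le> 36 * m^2 * K^4" by simp
    moreover have "\<gamma>^2 \<le> (\<alpha> + \<beta>)^2" using that by (intro power_mono) auto
    ultimately have "4 * m * \<gamma>^2 \<le> 36 * m^2 * K^4 * (\<alpha> + \<beta>)^2"
      by (rule mult_mono) (use K2 in auto)
    then have "4 * m * \<gamma>^2 * (L^2 * N) \<le> 36 * m^2 * K^4 * (\<alpha> + \<beta>)^2 * (L^2 * N)"
      using N by (intro mult_right_mono) auto
    then show ?thesis by (simp add: BB mult_ac)
  qed
  have z1: "err {0} ?H \<le> c * D * (sqrt (real s))^3 * B"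
  proof (rule sq)
    have "(\<Sum>h\<in>{0}. \<Sum>k\<in>?H. orbit_weight s i j X Y h k ^ 2)
        = \<alpha>^2 * (\<Sum>k\<in>?H. (\<Sum>l\<in>units_mod s. ?wY (l ^ j * k))^2)"
    proof -
      have "kernel_weight s X 0 = \<alpha>" unfolding \<alpha>_def by (rule kernel_weight_0)
      then have eq: "orbit_weight s i j X Y 0 k = \<alpha> * (\<Sum>l\<in>units_mod s. ?wY (l ^ j * k))" for k
        by (simp add: orbit_weight_def sum_distrib_left)
      have "(\<Sum>h\<in>{0}. \<Sum>k\<in>?H. orbit_weight s i j X Y h k ^ 2) = (\<Sum>k\<in>?H. orbit_weight s i j X Y 0 k ^ 2)"
        by simp
      then show ?thesis by (simp only: eq power_mult_distrib sum_distrib_left[symmetric])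
    qed
    also have "\<dots> \<le> \<alpha>^2 * (4 * m * L^2 * N)"
      unfolding N_def by (intro mult_left_mono sum_orbit_squares mj) auto
    also have "\<dots> \<le> N * B^2" using one_var[of \<alpha>] pos by (simp add: mult_ac)
    finally show "(\<Sum>h\<in>{0}. \<Sum>k\<in>?H. orbit_weight s i j X Y h k ^ 2) \<le> N * B^2" .
  qed (use unit_invariant_nonzero unit_invariant_zero s in auto)
  have z2: "err ?H {0} \<le> c * D * (sqrt (real s))^3 * B"
  proof (rule sq)
    have "(\<Sum>h\<in>?H. \<Sum>k\<in>{0}. orbit_weight s i j X Y h k ^ 2)
        = \<beta>^2 * (\<Sum>h\<in>?H. (\<Sum>l\<in>units_mod s. ?wX (l ^ i * h))^2)"
    proof -
      have "kernel_weight s Y 0 = \<beta>" unfolding \<beta>_def by (rule kernel_weight_0)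
      then have eq: "orbit_weight s i j X Y h 0 = \<beta> * (\<Sum>l\<in>units_mod s. ?wX (l ^ i * h))" for h
        by (simp add: orbit_weight_def sum_distrib_left mult.commute)
      have "(\<Sum>h\<in>?H. \<Sum>k\<in>{0}. orbit_weight s i j X Y h k ^ 2) = (\<Sum>h\<in>?H. orbit_weight s i j X Y h 0 ^ 2)"
        by simp
      then show ?thesis by (simp only: eq power_mult_distrib sum_distrib_left[symmetric])
    qed
    also have "\<dots> \<le> \<beta>^2 * (4 * m * L^2 * N)"
      unfolding N_def by (intro mult_left_mono sum_orbit_squares mi) auto
    also have "\<dots> \<le> N * B^2" using one_var[of \<beta>] pos by (simp add: mult_ac)
    finally show "(\<Sum>h\<in>?H. \<Sum>k\<in>{0}. orbit_weight s i j X Y h k ^ 2) \<le> N * B^2" .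
  qed (use unit_invariant_nonzero unit_invariant_zero s in auto)
  define G where "G h k = box_kernel s X h * box_kernel s Y k * ?F h k" for h k
  have normG: "norm (\<Sum>h\<in>H. \<Sum>k\<in>Ks. G h k) \<le> real s ^ 2 * err H Ks" for H Ks
  proof -
    have "norm (\<Sum>h\<in>H. \<Sum>k\<in>Ks. G h k) \<le> (\<Sum>h\<in>H. \<Sum>k\<in>Ks. norm (G h k))"
      by (intro sum_norm_le order_refl)
    also have "\<dots> = real s ^ 2 * err H Ks"
      unfolding err_def G_def sum_distrib_left using s
      by (intro sum.cong refl) (simp add: norm_mult kernel_weight_def power2_eq_square)
    finally show ?thesis .
  qed
  have Zsplit: "(\<Sum>h\<in>?Z. g h) = g 0 + (\<Sum>h\<in>?H. g h)" for g :: "int \<Rightarrow> complex"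
  proof -
    have "?Z = insert 0 ?H" using s by auto
    then show ?thesis by simp
  qed
  define S0 where "S0 = (\<Sum>a\<in>?Z. \<Sum>b\<in>?Z. f a b)"
  define S where "S = (\<Sum>x\<in>{- int X..int X}. \<Sum>y\<in>{- int Y..int Y}. f x y)"
  have G00: "G 0 0 = of_real (real (2 * X + 1) * real (2 * Y + 1) * S0)"
  proof -
    have "box_kernel s V 0 = of_nat (2 * V + 1)" for V
      by (simp add: box_kernel_def nat_add_distrib nat_mult_distrib)
    then show ?thesis by (simp add: G_def fourier_def S0_def)
  qed
  have "of_nat s ^ 2 * of_real S = (\<Sum>h\<in>?Z. \<Sum>k\<in>?Z. G h k)"
    unfolding S_def G_def by (rule completion[where f = f, OF s f_mod, symmetric])
  also have "\<dots> = G 0 0 + ((\<Sum>h\<in>{0}. \<Sum>k\<in>?H. G h k) + (\<Sum>h\<in>?H. \<Sum>k\<in>{0}. G h k) + (\<Sum>h\<in>?H. \<Sum>k\<in>?H. G h k))"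
    unfolding Zsplit by (simp add: sum.distrib)
  finally have eq: "complex_of_real (real s ^ 2 * S - real (2 * X + 1) * real (2 * Y + 1) * S0)
     = (\<Sum>h\<in>{0}. \<Sum>k\<in>?H. G h k) + (\<Sum>h\<in>?H. \<Sum>k\<in>{0}. G h k) + (\<Sum>h\<in>?H. \<Sum>k\<in>?H. G h k)"
    unfolding G00 by (simp add: algebra_simps)
  have "\<bar>real s ^ 2 * S - real (2 * X + 1) * real (2 * Y + 1) * S0\<bar>
     = norm ((\<Sum>h\<in>{0}. \<Sum>k\<in>?H. G h k) + (\<Sum>h\<in>?H. \<Sum>k\<in>{0}. G h k) + (\<Sum>h\<in>?H. \<Sum>k\<in>?H. G h k))"
    unfolding eq[symmetric] by (simp only: norm_of_real real_norm_def)
  also have "\<dots> \<le> real s ^ 2 * err {0} ?H + real s ^ 2 * err ?H {0} + real s ^ 2 * err ?H ?H"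
    by (intro order_trans[OF norm_triangle_ineq] add_mono normG)
  also have "\<dots> \<le> real s ^ 2 * (c * D * (sqrt (real s))^3 * B) + real s ^ 2 * (c * D * (sqrt (real s))^3 * B)
      + real s ^ 2 * (c * D * (sqrt (real s))^3 * B)"
    by (intro add_mono mult_left_mono z1 z2 nz) auto
  finally have main: "\<bar>real s ^ 2 * S - real (2 * X + 1) * real (2 * Y + 1) * S0\<bar>
      \<le> real s ^ 2 * (3 * (c * D * (sqrt (real s))^3 * B))" by (simp add: mult_ac)
  have "S - real (2 * X + 1) * real (2 * Y + 1) / real s ^ 2 * S0
     = (real s ^ 2 * S - real (2 * X + 1) * real (2 * Y + 1) * S0) / real s ^ 2"
    using s by (simp add: field_simps)
  then have "\<bar>S - real (2 * X + 1) * real (2 * Y + 1) / real s ^ 2 * S0\<bar>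
     = \<bar>real s ^ 2 * S - real (2 * X + 1) * real (2 * Y + 1) * S0\<bar> / real s ^ 2"
    by simp
  also have "\<dots> \<le> real s ^ 2 * (3 * (c * D * (sqrt (real s))^3 * B)) / real s ^ 2"
    by (rule divide_right_mono[OF main]) simp
  also have "\<dots> = 3 * (c * D * (sqrt (real s))^3 * B)" using s by simp
  also have "\<dots> = 18 * c * m * K^2 * L * D * sqrt (real s) * (real (2 * X + 1) + real (2 * Y + 1))"
  proof -
    have "(sqrt (real s))^3 * (\<alpha> + \<beta>) = sqrt (real s) * (real s * (\<alpha> + \<beta>))"
      by (simp add: power3_eq_cube mult.assoc[symmetric])
    also have "real s * (\<alpha> + \<beta>) = real (2 * X + 1) + real (2 * Y + 1)"
      using s by (simp add: \<alpha>_def \<beta>_def field_simps)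
    finally have *: "(sqrt (real s))^3 * (\<alpha> + \<beta>) = sqrt (real s) * (real (2 * X + 1) + real (2 * Y + 1))" .
    have "3 * (c * D * (sqrt (real s))^3 * B) = 18 * c * m * K^2 * L * D * ((sqrt (real s))^3 * (\<alpha> + \<beta>))"
      by (simp add: B_def mult_ac)
    then show ?thesis unfolding * by (simp add: mult_ac)
  qed
  finally show ?thesis unfolding S_def S0_def .
qed

end

subsection \<open>Divisor bound, roots of unity and the radical\<close>


text \<open>If p^\<eta> \<ge> 2, then e + 1 \<le> 2^e \<le> p^(e \<eta>). Only the primes below B
  cost a constant factor each, and B depends on \<eta> alone.\<close>

lemma num_divisors_bound:
  fixes \<eta> :: real
  assumes \<eta>: "\<eta> > 0"
  obtains C where "C \<ge> 1" "\<And>n. n > 0 \<Longrightarrow> real (num_divisors n) \<le> C * real n powr \<eta>"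
proof -
  \<comment> \<open>Makes C1 \<eta> ln 2 \<ge> 1, so that e + 1 \<le> C1 (1 + e \<eta> ln 2) \<le>
    C1 2^(e \<eta>).\<close>
  define C1 where "C1 = max 1 (1 / (\<eta> * ln 2))"
  define B where "B = nat \<lceil>2 powr (1 / \<eta>)\<rceil>"
  have C1: "C1 \<ge> 1" by (simp add: C1_def)
  have local: "real (e + 1) \<le> (if p < B then C1 else 1) * (real p ^ e) powr \<eta>" if "prime p" for p e :: nat
  proof -
    have p2: "real p \<ge> 2" using prime_ge_2_nat[OF that] by simp
    have pe: "(real p ^ e) powr \<eta> = (real p powr \<eta>) ^ e"
      using p2 by (simp add: powr_powr powr_realpow[symmetric] mult.commute)
    show ?thesis
    proof (cases "p < B")
      case True
      have "real (e + 1) \<le> C1 * (1 + real e * (\<eta> * ln 2))"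
      proof -
        have "1 \<le> C1 * (\<eta> * ln 2)"
        proof -
          have "(1 / (\<eta> * ln 2)) * (\<eta> * ln 2) \<le> C1 * (\<eta> * ln 2)"
            using \<eta> by (intro mult_right_mono) (auto simp: C1_def)
          then show ?thesis using \<eta> by simp
        qed
        then have "real e * 1 \<le> real e * (C1 * (\<eta> * ln 2))" by (intro mult_left_mono) auto
        then show ?thesis using C1 by (simp add: algebra_simps)
      qed
      also have "\<dots> \<le> C1 * exp (real e * (\<eta> * ln 2))"
        using C1 by (intro mult_left_mono exp_ge_add_one_self) auto
      also have "exp (real e * (\<eta> * ln 2)) = (2 powr \<eta>) ^ e"
        by (simp add: powr_def exp_of_nat_mult)
      also have "C1 * (2 powr \<eta>) ^ e \<le> C1 * (real p powr \<eta>) ^ e"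
        using C1 p2 \<eta> by (intro mult_left_mono power_mono powr_mono2) auto
      finally show ?thesis using True by (simp add: pe)
    next
      case False
      have "2 powr (1 / \<eta>) \<le> real B" unfolding B_def by linarith
      also have "\<dots> \<le> real p" using False by simp
      finally have "(2 powr (1 / \<eta>)) powr \<eta> \<le> real p powr \<eta>"
        using \<eta> by (intro powr_mono2) auto
      then have "2 \<le> real p powr \<eta>" using \<eta> by (simp add: powr_powr)
      then have "2 ^ e \<le> (real p powr \<eta>) ^ e" by (intro power_mono) auto
      moreover have "e + 1 \<le> 2 ^ e" by (induction e) auto
      then have "real (e + 1) \<le> real (2 ^ e)" by (simp only: of_nat_le_iff)
      ultimately show ?thesis using False by (simp add: pe)
    qed
  qed
  have "real (num_divisors n) \<le> C1 ^ B * real n powr \<eta>" if n: "n > 0" for n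
  proof -
    have "real (num_divisors n) = (\<Prod>p\<in>prime_factors n. real (multiplicity p n + 1))"
      using num_divisors_eq_prod[OF n] by simp
    also have "\<dots> \<le> (\<Prod>p\<in>prime_factors n. (if p < B then C1 else 1) * (real p ^ multiplicity p n) powr \<eta>)"
    proof (rule prod_mono, intro conjI)
      fix p assume "p \<in> prime_factors n"
      then have "prime p" by auto
      then show "real (multiplicity p n + 1) \<le> (if p < B then C1 else 1) * (real p ^ multiplicity p n) powr \<eta>"
        by (rule local)
    qed simp
    also have "\<dots> = (\<Prod>p\<in>prime_factors n. if p < B then C1 else 1) * (\<Prod>p\<in>prime_factors n. (real p ^ multiplicity p n) powr \<eta>)"
      by (rule prod.distrib)
    also have "(\<Prod>p\<in>prime_factors n. (real p ^ multiplicity p n) powr \<eta>) = real n powr \<eta>"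
    proof -
      have "(\<Prod>p\<in>A. g p powr \<eta>) = (\<Prod>p\<in>A. g p) powr \<eta>" if "\<And>p. g p \<ge> 0" for A :: "nat set" and g :: "nat \<Rightarrow> real"
        using that by (induction A rule: infinite_finite_induct) (auto simp: powr_mult prod_nonneg)
      then have "(\<Prod>p\<in>prime_factors n. (real p ^ multiplicity p n) powr \<eta>) = (\<Prod>p\<in>prime_factors n. real p ^ multiplicity p n) powr \<eta>"
        by simp
      also have "(\<Prod>p\<in>prime_factors n. real p ^ multiplicity p n) = real n"
        using arg_cong[OF prime_factorization_nat[OF n], of real] by simp
      finally show ?thesis .
    qed
    also have "(\<Prod>p\<in>prime_factors n. if p < B then C1 else 1) * real n powr \<eta> \<le> C1 ^ B * real n powr \<eta>"
    proof (rule mult_right_mono)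
      have "(\<Prod>p\<in>prime_factors n. if p < B then C1 else 1) = (\<Prod>p\<in>prime_factors n \<inter> {..<B}. C1)"
        by (simp add: prod.inter_restrict[symmetric] prod.If_cases Int_def)
      also have "\<dots> = C1 ^ card (prime_factors n \<inter> {..<B})" by simp
      also have "\<dots> \<le> C1 ^ B"
        using C1 card_mono[of "{..<B}" "prime_factors n \<inter> {..<B}"] by (intro power_increasing) auto
      finally show "(\<Prod>p\<in>prime_factors n. if p < B then C1 else 1) \<le> C1 ^ B" .
    qed simp
    finally show ?thesis .
  qed
  then show ?thesis using C1 by (intro that[of "C1 ^ B"]) (auto intro: one_le_power)
qed

lemma harmonic_le_ln: "n > 0 \<Longrightarrow> harmonic n \<le> 1 + ln (real n)"
proof (induction n rule: nat_induct_non_zero)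
  case 1
  then show ?case by (simp add: harmonic_def)
next
  case (Suc n)
  have "ln (real n / real (Suc n)) \<le> real n / real (Suc n) - 1"
    using Suc.hyps by (intro ln_le_minus_one) simp
  then have "1 / real (Suc n) \<le> ln (real (Suc n)) - ln (real n)"
    using Suc.hyps by (simp add: ln_div field_simps)
  then show ?case using Suc.IH by (simp add: harmonic_def)
qed

lemma harmonic_square_bound:
  assumes "s > 0" "\<eta> > 0"
  shows "harmonic (s^2) \<le> (1 + 2 / \<eta>) * real s powr \<eta>"
proof -
  have s1: "real s \<ge> 1" using assms by simp
  have "harmonic (s^2) \<le> 1 + 2 * ln (real s)"
    using harmonic_le_ln[of "s^2"] assms by (simp add: ln_realpow)
  also have "\<dots> \<le> 1 * real s powr \<eta> + 2 * (real s powr \<eta> / \<eta>)"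
    using ge_one_powr_ge_zero[OF s1] ln_powr_bound[OF s1 assms(2)] assms(2)
    by (intro add_mono mult_left_mono) auto
  finally show ?thesis by (simp add: algebra_simps)
qed

lemma squarefree_dvd_int:
  assumes "squarefree s" and "\<And>p. p \<in> prime_factors s \<Longrightarrow> int p dvd d"
  shows "int s dvd d"
proof (cases "d = 0")
  case False
  have s0: "s \<noteq> 0" using assms(1) by (metis not_squarefree_0)
  have "s dvd nat \<bar>d\<bar>"
  proof (rule multiplicity_le_imp_dvd)
    fix p :: nat assume "prime p"
    show "multiplicity p s \<le> multiplicity p (nat \<bar>d\<bar>)"
    proof (cases "p dvd s")
      case True
      then have p: "p \<in> prime_factors s" using \<open>prime p\<close> s0 by (simp add: prime_factors_dvd)
      then have "multiplicity p s = 1" using assms(1) s0 squarefree_factorial_semiring'[of s] by blast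
      moreover have "p dvd nat \<bar>d\<bar>" using assms(2)[OF p] int_dvd_int_iff[of p "nat \<bar>d\<bar>"] by simp
      then have "multiplicity p (nat \<bar>d\<bar>) \<ge> 1"
        using False \<open>prime p\<close> by (intro multiplicity_geI) auto
      ultimately show ?thesis by simp
    qed (simp add: not_dvd_imp_multiplicity_0)
  qed (use s0 in simp)
  then have "int s dvd int (nat \<bar>d\<bar>)" by (simp only: int_dvd_int_iff)
  then show ?thesis by simp
qed simp

text \<open>The Chinese remainder theorem as an injection: for squarefree s a residue is determined
  by its residues at the primes, and modulo each prime there are at most i roots.\<close>

lemma card_roots_le:
  assumes s: "squarefree s" and i: "i > 0"
  shows "card {l \<in> units_mod s. int s dvd l ^ i - v} \<le> i ^ card (prime_factors s)"
proof -
  let ?P = "prime_factors s" and ?S = "{l \<in> units_mod s. int s dvd l ^ i - v}"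
  define R where "R p = {x\<in>{..<p}. [x ^ i = nat (v mod int p)] (mod p)}" for p
  define \<phi> where "\<phi> l = restrict (\<lambda>p. nat (l mod int p)) ?P" for l
  have R: "card (R p) \<le> i" if "p \<in> ?P" for p
    unfolding R_def using that i by (intro roots_mod_prime_bound) auto
  have p0: "p > 0" if "p \<in> ?P" for p using that by (auto intro: prime_gt_0_nat)
  have "inj_on \<phi> ?S"
  proof (rule inj_onI)
    fix x y assume xy: "x \<in> ?S" "y \<in> ?S" "\<phi> x = \<phi> y"
    have "int s dvd x - y"
    proof (rule squarefree_dvd_int[OF s])
      fix p assume p: "p \<in> ?P"
      have "nat (x mod int p) = nat (y mod int p)" using fun_cong[OF xy(3), of p] p by (simp add: \<phi>_def)
      then have "x mod int p = y mod int p" using p0[OF p] by (simp add: eq_nat_nat_iff)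
      then show "int p dvd x - y" by (simp add: mod_eq_dvd_iff)
    qed
    then have "x mod int s = y mod int s" by (simp add: mod_eq_dvd_iff)
    then show "x = y" using xy by (simp add: units_mod_def)
  qed
  moreover have "\<phi> ` ?S \<subseteq> Pi\<^sub>E ?P R"
  proof clarify
    fix l assume l: "l \<in> units_mod s" "int s dvd l ^ i - v"
    show "\<phi> l \<in> Pi\<^sub>E ?P R"
    proof (rule PiE_I)
      fix p assume p: "p \<in> ?P"
      have "int p dvd l ^ i - v" using l(2) p by (meson dvd_trans in_prime_factors_imp_dvd int_dvd_int_iff)
      then have "(l mod int p) ^ i mod int p = v mod int p mod int p" by (simp add: mod_eq_dvd_iff power_mod)
      then have "[int (nat (l mod int p) ^ i) = int (nat (v mod int p))] (mod int p)"
        using p0[OF p] by (simp add: cong_def)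
      then have "[nat (l mod int p) ^ i = nat (v mod int p)] (mod p)" by (simp only: cong_int_iff)
      moreover have "nat (l mod int p) < p" using p0[OF p] by (simp add: nat_less_iff)
      ultimately show "\<phi> l p \<in> R p" using p by (simp add: \<phi>_def R_def)
    qed (simp add: \<phi>_def)
  qed
  ultimately have "card ?S \<le> card (Pi\<^sub>E ?P R)"
    by (intro card_inj_on_le finite_PiE) (auto simp: R_def)
  also have "\<dots> = (\<Prod>p\<in>?P. card (R p))" by (simp add: card_PiE)
  also have "\<dots> \<le> (\<Prod>p\<in>?P. i)" by (rule prod_mono) (simp add: R)
  finally show ?thesis by simp
qed

text \<open>phi(s)/s is a product of factors 1 - 1/p \<ge> 1/2. For s > 1 neither 0 nor s is coprime
  to s, so residues in 0..s-1 and totatives in 1..s agree.\<close>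

lemma card_units_mod_ge:
  assumes "s > 1"
  shows "real s \<le> 2 ^ card (prime_factors s) * real (card (units_mod s))"
proof -
  have "units_mod s = int ` totatives s"
  proof (intro equalityI subsetI)
    fix x assume x: "x \<in> units_mod s"
    then have "coprime x (int s)" by (simp add: units_mod_def)
    moreover have "\<not> coprime 0 (int s)" using assms by simp
    ultimately have "x \<noteq> 0" by metis
    moreover obtain k where k: "x = int k" using x by (auto simp: units_mod_def elim: nonneg_int_cases)
    ultimately have "k \<in> totatives s" using x by (simp add: units_mod_def totatives_def)
    then show "x \<in> int ` totatives s" unfolding k by (rule imageI)
  next
    fix x assume "x \<in> int ` totatives s"
    then obtain k where k: "x = int k" "k \<in> totatives s" by blast
    have "coprime k s" "k \<le> s" using k(2) by (simp_all add: totatives_def)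
    moreover have "\<not> coprime s s" using assms by simp
    ultimately have "k \<noteq> s" by metis
    with \<open>coprime k s\<close> \<open>k \<le> s\<close> show "x \<in> units_mod s" by (simp add: units_mod_def k(1))
  qed
  then have "card (units_mod s) = totient s" by (simp add: card_image totient_def)
  then have "real (card (units_mod s)) = real s * (\<Prod>p\<in>prime_factors s. 1 - 1 / real p)"
    by (simp add: totient_formula2)
  also have "\<dots> \<ge> real s * (\<Prod>p\<in>prime_factors s. 1 / 2)"
  proof (intro mult_left_mono prod_mono)
    fix p assume "p \<in> prime_factors s"
    then have "real p \<ge> 2" using prime_ge_2_nat[of p] by auto
    then show "0 \<le> (1 / 2 :: real) \<and> 1 / 2 \<le> 1 - 1 / real p" by (simp add: field_simps)
  qed simp
  finally have "real s / 2 ^ card (prime_factors s) \<le> real (card (units_mod s))"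
    by (simp add: power_one_over)
  then show ?thesis by (simp add: field_simps)
qed

text \<open>A prime divisor of n missing from the largest squarefree divisor could be multiplied in,
  against maximality.\<close>

lemma max_squarefree_divisor:
  assumes "n > 0"
  shows "max_squarefree_divisor n dvd n" "squarefree (max_squarefree_divisor n)"
    "max_squarefree_divisor n > 0" "prime_factors (max_squarefree_divisor n) = prime_factors n"
proof -
  let ?A = "{d. d dvd n \<and> squarefree d}" and ?s = "max_squarefree_divisor n"
  have "finite {d. d dvd n}" using assms by (rule finite_divisors_nat)
  then have fin: "finite ?A" by (rule finite_subset[rotated]) auto
  have "1 \<in> ?A" by simp
  then have "?s \<in> ?A" unfolding max_squarefree_divisor_def using Max_in[OF fin] by blast
  then show s: "?s dvd n" "squarefree ?s" by auto
  then show s0: "?s > 0" using assms by (auto intro!: Nat.gr0I)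
  have "p dvd ?s" if p: "prime p" "p dvd n" for p
  proof (rule ccontr)
    assume "\<not> p dvd ?s"
    then have cop: "coprime p ?s" using p(1) by (simp add: prime_imp_coprime)
    then have "p * ?s dvd n" using p(2) s(1) by (intro divides_mult)
    moreover have "squarefree (p * ?s)"
      by (rule squarefree_mult_coprime[OF cop squarefree_prime[OF p(1)] s(2)])
    ultimately have "p * ?s \<le> ?s"
      unfolding max_squarefree_divisor_def using Max_ge[OF fin] by blast
    then show False using prime_gt_1_nat[OF p(1)] s0 by simp
  qed
  then show "prime_factors ?s = prime_factors n"
    using s(1) s0 assms by (auto simp: prime_factors_dvd intro: dvd_trans)
qed

section \<open>The summand as a periodic function invariant under twists\<close>

lemma admissible_iff:
  assumes "n > 1"
  shows "admissible n a b \<longleftrightarrow> (\<forall>p\<in>prime_factors n. \<not> int p dvd a * b * Delta a b)"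
proof -
  have "admissible n a b \<longleftrightarrow> coprime (a * b * Delta a b) (int n)"
  proof -
    \<comment> \<open>For n > 1 coprimality already excludes \<open>Delta a b = 0\<close>. Only at n
      = 1 is this a separate condition, and one that is not periodic; hence the special treatment of
      n = 1.\<close>
    have "\<not> coprime 0 (int n)" using assms by simp
    then show ?thesis unfolding admissible_def by (metis mult_zero_right)
  qed
  also have "\<dots> \<longleftrightarrow> (\<forall>p\<in>prime_factors n. \<not> int p dvd a * b * Delta a b)"
    using assms by (subst coprime_nat_int_iff) (auto simp: prime_factors_dvd)
  finally show ?thesis .
qed

text \<open>Extension by zero turns the restricted sums into sums over full boxes. For n > 1
  admissibility depends only on residues and is stable under twists, so both symmetries
  survive.\<close>

definition coeff_mod :: "nat \<Rightarrow> int \<Rightarrow> int \<Rightarrow> real" where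
  "coeff_mod n a b = (if admissible n a b then trace_coeff a b n else 0)"

lemma coeff_mod_mod:
  assumes n: "n > 1" and s: "\<And>p. p \<in> prime_factors n \<Longrightarrow> int p dvd int s"
  shows "coeff_mod n (a mod int s) (b mod int s) = coeff_mod n a b"
proof -
  have cong: "[x mod int s = x] (mod int p)" if "p \<in> prime_factors n" for x p
    using s[OF that] by (metis cong_def mod_mod_cancel)
  have "int p dvd (a mod int s) * (b mod int s) * Delta (a mod int s) (b mod int s)
      \<longleftrightarrow> int p dvd a * b * Delta a b" if "p \<in> prime_factors n" for p
    unfolding Delta_def by (intro cong_dvd_iff cong_mult cong_add cong_pow cong_refl cong[OF that])
  then have adm: "admissible n (a mod int s) (b mod int s) \<longleftrightarrow> admissible n a b"
    by (simp add: admissible_iff[OF n])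
  have "affine_points p (a mod int s) (b mod int s) = affine_points p a b" if "p \<in> prime_factors n" for p
    by (intro cong_affine_points cong[OF that])
  then have "trace_coeff (a mod int s) (b mod int s) n = trace_coeff a b n"
    unfolding trace_coeff_def by simp
  then show ?thesis by (simp add: coeff_mod_def adm)
qed

lemma coeff_mod_twist:
  assumes n: "n > 1" and l: "\<And>p. p \<in> prime_factors n \<Longrightarrow> \<not> int p dvd l"
  shows "coeff_mod n (l^4 * a) (l^6 * b) = coeff_mod n a b"
proof -
  have pr: "prime (int p)" if "p \<in> prime_factors n" for p using that by auto
  \<comment> \<open>22 = 4 + 6 + 12, as \<open>Delta\<close> has weight 12.\<close>
  have "(l^4 * a) * (l^6 * b) * Delta (l^4 * a) (l^6 * b) = l^22 * (a * b * Delta a b)"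
    by (simp add: Delta_def power_mult_distrib algebra_simps flip: power_mult power_add)
  then have "int p dvd (l^4 * a) * (l^6 * b) * Delta (l^4 * a) (l^6 * b) \<longleftrightarrow> int p dvd a * b * Delta a b"
    if "p \<in> prime_factors n" for p
    using l[OF that] pr[OF that] prime_dvd_power by (metis prime_dvd_mult_iff)
  then have adm: "admissible n (l^4 * a) (l^6 * b) \<longleftrightarrow> admissible n a b"
    by (simp add: admissible_iff[OF n])
  have "card (affine_points p (l^4 * a) (l^6 * b)) = card (affine_points p a b)" if "p \<in> prime_factors n" for p
    using that l by (intro card_affine_points_twist) auto
  then have "trace_coeff (l^4 * a) (l^6 * b) n = trace_coeff a b n"
    unfolding trace_coeff_def by simp
  then show ?thesis by (simp add: coeff_mod_def adm)
qed

lemma coeff_mod_bound: "odd n \<Longrightarrow> \<bar>coeff_mod n a b\<bar> \<le> real (num_divisors n)"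
  by (simp add: coeff_mod_def trace_coeff_bound)

lemma abs_le_floor_iff:
  assumes "A \<ge> 0"
  shows "\<bar>real_of_int a\<bar> \<le> A \<longleftrightarrow> a \<in> {- int (nat \<lfloor>A\<rfloor>)..int (nat \<lfloor>A\<rfloor>)}"
proof -
  have "\<bar>real_of_int a\<bar> \<le> A \<longleftrightarrow> \<bar>a\<bar> \<le> \<lfloor>A\<rfloor>" by (simp add: le_floor_iff)
  also have "\<dots> \<longleftrightarrow> a \<in> {- int (nat \<lfloor>A\<rfloor>)..int (nat \<lfloor>A\<rfloor>)}" using assms by auto
  finally show ?thesis .
qed

lemma sum_admissible_box:
  assumes n: "odd n" and "A \<ge> 0" "B \<ge> 0"
  shows "(\<Sum>(a, b) \<in> {(a, b). \<bar>real_of_int a\<bar> \<le> A \<and> \<bar>real_of_int b\<bar> \<le> B \<and> admissible n a b}.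
        L_coeff_normalized (curve a b) n)
     = (\<Sum>x\<in>{- int (nat \<lfloor>A\<rfloor>)..int (nat \<lfloor>A\<rfloor>)}. \<Sum>y\<in>{- int (nat \<lfloor>B\<rfloor>)..int (nat \<lfloor>B\<rfloor>)}. coeff_mod n x y)"
  unfolding sum.cartesian_product
  by (rule sum.mono_neutral_cong_left)
    (auto simp: abs_le_floor_iff[OF assms(2)] abs_le_floor_iff[OF assms(3)] coeff_mod_def
      L_coeff_normalized_eq[OF n] simp del: atLeastAtMost_iff split: if_splits)

lemma sum_periodic_shift:
  fixes g :: "int \<Rightarrow> real"
  assumes "s > 0" "\<And>x. g (x mod int s) = g x"
  shows "(\<Sum>x\<in>{1..int s}. g x) = (\<Sum>x\<in>{0..<int s}. g x)"
proof -
  have "{1..int s} = insert (int s) {1..<int s}" "{0..<int s} = insert 0 {1..<int s}" using assms(1) by auto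
  then show ?thesis using assms(2)[of "int s"] by simp
qed

lemma mean_coeff_eq:
  assumes n: "odd n" "n > 1"
  defines "s \<equiv> max_squarefree_divisor n"
  shows "mean_coeff n = (\<Sum>a\<in>{0..<int s}. \<Sum>b\<in>{0..<int s}. coeff_mod n a b) / real s ^ 2"
proof -
  note ms = max_squarefree_divisor[of n]
  have s0: "s > 0" using ms n by (simp add: s_def)
  have dvd: "int p dvd int s" if "p \<in> prime_factors n" for p
    using that ms n unfolding s_def by (metis gr_implies_not0 in_prime_factors_imp_dvd int_dvd_int_iff neq0_conv)
  have "coeff_mod n (a mod int s) (b mod int s) = coeff_mod n a b" for a b
    by (rule coeff_mod_mod[OF n(2) dvd])
  then have per: "coeff_mod n (a mod int s) b = coeff_mod n a b" "coeff_mod n a (b mod int s) = coeff_mod n a b" for a b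
    by (metis mod_mod_trivial)+
  have "(\<Sum>(a, b) \<in> {(a, b). a \<in> {1..int s} \<and> b \<in> {1..int s} \<and> admissible n a b}. L_coeff_normalized (curve a b) n)
     = (\<Sum>a\<in>{1..int s}. \<Sum>b\<in>{1..int s}. coeff_mod n a b)"
    unfolding sum.cartesian_product
    by (rule sum.mono_neutral_cong_left) (auto simp: coeff_mod_def L_coeff_normalized_eq[OF n(1)] split: if_splits)
  also have "\<dots> = (\<Sum>a\<in>{0..<int s}. \<Sum>b\<in>{0..<int s}. coeff_mod n a b)"
    using sum_periodic_shift[OF s0, of "coeff_mod n a" for a]
      sum_periodic_shift[OF s0, of "\<lambda>a. \<Sum>b\<in>{0..<int s}. coeff_mod n a b"] per by simp
  finally show ?thesis by (simp add: mean_coeff_def s_def)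
qed

lemma odd_length_bounds:
  fixes A B :: real
  assumes "A \<ge> 1" "B \<ge> 1"
  defines "x \<equiv> real (2 * nat \<lfloor>A\<rfloor> + 1)" and "y \<equiv> real (2 * nat \<lfloor>B\<rfloor> + 1)"
  shows "x \<ge> 1" "y \<ge> 1" "x + y \<le> 3 * (A + B)" "\<bar>x * y - 4 * A * B\<bar> \<le> 3 * (A + B)"
proof -
  have A: "real (nat \<lfloor>A\<rfloor>) \<le> A" "A < real (nat \<lfloor>A\<rfloor>) + 1" using assms by linarith+
  have B: "real (nat \<lfloor>B\<rfloor>) \<le> B" "B < real (nat \<lfloor>B\<rfloor>) + 1" using assms by linarith+
  show x: "x \<ge> 1" and y: "y \<ge> 1" by (simp_all add: x_def y_def)
  have xu: "x \<le> 2 * A + 1" and yu: "y \<le> 2 * B + 1" using A B unfolding x_def y_def by linarith+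
  have "2 \<le> A + B" using assms(1,2) by linarith
  then show sum: "x + y \<le> 3 * (A + B)" using add_mono[OF xu yu] by (simp add: distrib_left)
  have d: "\<bar>x - 2 * A\<bar> \<le> 1" "\<bar>y - 2 * B\<bar> \<le> 1" using A B unfolding x_def y_def by linarith+
  have "x * y - 4 * A * B = (x - 2 * A) * y + 2 * A * (y - 2 * B)" by (simp add: algebra_simps)
  then have "\<bar>x * y - 4 * A * B\<bar> \<le> \<bar>(x - 2 * A) * y\<bar> + \<bar>2 * A * (y - 2 * B)\<bar>"
    by (simp only: abs_triangle_ineq)
  also have "\<dots> \<le> 1 * y + 2 * A * 1"
    unfolding abs_mult using d y assms(1) by (intro add_mono mult_mono) auto
  also have "\<dots> \<le> 3 * (A + B)" using yu assms(1,2) unfolding distrib_left by linarith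
  finally show "\<bar>x * y - 4 * A * B\<bar> \<le> 3 * (A + B)" .
qed

text \<open>Cubing is injective on the integers, so b determines a.\<close>

lemma singular_count_le:
  "card {(a, b). a \<in> {- int X..int X} \<and> b \<in> {- int Y..int Y} \<and> Delta a b = 0} \<le> 2 * Y + 1"
proof -
  let ?S = "{(a, b). a \<in> {- int X..int X} \<and> b \<in> {- int Y..int Y} \<and> Delta a b = 0}"
  have "inj_on snd ?S"
  proof (rule inj_onI, clarify, simp)
    fix a a' b assume "Delta a b = 0" "Delta a' b = 0"
    then have "a^3 = a'^3" by (simp add: Delta_def)
    then have "(a - a') * (a^2 + a * a' + a'^2) = 0" by (simp add: algebra_simps power2_eq_square power3_eq_cube)
    moreover have "a = a'" if "a^2 + a * a' + a'^2 = 0"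
    proof -
      have "(a + a')^2 + (a^2 + a'^2) = 0" using that by (simp add: algebra_simps power2_eq_square)
      then have "a^2 + a'^2 = 0" by (smt (verit) zero_le_power2)
      then show ?thesis by simp
    qed
    ultimately show "a = a'" by auto
  qed
  moreover have "snd ` ?S \<subseteq> {- int Y..int Y}" by auto
  ultimately have "card ?S \<le> card {- int Y..int Y}" by (intro card_inj_on_le) auto
  then show ?thesis by (simp add: nat_add_distrib nat_mult_distrib)
qed

text \<open>All coefficients are 1 here, so lattice points are counted. The singular pairs and the
  rounding of the sides cost 3(A + B) each.\<close>

lemma box_sum_modulus_one:
  assumes "A \<ge> 1" "B \<ge> 1"
  shows "\<bar>(\<Sum>(a, b) \<in> {(a, b). \<bar>real_of_int a\<bar> \<le> A \<and> \<bar>real_of_int b\<bar> \<le> B \<and> admissible 1 a b}.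
        L_coeff_normalized (curve a b) 1) - 4 * A * B * mean_coeff 1\<bar> \<le> 6 * (A + B)"
proof -
  define X Y where "X = nat \<lfloor>A\<rfloor>" and "Y = nat \<lfloor>B\<rfloor>"
  let ?Box = "{- int X..int X} \<times> {- int Y..int Y}"
  let ?S = "{(a, b). a \<in> {- int X..int X} \<and> b \<in> {- int Y..int Y} \<and> Delta a b = 0}"
  have one: "L_coeff_normalized W 1 = 1" for W by (simp add: L_coeff_normalized_def L_coeff_def)
  have adm: "admissible 1 a b \<longleftrightarrow> Delta a b \<noteq> 0" for a b by (simp add: admissible_def)
  have ms: "max_squarefree_divisor 1 = 1" using max_squarefree_divisor(1)[of 1] by simp
  have "{(a, b). a \<in> {1..int 1} \<and> b \<in> {1..int 1} \<and> admissible 1 a b} = {(1, 1)}"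
    unfolding adm by (auto simp: Delta_def)
  then have mean: "mean_coeff 1 = 1" unfolding mean_coeff_def ms by (simp only: one) simp
  have set: "{(a, b). \<bar>real_of_int a\<bar> \<le> A \<and> \<bar>real_of_int b\<bar> \<le> B \<and> admissible 1 a b} = ?Box - ?S"
    using abs_le_floor_iff[of A] abs_le_floor_iff[of B] assms unfolding adm X_def Y_def by auto
  have sub: "?S \<subseteq> ?Box" by auto
  then have finS: "finite ?S" by (rule finite_subset) simp
  have "(\<Sum>(a, b) \<in> ?Box - ?S. L_coeff_normalized (curve a b) 1) = real (card (?Box - ?S))"
    unfolding case_prod_unfold one by simp
  also have "\<dots> = real (card ?Box) - real (card ?S)"
    using card_Diff_subset[OF finS sub] card_mono[OF _ sub] by (simp add: of_nat_diff)
  also have "real (card ?Box) = real (2 * X + 1) * real (2 * Y + 1)"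
    by (simp add: card_cartesian_product nat_add_distrib nat_mult_distrib algebra_simps)
  finally have eq: "(\<Sum>(a, b) \<in> ?Box - ?S. L_coeff_normalized (curve a b) 1) = real (2 * X + 1) * real (2 * Y + 1) - real (card ?S)" .
  have "real (card ?S) \<le> real (2 * Y + 1)" using singular_count_le[of X Y] by (simp only: of_nat_le_iff)
  then have "real (card ?S) \<le> 3 * (A + B)"
    using odd_length_bounds(1,3)[OF assms] unfolding Y_def by linarith
  moreover have "\<bar>real (2 * X + 1) * real (2 * Y + 1) - 4 * A * B\<bar> \<le> 3 * (A + B)"
    unfolding X_def Y_def by (rule odd_length_bounds(4)[OF assms])
  moreover have "\<bar>P - c - Q * 1\<bar> \<le> 6 * T" if "c \<le> 3 * T" "\<bar>P - Q\<bar> \<le> 3 * T" "0 \<le> c" for P Q c T :: real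
    using that by linarith
  ultimately show ?thesis unfolding set eq mean by simp
qed

theorem theorem12:
  fixes \<epsilon> :: real and t :: nat
  assumes "\<epsilon> > 0"
  shows "\<exists>C>0. \<forall>(A::real) (B::real) (n::nat).
    A \<ge> 1 \<longrightarrow> B \<ge> 1 \<longrightarrow> odd n \<longrightarrow> card (prime_factors n) = t \<longrightarrow>
    \<bar>(\<Sum>(a, b) \<in> {(a, b). \<bar>real_of_int a\<bar> \<le> A \<and> \<bar>real_of_int b\<bar> \<le> B \<and> admissible n a b}.
        L_coeff_normalized (curve a b) n)
      - 4 * A * B * mean_coeff n\<bar>
    \<le> C * (real (num_divisors n) * real (max_squarefree_divisor n) powr (1/2 + \<epsilon>) * (A + B))"
proof -
  \<comment> \<open>The divisor bound, at arguments up to s^2, enters squared and the harmonic sum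
    enters once: the total is s^(4 \<eta> + \<eta>).\<close>
  define \<eta> where "\<eta> = \<epsilon> / 5"
  have \<eta>: "\<eta> > 0" using assms by (simp add: \<eta>_def)
  obtain C1 where C1: "C1 \<ge> 1" "\<And>n. n > 0 \<Longrightarrow> real (num_divisors n) \<le> C1 * real n powr \<eta>"
    using num_divisors_bound[OF \<eta>] by blast
  define C2 where "C2 = 1 + 2 / \<eta>"
  \<comment> \<open>There are at most 6^t fourth or sixth roots, and s \<le> 2^t phi(s), whence
    \<open>c\<close> below.\<close>
  define m where "m = (6::real) ^ t"
  define c where "c = sqrt (2 ^ t)"
  \<comment> \<open>54 is the 18 of \<open>box_sum_error\<close> times 3, from x + y \<le> 3(A + B).
    The 9 is 6 for boxes with a short side plus 3 for replacing x y by 4AB; it also covers the 6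
    needed at n = 1.\<close>
  define C where "C = 54 * c * m * C1^2 * C2 + 9"
  have C2: "C2 \<ge> 1" using \<eta> by (simp add: C2_def)
  have m0: "m \<ge> 0" and c0: "c \<ge> 0" by (simp_all add: m_def c_def)
  have C9: "C \<ge> 9" using C1 C2 m0 c0 by (simp add: C_def)
  show ?thesis
  proof (intro exI[of _ C] conjI allI impI)
    show "C > 0" using C9 by simp
  next
    fix A B :: real and n :: nat
    assume AB: "A \<ge> 1" "B \<ge> 1" and n: "odd n" and t: "card (prime_factors n) = t"
    let ?lhs = "\<bar>(\<Sum>(a, b) \<in> {(a, b). \<bar>real_of_int a\<bar> \<le> A \<and> \<bar>real_of_int b\<bar> \<le> B \<and> admissible n a b}.
        L_coeff_normalized (curve a b) n) - 4 * A * B * mean_coeff n\<bar>"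
    show "?lhs \<le> C * (real (num_divisors n) * real (max_squarefree_divisor n) powr (1/2 + \<epsilon>) * (A + B))"
    proof (cases "n = 1")
      case True
      have "max_squarefree_divisor 1 = 1" using max_squarefree_divisor(1)[of 1] by simp
      moreover have "num_divisors 1 = 1" by (simp add: num_divisors_def)
      moreover have "6 * (A + B) \<le> C * (A + B)" using C9 AB by (intro mult_right_mono) auto
      ultimately show ?thesis using box_sum_modulus_one[OF AB] unfolding True by simp
    next
      case False
      then have n1: "n > 1" using n by (cases n) auto
      define s where "s = max_squarefree_divisor n"
      have ms: "s dvd n" "squarefree s" "s > 0" "prime_factors s = prime_factors n"
        using max_squarefree_divisor[of n] n1 by (simp_all add: s_def)
      have "s \<noteq> 1"
      proof
        assume "s = 1"
        then have "prime_factors n = {}" using ms(4) by simp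
        then show False using n1 prime_factor_nat[of n] by (auto simp: prime_factors_dvd)
      qed
      then have s1: "s > 1" using ms(3) by simp
      define D where "D = real (num_divisors n)"
      define X Y where "X = nat \<lfloor>A\<rfloor>" and "Y = nat \<lfloor>B\<rfloor>"
      define x y where "x = real (2 * X + 1)" and "y = real (2 * Y + 1)"
      note xy = odd_length_bounds[OF AB, folded X_def Y_def, folded x_def y_def]
      define S where "S = (\<Sum>a\<in>{- int X..int X}. \<Sum>b\<in>{- int Y..int Y}. coeff_mod n a b)"
      define S0 where "S0 = (\<Sum>a\<in>{0..<int s}. \<Sum>b\<in>{0..<int s}. coeff_mod n a b)"
      have bound: "\<bar>coeff_mod n a b\<bar> \<le> D" for a b unfolding D_def by (rule coeff_mod_bound[OF n])
      have D0: "D \<ge> 0" by (simp add: D_def)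
      have absS: "\<bar>\<Sum>a\<in>I. \<Sum>b\<in>J. coeff_mod n a b\<bar> \<le> real (card I) * real (card J) * D" for I J
      proof -
        have "\<bar>\<Sum>a\<in>I. \<Sum>b\<in>J. coeff_mod n a b\<bar> \<le> (\<Sum>a\<in>I. \<Sum>b\<in>J. \<bar>coeff_mod n a b\<bar>)"
          by (intro order_trans[OF sum_abs] sum_mono sum_abs)
        also have "\<dots> \<le> (\<Sum>a\<in>I. \<Sum>b\<in>J. D)" by (intro sum_mono bound)
        finally show ?thesis by simp
      qed
      have mean: "mean_coeff n = S0 / real s ^ 2"
        unfolding S0_def s_def by (rule mean_coeff_eq[OF n n1])
      have absmean: "\<bar>mean_coeff n\<bar> \<le> D"
        using absS[of "{0..<int s}" "{0..<int s}"] s1 unfolding mean S0_def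
        by (simp add: power2_eq_square divide_le_eq mult_ac)
      define E where "E = sqrt (real s) * real s powr \<epsilon>"
      have powr_s: "real s powr \<epsilon> \<ge> 1" using s1 assms by (simp add: ge_one_powr_ge_zero)
      have E: "real s powr (1/2 + \<epsilon>) = E" using s1 by (simp add: E_def powr_add powr_half_sqrt)
      have sqrtE: "sqrt (real s) \<le> E"
        unfolding E_def using mult_left_mono[OF powr_s, of "sqrt (real s)"] by simp
      have "1 \<le> sqrt (real s)" using s1 by simp
      then have E1: "E \<ge> 1" using sqrtE by linarith
      have err: "\<bar>S - x * y * mean_coeff n\<bar> \<le> (54 * c * m * C1^2 * C2 + 6) * (D * E * (A + B))"
      proof (cases "x^2 \<ge> real s \<and> y^2 \<ge> real s")
        case True
        define K where "K = C1 * (real s ^ 2) powr \<eta>"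
        define L where "L = C2 * real s powr \<eta>"
        have L: "harmonic (s^2) \<le> L" unfolding L_def C2_def by (rule harmonic_square_bound[OF ms(3) \<eta>])
        have "real s powr \<eta> \<ge> 1" using s1 \<eta> by (simp add: ge_one_powr_ge_zero)
        then have L1: "L \<ge> 1" unfolding L_def using C2 mult_mono[of 1 C2 1 "real s powr \<eta>"] by simp
        have K: "real (num_divisors k) \<le> K" if "k \<in> {1..s^2}" for k
        proof -
          have "real (num_divisors k) \<le> C1 * real k powr \<eta>" using C1(2) that by simp
          also have "real k \<le> real (s^2)" using that by (simp only: of_nat_le_iff atLeastAtMost_iff)
          then have "C1 * real k powr \<eta> \<le> C1 * (real s ^ 2) powr \<eta>"
            using C1(1) \<eta> by (intro mult_left_mono powr_mono2) auto
          finally show ?thesis by (simp add: K_def)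
        qed
        have dvd: "int p dvd int s" if "p \<in> prime_factors n" for p
          using that ms(4) by (metis in_prime_factors_imp_dvd int_dvd_int_iff)
        have inv: "coeff_mod n (l^4 * a) (l^6 * b) = coeff_mod n a b" if "coprime l (int s)" for l a b
        proof (rule coeff_mod_twist[OF n1])
          fix p assume p: "p \<in> prime_factors n"
          then have "prime (int p)" by auto
          then show "\<not> int p dvd l" using that dvd[OF p] by (meson coprime_common_divisor not_prime_unit)
        qed
        have roots: "real (card {l \<in> units_mod s. int s dvd l ^ i - v}) \<le> m" if "0 < i" "i \<le> 6" for i v
        proof -
          have "card {l \<in> units_mod s. int s dvd l ^ i - v} \<le> i ^ t"
            using card_roots_le[OF ms(2) that(1), of v] ms(4) t by simp
          also have "\<dots> \<le> 6 ^ t" using that by (intro power_mono) auto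
          finally have "real (card {l \<in> units_mod s. int s dvd l ^ i - v}) \<le> real (6 ^ t)" by (simp only: of_nat_le_iff)
          then show ?thesis by (simp add: m_def)
        qed
        have r4: "real (card {l \<in> units_mod s. int s dvd l ^ 4 - v}) \<le> m" for v by (rule roots) auto
        have r6: "real (card {l \<in> units_mod s. int s dvd l ^ 6 - v}) \<le> m" for v by (rule roots) auto
        have units: "real s \<le> c^2 * real (card (units_mod s))"
          using card_units_mod_ge[OF s1] ms(4) t by (simp add: c_def)
        have pw: "((real s ^ 2) powr \<eta>)^2 * real s powr \<eta> = real s powr \<epsilon>"
        proof -
          have "real s ^ 2 = real s powr 2" using s1 by simp
          then have "(real s ^ 2) powr \<eta> = real s powr (2 * \<eta>)" by (simp only: powr_powr)
          then have "((real s ^ 2) powr \<eta>)^2 * real s powr \<eta> = real s powr (2 * \<eta>) * real s powr (2 * \<eta>) * real s powr \<eta>"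
            by (simp add: power2_eq_square)
          also have "\<dots> = real s powr \<epsilon>" by (simp add: powr_add[symmetric] \<eta>_def)
          finally show ?thesis .
        qed
        have "\<bar>S - x * y / real s ^ 2 * S0\<bar> \<le> 18 * c * m * K^2 * L * D * sqrt (real s) * (x + y)"
          unfolding S_def S0_def x_def y_def
          by (rule box_sum_error[where f = "coeff_mod n" and i = 4 and j = 6,
              OF ms(3) L L1 K coeff_mod_mod[OF n1 dvd] inv bound r4 r6 _ _ units c0])
            (use True in \<open>simp_all add: x_def y_def\<close>)
        also have "\<dots> \<le> 18 * c * m * K^2 * L * D * sqrt (real s) * (3 * (A + B))"
          using c0 m0 L1 D0 xy(3) by (intro mult_left_mono) auto
        also have "\<dots> = 54 * c * m * C1^2 * C2 * (D * (sqrt (real s) * (((real s ^ 2) powr \<eta>)^2 * real s powr \<eta>)) * (A + B))"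
          by (simp add: K_def L_def power_mult_distrib mult_ac)
        also have "\<dots> = 54 * c * m * C1^2 * C2 * (D * E * (A + B))"
          unfolding pw E_def ..
        also have "\<dots> \<le> (54 * c * m * C1^2 * C2 + 6) * (D * E * (A + B))"
          using D0 E1 AB by (intro mult_right_mono) auto
        finally show ?thesis by (simp add: mean)
      next
        case False
        \<comment> \<open>If one side is below sqrt(s), the number of lattice points is at most
          sqrt(s)(x + y), and the sum and its main term are each bounded trivially.\<close>
        have small: "u * v \<le> sqrt (real s) * (x + y)" if "u^2 < real s" "u \<ge> 1" "v \<ge> 1" "v \<le> x + y" for u v
        proof -
          have "u \<le> sqrt (real s)" using that by (intro real_le_rsqrt) simp
          then show ?thesis using that by (intro mult_mono) auto
        qed
        have "x * y \<le> sqrt (real s) * (x + y)"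
        proof (cases "x^2 < real s")
          case True then show ?thesis using small[of x y] xy by simp
        next
          case nx: False
          then have "y^2 < real s" using False by simp
          then show ?thesis using small[of y x] xy by (simp add: mult.commute)
        qed
        also have "\<dots> \<le> E * (3 * (A + B))" using sqrtE E1 xy by (intro mult_mono) auto
        finally have prod: "x * y \<le> E * (3 * (A + B))" .
        have "\<bar>S\<bar> \<le> x * y * D"
          using absS[where I = "{- int X..int X}" and J = "{- int Y..int Y}"]
          by (simp add: S_def x_def y_def add.commute)
        moreover have "\<bar>x * y * mean_coeff n\<bar> \<le> x * y * D"
          unfolding abs_mult using absmean xy by (intro mult_mono) auto
        ultimately have "\<bar>S - x * y * mean_coeff n\<bar> \<le> x * y * D + x * y * D" by linarith
        then have "\<bar>S - x * y * mean_coeff n\<bar> \<le> 2 * D * (x * y)" by simp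
        also have "\<dots> \<le> 2 * D * (E * (3 * (A + B)))" using prod D0 by (intro mult_left_mono) auto
        also have "\<dots> = 6 * (D * E * (A + B))" by simp
        also have "\<dots> \<le> (54 * c * m * C1^2 * C2 + 6) * (D * E * (A + B))"
          using D0 E1 AB c0 m0 C1 C2 by (intro mult_right_mono) auto
        finally show ?thesis .
      qed
      \<comment> \<open>Passing from the number of lattice points to the area costs a boundary term
        times the mean, which is at most d(n).\<close>
      have main: "\<bar>(x * y - 4 * A * B) * mean_coeff n\<bar> \<le> 3 * (D * E * (A + B))"
      proof -
        have "\<bar>(x * y - 4 * A * B) * mean_coeff n\<bar> \<le> (3 * (A + B)) * D"
          unfolding abs_mult using xy absmean AB by (intro mult_mono) auto
        also have "\<dots> \<le> (3 * (A + B)) * (D * E)"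
          using mult_left_mono[OF E1 D0] AB by (intro mult_left_mono) auto
        finally show ?thesis by (simp add: mult_ac)
      qed
      have "?lhs = \<bar>S - 4 * A * B * mean_coeff n\<bar>"
        using sum_admissible_box[OF n, of A B] AB by (simp add: S_def X_def Y_def)
      also have "\<dots> = \<bar>(S - x * y * mean_coeff n) + (x * y - 4 * A * B) * mean_coeff n\<bar>"
        by (simp add: algebra_simps)
      also have "\<dots> \<le> (54 * c * m * C1^2 * C2 + 6) * (D * E * (A + B)) + 3 * (D * E * (A + B))"
        by (rule order_trans[OF abs_triangle_ineq add_mono[OF err main]])
      also have "\<dots> = C * (D * E * (A + B))" by (simp add: C_def algebra_simps)
      finally show ?thesis unfolding D_def s_def[symmetric] E .
    qed
  qed
qed

end
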